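(* Let $(M,J)$ be a complex manifold with a pluriclosed Hermitian metric $g$ (fundamental form $\omega$, $\partial\bar\partial\omega=0$). Then for any smooth covariant tensor field $A$ on $M$, $$\Delta|A|^2=(\Delta A,A)+(A,\Delta A)+|\nabla A|^2+|\overline{\nabla}A|^2-(A,P\circ A)-(A,Q\circ A).$$
   Context: Locally $\omega=\sqrt{-1}\,g_{i\bar j}\,dz^i\wedge d\bar z^j$, with inverse matrix $(g^{\bar j i})$. $\nabla$ is the Chern connection, with $\Gamma_{ij}^{s}=g^{\bar t s}\partial_i g_{j\bar t}$ and torsion $T_{ij\bar t}=\partial_i g_{j\bar t}-\partial_j g_{i\bar t}$. $\nabla A$ and $\overline{\nabla}A$ denote the $(1,0)$- and $(0,1)$-parts of the covariant derivative (components $\nabla_iA_{\cdots}$, $\nabla_{\bar i}A_{\cdots}$), and $\Delta=g^{\bar q p}\nabla_p\nabla_{\bar q}$ is the Chern Laplacian. $(\cdot,\cdot)=g(\cdot,\overline{\cdot})$ is the pointwise Hermitian inner product on complex tensors and $|A|^2=(A,A)$ (full tensor norms, no combinatorial factors). $P$ is defined by $\rho^{1,1}=\sqrt{-1}\,P_{i\bar j}\,dz^i\wedge d\bar z^j$, where $\rho^{1,1}=-\partial\partial^*\omega-\bar\partial\bar\partial^*\omega-\sqrt{-1}\,\partial\bar\partial\log\det g$ is the $(1,1)$-part of the Bismut Ricci form ($\partial^*,\bar\partial^*$ formal $L^2$-adjoints). $Q$ is defined by $Q_{i\bar j}=g^{\bar q p}g^{\bar t s}T_{is\bar q}\overline{T_{jt\bar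 p}}$. For a tensor $A_{i\bar j}$ and a tensor $B_{p_1\cdots p_s\bar q_1\cdots\bar q_t}$, the tensor $A\circ B$ is $$(A\circ B)_{p_1\cdots p_s\bar q_1\cdots\bar q_t}=-\sum_{m=1}^{s}g^{\bar\beta\alpha}A_{p_m\bar\beta}B_{\cdots p_{m-1}\alpha p_{m+1}\cdots}+\sum_{r=1}^{t}g^{\bar\beta\alpha}A_{\alpha\bar q_r}B_{\cdots\bar q_{r-1}\bar\beta\bar q_{r+1}\cdots}.$$ *)

theory Defs
  imports "HOL-Analysis.Analysis"
begin

section \<open>Smooth and holomorphic maps\<close>

text \<open>Real differentiability classes; used for open \<open>S\<close> only.\<close>

primrec Ck_on :: "nat \<Rightarrow> 'a::real_normed_vector set \<Rightarrow> ('a \<Rightarrow> 'b::real_normed_vector) \<Rightarrow> bool"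
where
  "Ck_on 0 S f = continuous_on S f"
| "Ck_on (Suc k) S f =
     (f differentiable_on S \<and> (\<forall>v. Ck_on k S (\<lambda>x. frechet_derivative f (at x) v)))"

definition smooth_on :: "'a::real_normed_vector set \<Rightarrow> ('a \<Rightarrow> 'b::real_normed_vector) \<Rightarrow> bool" where
  "smooth_on S f \<longleftrightarrow> (\<forall>k. Ck_on k S f)"

definition holomorphic_map_on :: "(complex^'n) set \<Rightarrow> (complex^'n \<Rightarrow> complex^'n) \<Rightarrow> bool" where
  "holomorphic_map_on S f \<longleftrightarrow>
     (\<forall>x\<in>S. \<exists>f'. (f has_derivative f') (at x) \<and> (\<forall>c v. f' (c *s v) = c *s f' v))"


section \<open>Complex manifolds and tensor fields\<close>

text \<open>A chart is a coordinate domain together with a coordinate map (whose values off the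
  domain are irrelevant).\<close>

type_synonym ('m, 'n) chart = "'m set \<times> ('m \<Rightarrow> complex^'n)"

definition complex_atlas ::
  "('m::{t2_space,second_countable_topology}, 'n::finite) chart set \<Rightarrow> bool" where
  "complex_atlas \<A> \<longleftrightarrow>
     (\<Union>(U,\<phi>)\<in>\<A>. U) = UNIV \<and>
     (\<forall>(U,\<phi>)\<in>\<A>. open U \<and> open (\<phi> ` U) \<and> homeomorphism U (\<phi> ` U) \<phi> (inv_into U \<phi>)) \<and>
     (\<forall>(U,\<phi>)\<in>\<A>. \<forall>(V,\<psi>)\<in>\<A>. holomorphic_map_on (\<phi> ` (U \<inter> V)) (\<psi> \<circ> inv_into U \<phi>))"

text \<open>Indices of complexified tensors: \<open>Inl i\<close> stands for the index \<open>i\<close> (i.e. \<open>dz\<^sup>i\<close> or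
  \<open>\<partial>/\<partial>z\<^sup>i\<close>), \<open>Inr i\<close> for the barred index. The components of a complex covariant tensor of
  rank \<open>r\<close> are its values on index lists of length \<open>r\<close>; holomorphic and antiholomorphic slots
  may come in any order. Values on lists of other lengths are irrelevant.\<close>

type_synonym 'n idx = "'n + 'n"
type_synonym 'n tens = "'n idx list \<Rightarrow> complex"
type_synonym 'n tens_field = "complex^'n \<Rightarrow> 'n tens"

definition coord :: "complex^'n \<Rightarrow> 'n idx \<Rightarrow> complex" where
  "coord z a = (case a of Inl i \<Rightarrow> z $ i | Inr i \<Rightarrow> cnj (z $ i))"

text \<open>The Wirtinger derivatives \<open>\<partial>/\<partial>z\<^sup>i\<close> and \<open>\<partial>/\<partial>\<bar>z\<^sup>i\<close>.\<close>

definition wirt :: "'n::finite idx \<Rightarrow> (complex^'n \<Rightarrow> complex) \<Rightarrow> complex^'n \<Rightarrow> complex" where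
  "wirt a f x = (case a of
     Inl i \<Rightarrow> (frechet_derivative f (at x) (axis i 1)
               - \<i> * frechet_derivative f (at x) (axis i \<i>)) / 2
   | Inr i \<Rightarrow> (frechet_derivative f (at x) (axis i 1)
               + \<i> * frechet_derivative f (at x) (axis i \<i>)) / 2)"

text \<open>A tensor field on the manifold: components in every chart, smooth in the coordinates, and
  related on overlaps by the tensorial transformation law.\<close>

definition tensor_field ::
  "('m, 'n::finite) chart set \<Rightarrow> nat \<Rightarrow> (('m, 'n) chart \<Rightarrow> 'n tens_field) \<Rightarrow> bool" where
  "tensor_field \<A> r A \<longleftrightarrow>
     (\<forall>(U,\<phi>)\<in>\<A>. \<forall>as. length as = r \<longrightarrow> smooth_on (\<phi> ` U) (\<lambda>x. A (U,\<phi>) x as)) \<and>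
     (\<forall>(U,\<phi>)\<in>\<A>. \<forall>(V,\<psi>)\<in>\<A>. \<forall>p \<in> U \<inter> V. \<forall>as. length as = r \<longrightarrow>
        A (U,\<phi>) (\<phi> p) as =
          (\<Sum>bs | length bs = r.
             (\<Prod>m<r. wirt (as ! m) (\<lambda>x. coord (\<psi> (inv_into U \<phi> x)) (bs ! m)) (\<phi> p))
             * A (V,\<psi>) (\<psi> p) bs))"


section \<open>Hermitian metrics\<close>

text \<open>A Hermitian metric is given in a chart by the matrix \<open>G $ i $ j = g\<^bsub>i\<bar>j\<^esub>\<close>. The next two
  definitions are the components of the complex bilinear extension of \<open>g\<close> and of
  \<open>\<omega> = \<i> g\<^bsub>i\<bar>j\<^esub> dz\<^sup>i \<and> d\<bar>z\<^sup>j\<close>.\<close>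

definition metric_tens :: "complex^'n^'n \<Rightarrow> 'n tens" where
  "metric_tens G as = (case as of
     [Inl i, Inr j] \<Rightarrow> G $ i $ j
   | [Inr j, Inl i] \<Rightarrow> G $ i $ j
   | _ \<Rightarrow> 0)"

definition fund_form :: "complex^'n^'n \<Rightarrow> 'n tens" where
  "fund_form G as = (case as of
     [Inl i, Inr j] \<Rightarrow> \<i> * G $ i $ j
   | [Inr j, Inl i] \<Rightarrow> - \<i> * G $ i $ j
   | _ \<Rightarrow> 0)"

definition hermitian_metric ::
  "('m, 'n::finite) chart set \<Rightarrow> (('m, 'n) chart \<Rightarrow> complex^'n \<Rightarrow> complex^'n^'n) \<Rightarrow> bool" where
  "hermitian_metric \<A> g \<longleftrightarrow>
     tensor_field \<A> 2 (\<lambda>c x. metric_tens (g c x)) \<and>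
     (\<forall>(U,\<phi>)\<in>\<A>. \<forall>x \<in> \<phi> ` U.
        (\<forall>i j. g (U,\<phi>) x $ j $ i = cnj (g (U,\<phi>) x $ i $ j)) \<and>
        (\<forall>v. v \<noteq> 0 \<longrightarrow> 0 < Re (\<Sum>i\<in>UNIV. \<Sum>j\<in>UNIV. g (U,\<phi>) x $ i $ j * v $ i * cnj (v $ j))))"

text \<open>\<open>ginv G j i\<close> is \<open>g\<^bsup>\<bar>j i\<^esup>\<close>, i.e. \<open>\<Sum>i. g\<^bsup>\<bar>j i\<^esup> g\<^bsub>i\<bar>k\<^esub> = \<delta>\<^bsub>jk\<^esub>\<close>.\<close>

definition ginv :: "complex^'n::finite^'n \<Rightarrow> 'n \<Rightarrow> 'n \<Rightarrow> complex" where
  "ginv G j i = matrix_inv G $ j $ i"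

text \<open>The pairing \<open>(e\<^sup>a, e\<^sup>b) = g(e\<^sup>a, \<bar>e\<^sup>b)\<close> of the coframe \<open>dz\<^sup>i, d\<bar>z\<^sup>i\<close>, and the induced Hermitian
  product of rank \<open>r\<close> tensors (without combinatorial factors).\<close>

definition coframe_inner :: "complex^'n::finite^'n \<Rightarrow> 'n idx \<Rightarrow> 'n idx \<Rightarrow> complex" where
  "coframe_inner G a b = (case (a, b) of
     (Inl i, Inl j) \<Rightarrow> ginv G j i
   | (Inr i, Inr j) \<Rightarrow> ginv G i j
   | _ \<Rightarrow> 0)"

definition tens_inner :: "complex^'n::finite^'n \<Rightarrow> nat \<Rightarrow> 'n tens \<Rightarrow> 'n tens \<Rightarrow> complex" where
  "tens_inner G r A B =
     (\<Sum>as | length as = r. \<Sum>bs | length bs = r.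
        (\<Prod>m<r. coframe_inner G (as ! m) (bs ! m)) * A as * cnj (B bs))"


section \<open>Chern connection\<close>

definition christoffel ::
  "(complex^'n::finite \<Rightarrow> complex^'n^'n) \<Rightarrow> complex^'n \<Rightarrow> 'n \<Rightarrow> 'n \<Rightarrow> 'n \<Rightarrow> complex" where
  "christoffel g x i j s = (\<Sum>t\<in>UNIV. ginv (g x) t s * wirt (Inl i) (\<lambda>y. g y $ j $ t) x)"

text \<open>All connection coefficients: \<open>\<nabla>\<^sub>a e\<^sub>b = \<Sum>c. conn g x a b c e\<^sub>c\<close> for the frame
  \<open>\<partial>/\<partial>z\<^sup>i, \<partial>/\<partial>\<bar>z\<^sup>i\<close>. The only nonzero ones are \<open>\<Gamma>\<^bsub>ij\<^esub>\<^sup>s\<close> and their conjugates.\<close>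

definition conn ::
  "(complex^'n::finite \<Rightarrow> complex^'n^'n) \<Rightarrow> complex^'n \<Rightarrow> 'n idx \<Rightarrow> 'n idx \<Rightarrow> 'n idx \<Rightarrow> complex" where
  "conn g x a b c = (case (a, b, c) of
     (Inl i, Inl j, Inl s) \<Rightarrow> christoffel g x i j s
   | (Inr i, Inr j, Inr s) \<Rightarrow> cnj (christoffel g x i j s)
   | _ \<Rightarrow> 0)"

text \<open>The full covariant derivative, with the differentiation index put first, and its
  (1,0)- and (0,1)-parts.\<close>

definition nabla :: "(complex^'n::finite \<Rightarrow> complex^'n^'n) \<Rightarrow> 'n tens_field \<Rightarrow> 'n tens_field" where
  "nabla g A x as = (case as of
     [] \<Rightarrow> 0
   | a # bs \<Rightarrow> wirt a (\<lambda>y. A y bs) x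
        - (\<Sum>m<length bs. \<Sum>c\<in>UNIV. conn g x a (bs ! m) c * A x (bs[m := c])))"

definition nabla10 :: "(complex^'n::finite \<Rightarrow> complex^'n^'n) \<Rightarrow> 'n tens_field \<Rightarrow> 'n tens_field" where
  "nabla10 g A x as = (if as \<noteq> [] \<and> isl (hd as) then nabla g A x as else 0)"

definition nabla01 :: "(complex^'n::finite \<Rightarrow> complex^'n^'n) \<Rightarrow> 'n tens_field \<Rightarrow> 'n tens_field" where
  "nabla01 g A x as = (if as \<noteq> [] \<and> \<not> isl (hd as) then nabla g A x as else 0)"

definition chern_laplacian ::
  "(complex^'n::finite \<Rightarrow> complex^'n^'n) \<Rightarrow> 'n tens_field \<Rightarrow> 'n tens_field" where
  "chern_laplacian g A x as =
     (\<Sum>p\<in>UNIV. \<Sum>q\<in>UNIV. ginv (g x) q p * nabla g (nabla g A) x (Inl p # Inr q # as))"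

definition torsion ::
  "(complex^'n::finite \<Rightarrow> complex^'n^'n) \<Rightarrow> complex^'n \<Rightarrow> 'n \<Rightarrow> 'n \<Rightarrow> 'n \<Rightarrow> complex" where
  "torsion g x i j t = wirt (Inl i) (\<lambda>y. g y $ j $ t) x - wirt (Inl j) (\<lambda>y. g y $ i $ t) x"

definition torsion_Q :: "(complex^'n::finite \<Rightarrow> complex^'n^'n) \<Rightarrow> complex^'n \<Rightarrow> complex^'n^'n" where
  "torsion_Q g x = (\<chi> i j. \<Sum>p\<in>UNIV. \<Sum>q\<in>UNIV. \<Sum>s\<in>UNIV. \<Sum>t\<in>UNIV.
     ginv (g x) q p * ginv (g x) t s * torsion g x i s q * cnj (torsion g x j t p))"

text \<open>The operation \<open>A \<circ> B\<close>, slot by slot, for \<open>B\<close> with components on index lists.\<close>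

definition circ :: "complex^'n::finite^'n \<Rightarrow> complex^'n^'n \<Rightarrow> 'n tens \<Rightarrow> 'n tens" where
  "circ G A B as = (\<Sum>m<length as. case as ! m of
     Inl p \<Rightarrow> - (\<Sum>\<alpha>\<in>UNIV. \<Sum>\<beta>\<in>UNIV. ginv G \<beta> \<alpha> * A $ p $ \<beta> * B (as[m := Inl \<alpha>]))
   | Inr q \<Rightarrow> (\<Sum>\<alpha>\<in>UNIV. \<Sum>\<beta>\<in>UNIV. ginv G \<beta> \<alpha> * A $ \<alpha> $ q * B (as[m := Inr \<beta>])))"


section \<open>Differential forms\<close>

text \<open>A \<open>k\<close>-form \<open>\<alpha> = 1/k! \<Sum> \<alpha>\<^bsub>a\<^sub>1\<dots>a\<^sub>k\<^esub> e\<^bsup>a\<^sub>1\<^esup> \<and> \<dots> \<and> e\<^bsup>a\<^sub>k\<^esup>\<close> is represented by its alternating components.\<close>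

definition alternating :: "nat \<Rightarrow> 'n tens \<Rightarrow> bool" where
  "alternating k \<alpha> \<longleftrightarrow> (\<forall>as i j. length as = k \<longrightarrow> i < j \<longrightarrow> j < k \<longrightarrow>
     \<alpha> (as[i := as ! j, j := as ! i]) = - \<alpha> as)"

definition smooth_form_on :: "(complex^'n::finite) set \<Rightarrow> nat \<Rightarrow> 'n tens_field \<Rightarrow> bool" where
  "smooth_form_on S k \<alpha> \<longleftrightarrow>
     (\<forall>as. length as = k \<longrightarrow> smooth_on S (\<lambda>x. \<alpha> x as)) \<and> (\<forall>x\<in>S. alternating k (\<alpha> x))"

definition test_form :: "(complex^'n::finite) set \<Rightarrow> nat \<Rightarrow> 'n tens_field \<Rightarrow> bool" where
  "test_form S k \<eta> \<longleftrightarrow> smooth_form_on UNIV k \<eta> \<and>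
     (\<exists>K. compact K \<and> K \<subseteq> S \<and> (\<forall>x as. x \<notin> K \<longrightarrow> length as = k \<longrightarrow> \<eta> x as = 0))"

text \<open>\<open>d\<alpha>\<close> has components \<open>\<Sum>m. (-1)\<^sup>m \<partial>\<^bsub>a\<^sub>m\<^esub> \<alpha>\<^bsub>\<dots>\<^esub>\<close> with \<open>a\<^sub>m\<close> omitted (\<open>m\<close> counted from 0); \<open>\<partial>\<close> and
  \<open>\<partial>\<bar>\<close> keep the terms with \<open>a\<^sub>m\<close> unbarred and barred, respectively.\<close>

definition dolb :: "'n::finite tens_field \<Rightarrow> 'n tens_field" where
  "dolb \<alpha> x as = (\<Sum>m | m < length as \<and> isl (as ! m).
     (-1) ^ m * wirt (as ! m) (\<lambda>y. \<alpha> y (take m as @ drop (Suc m) as)) x)"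

definition dolbbar :: "'n::finite tens_field \<Rightarrow> 'n tens_field" where
  "dolbbar \<alpha> x as = (\<Sum>m | m < length as \<and> \<not> isl (as ! m).
     (-1) ^ m * wirt (as ! m) (\<lambda>y. \<alpha> y (take m as @ drop (Suc m) as)) x)"

definition pluriclosed ::
  "('m, 'n::finite) chart set \<Rightarrow> (('m, 'n) chart \<Rightarrow> complex^'n \<Rightarrow> complex^'n^'n) \<Rightarrow> bool" where
  "pluriclosed \<A> g \<longleftrightarrow> (\<forall>(U,\<phi>)\<in>\<A>. \<forall>x \<in> \<phi> ` U. \<forall>as. length as = 4 \<longrightarrow>
     dolb (dolbbar (\<lambda>y. fund_form (g (U,\<phi>) y))) x as = 0)"

text \<open>The usual inner product of \<open>k\<close>-forms, for which \<open>e\<^bsup>a\<^sub>1\<^esup> \<and> \<dots> \<and> e\<^bsup>a\<^sub>k\<^esup>\<close> (\<open>a\<^sub>1 < \<dots> < a\<^sub>k\<close>) are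
  orthonormal whenever the \<open>e\<^sup>a\<close> are. With the tensor product in place of this one, the
  adjoints below would be off by a factor of the degree.\<close>

definition form_inner :: "complex^'n::finite^'n \<Rightarrow> nat \<Rightarrow> 'n tens \<Rightarrow> 'n tens \<Rightarrow> complex" where
  "form_inner G k \<alpha> \<beta> = tens_inner G k \<alpha> \<beta> / fact k"

text \<open>\<open>\<theta>\<close> is the image of the \<open>(k+1)\<close>-form \<open>\<beta>\<close> under the formal \<open>L\<^sup>2\<close>-adjoint of the operator \<open>D\<close> on
  \<open>k\<close>-forms. The volume form of \<open>g\<close> is a constant multiple of \<open>det g\<close> times Lebesgue measure.
  Formal adjoints are local, so testing against forms compactly supported in the coordinate
  domain \<open>S\<close> determines \<open>\<theta>\<close> on \<open>S\<close>; the choice in \<open>formal_adjoint\<close> is unique on \<open>S\<close>.\<close>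

definition is_formal_adjoint ::
  "('n::finite tens_field \<Rightarrow> 'n tens_field) \<Rightarrow> (complex^'n) set \<Rightarrow> (complex^'n \<Rightarrow> complex^'n^'n) \<Rightarrow>
   nat \<Rightarrow> 'n tens_field \<Rightarrow> 'n tens_field \<Rightarrow> bool" where
  "is_formal_adjoint D S g k \<beta> \<theta> \<longleftrightarrow> smooth_form_on S k \<theta> \<and>
     (\<forall>\<eta>. test_form S k \<eta> \<longrightarrow>
        (LINT x:S|lborel. form_inner (g x) (Suc k) (D \<eta> x) (\<beta> x) * det (g x)) =
        (LINT x:S|lborel. form_inner (g x) k (\<eta> x) (\<theta> x) * det (g x)))"

definition formal_adjoint ::
  "('n::finite tens_field \<Rightarrow> 'n tens_field) \<Rightarrow> (complex^'n) set \<Rightarrow> (complex^'n \<Rightarrow> complex^'n^'n) \<Rightarrow>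
   nat \<Rightarrow> 'n tens_field \<Rightarrow> 'n tens_field" where
  "formal_adjoint D S g k \<beta> = (SOME \<theta>. is_formal_adjoint D S g k \<beta> \<theta>)"

definition log_det :: "(complex^'n::finite \<Rightarrow> complex^'n^'n) \<Rightarrow> 'n tens_field" where
  "log_det g x as = complex_of_real (ln (Re (det (g x))))"

text \<open>The (1,1)-part of the Bismut Ricci form.\<close>

definition bismut_rho11 ::
  "(complex^'n::finite) set \<Rightarrow> (complex^'n \<Rightarrow> complex^'n^'n) \<Rightarrow> 'n tens_field" where
  "bismut_rho11 S g x as =
     - dolb (formal_adjoint dolb S g 1 (\<lambda>y. fund_form (g y))) x as
     - dolbbar (formal_adjoint dolbbar S g 1 (\<lambda>y. fund_form (g y))) x as
     - \<i> * dolb (dolbbar (log_det g)) x as"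

definition bismut_P ::
  "(complex^'n::finite) set \<Rightarrow> (complex^'n \<Rightarrow> complex^'n^'n) \<Rightarrow> complex^'n \<Rightarrow> complex^'n^'n" where
  "bismut_P S g x = (\<chi> i j. bismut_rho11 S g x [Inl i, Inr j] / \<i>)"

end

theory Submission
  imports Defs
begin

text \<open>The idea is to differentiate \<open>|A|\<^sup>2 = (A, A)\<close> twice. The Chern connection preserves the metric
(\<open>metric_compatible\<close>), so \<open>\<partial>\<^sub>p \<partial>\<^bsub>\<bar>q\<^esub> (A, A)\<close> is the sum of \<open>(\<nabla>\<^sub>p \<nabla>\<^bsub>\<bar>q\<^esub> A, A)\<close>,
\<open>(\<nabla>\<^bsub>\<bar>q\<^esub> A, \<nabla>\<^bsub>\<bar>p\<^esub> A)\<close>, \<open>(\<nabla>\<^sub>p A, \<nabla>\<^sub>q A)\<close> and \<open>(A, \<nabla>\<^bsub>\<bar>p\<^esub> \<nabla>\<^sub>q A)\<close>. Contracted with the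
inverse metric, the first three give \<open>(\<Delta>A, A)\<close>, \<open>|\<nabla>\<bar>A|\<^sup>2\<close> and \<open>|\<nabla>A|\<^sup>2\<close>; the fourth pairs \<open>A\<close>
with the conjugate Laplacian of \<open>A\<close>. Covariant derivatives in an unbarred and a barred direction
commute up to curvature only, because the connection coefficients with mixed lower indices vanish.
The trace of the curvature over the two directions of differentiation is the second Ricci curvature
\<open>S\<close> of the Chern connection, and it acts slot by slot, exactly as in the operation \<open>\<circ>\<close>. Hence, for
an arbitrary Hermitian metric, the conjugate Laplacian is \<open>\<Delta>A - S \<circ> A\<close>, and the formula holds with
\<open>S\<close> in the place of \<open>P + Q\<close> (\<open>bochner_formula\<close>).

It remains to see that \<open>S = P + Q\<close> for pluriclosed metrics (\<open>bismut_P_plus_torsion_Q\<close>). Let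
\<open>\<tau>\<^sub>k = g\<^bsup>\<bar>l i\<^esup> T\<^bsub>ki\<bar>l\<^esub>\<close> be the trace of the torsion. Integration by parts, together with the formula for
the divergence of \<open>g\<^bsup>\<bar>j i\<^esup> det g\<close> (\<open>divergence_ginv\<close>), shows that the adjoints \<open>\<partial>\<^sup>*\<omega>\<close> and
\<open>\<partial>\<bar>\<^sup>*\<omega>\<close> have the components \<open>- \<i> \<tau>\<bar>\<^sub>k\<close> and \<open>\<i> \<tau>\<^sub>k\<close>, so that
\<open>P\<^bsub>i\<bar>j\<^esub> = \<partial>\<^sub>i \<tau>\<bar>\<^sub>j + \<partial>\<^bsub>\<bar>j\<^esub> \<tau>\<^sub>i - \<partial>\<^sub>i \<partial>\<^bsub>\<bar>j\<^esub> log det g\<close> (\<open>bismut_P_eq\<close>). The second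
derivatives of \<open>g\<close> occur in this expression in exactly the combination that \<open>\<partial>\<partial>\<bar>\<omega> = 0\<close> turns into
\<open>- g\<^bsup>\<bar>l k\<^esup> \<partial>\<^sub>k \<partial>\<^bsub>\<bar>l\<^esub> g\<^bsub>i\<bar>j\<^esub>\<close> (\<open>pluriclosed_identity\<close>), which is the second order part of \<open>S\<close>. The
remaining terms of \<open>P\<close>, \<open>Q\<close> and \<open>S\<close> are contractions of products of first derivatives of \<open>g\<close>, and
they agree by expanding the products.

The formal adjoints are defined by testing against compactly supported forms. To know them one
needs that a compactly supported derivative has integral zero (\<open>integral_wirt_eq_0\<close>) and that
there are enough test forms to determine a continuous function (\<open>fundamental_lemma\<close>), hence smooth
bump functions.\<close>

section \<open>Calculus of smooth functions\<close>

lemma frechet_derivative_cong_open: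
  assumes "open S" "x \<in> S" "\<And>y. y \<in> S \<Longrightarrow> f y = g y"
  shows "frechet_derivative f (at x) = frechet_derivative g (at x)"
proof -
  have "(f has_derivative D) (at x) \<longleftrightarrow> (g has_derivative D) (at x)" for D
    using assms has_derivative_transform_within_open[of f D x UNIV S g]
      has_derivative_transform_within_open[of g D x UNIV S f] by auto
  then show ?thesis by (simp add: frechet_derivative_def)
qed

lemma differentiable_cong_open:
  assumes "open S" "x \<in> S" "\<And>y. y \<in> S \<Longrightarrow> f y = g y" "f differentiable (at x)"
  shows "g differentiable (at x)"
  using assms has_derivative_transform_within_open[of f _ x UNIV S g]
  unfolding differentiable_def by blast

text \<open>On an open set differentiability within the set is differentiability at each point. This is the
form of the recursion that all proofs below use, so the defining equation is not left to the
simplifier.\<close>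

lemma Ck_on_Suc_iff:
  assumes "open S"
  shows "Ck_on (Suc k) S f \<longleftrightarrow> (\<forall>x\<in>S. f differentiable (at x)) \<and>
    (\<forall>v. Ck_on k S (\<lambda>x. frechet_derivative f (at x) v))"
  using differentiable_on_eq_differentiable_at[OF assms, of f] by auto

declare Ck_on.simps(2) [simp del]

lemma Ck_on_cong:
  assumes "open S" "\<And>y. y \<in> S \<Longrightarrow> f y = g y" "Ck_on k S f"
  shows "Ck_on k S g"
  using assms(2,3)
proof (induction k arbitrary: f g)
  case 0
  then show ?case using continuous_on_cong[of S S f g] by auto
next
  case (Suc k)
  have "g differentiable (at x)" if "x \<in> S" for x
    using differentiable_cong_open[OF assms(1) that, of f g] Suc.prems that
    unfolding Ck_on_Suc_iff[OF assms(1)] by blast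
  moreover have "Ck_on k S (\<lambda>x. frechet_derivative g (at x) v)" for v
  proof (rule Suc.IH)
    show "frechet_derivative f (at y) v = frechet_derivative g (at y) v" if "y \<in> S" for y
      using frechet_derivative_cong_open[OF assms(1) that Suc.prems(1)] by simp
    show "Ck_on k S (\<lambda>x. frechet_derivative f (at x) v)"
      using Suc.prems(2) unfolding Ck_on_Suc_iff[OF assms(1)] by blast
  qed
  ultimately show ?case unfolding Ck_on_Suc_iff[OF assms(1)] by blast
qed

lemma Ck_on_lower:
  assumes "Ck_on (Suc k) S f"
  shows "Ck_on k S f"
  using assms
proof (induction k arbitrary: f)
  case 0
  then show ?case by (auto simp: Ck_on.simps(2) intro: differentiable_imp_continuous_on)
next
  case (Suc k)
  then show ?case unfolding Ck_on.simps(2)[of "Suc k"] Ck_on.simps(2)[of k] by blast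
qed

text \<open>Any explicit derivative may be used in place of the chosen one; the derivative of a product or of an
inverse is then again covered by the induction hypothesis.\<close>

lemma Ck_on_SucI:
  assumes "open S" "\<And>x. x \<in> S \<Longrightarrow> (f has_derivative D x) (at x)" "\<And>v. Ck_on k S (\<lambda>x. D x v)"
  shows "Ck_on (Suc k) S f"
  unfolding Ck_on_Suc_iff[OF assms(1)]
proof (intro conjI ballI allI)
  show "f differentiable at x" if "x \<in> S" for x using assms(2)[OF that] by (auto simp: differentiable_def)
  show "Ck_on k S (\<lambda>x. frechet_derivative f (at x) v)" for v
    by (rule Ck_on_cong[OF assms(1) _ assms(3)[of v]]) (simp add: frechet_derivative_at[OF assms(2), symmetric])
qed

lemma Ck_on_Suc_has_derivative:
  assumes "open S" "Ck_on (Suc k) S f" "x \<in> S"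
  shows "(f has_derivative frechet_derivative f (at x)) (at x)"
  using assms(2,3) unfolding Ck_on_Suc_iff[OF assms(1)] frechet_derivative_works by blast

lemma Ck_on_const [simp]:
  assumes "open S"
  shows "Ck_on k S (\<lambda>_. c)"
proof (induction k arbitrary: c)
  case (Suc k)
  show ?case by (intro Ck_on_SucI[OF assms, where D="\<lambda>_ _. 0"] has_derivative_const Suc)
qed simp

lemma Ck_on_bounded_linear_comp:
  assumes "open S" "bounded_linear L" "Ck_on k S f"
  shows "Ck_on k S (\<lambda>x. L (f x))"
  using assms(3)
proof (induction k arbitrary: f)
  case 0
  then show ?case using assms(2) by (auto intro: bounded_linear.continuous_on)
next
  case (Suc k)
  show ?case
    by (intro Ck_on_SucI[OF assms(1), where D="\<lambda>x v. L (frechet_derivative f (at x) v)"]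
      bounded_linear.has_derivative[OF assms(2)] Ck_on_Suc_has_derivative[OF assms(1) Suc.prems] Suc.IH)
      (use Suc.prems in \<open>auto simp: Ck_on_Suc_iff[OF assms(1)]\<close>)
qed

lemma Ck_on_bounded_linear:
  assumes "open S" "bounded_linear L"
  shows "Ck_on k S L"
proof (cases k)
  case 0
  then show ?thesis using assms(2) by (simp add: linear_continuous_on)
next
  case (Suc k)
  then show ?thesis
    using assms by (auto intro!: Ck_on_SucI[where D="\<lambda>_. L"] bounded_linear_imp_has_derivative)
qed

lemma Ck_on_add:
  assumes "open S" "Ck_on k S f" "Ck_on k S g"
  shows "Ck_on k S (\<lambda>x. f x + g x)"
  using assms(2,3)
proof (induction k arbitrary: f g)
  case 0
  then show ?case by (auto intro: continuous_on_add)
next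
  case (Suc k)
  show ?case
    by (intro Ck_on_SucI[OF assms(1), where D="\<lambda>x v. frechet_derivative f (at x) v + frechet_derivative g (at x) v"]
      has_derivative_add Ck_on_Suc_has_derivative[OF assms(1) Suc.prems(1)] 
      Ck_on_Suc_has_derivative[OF assms(1) Suc.prems(2)] Suc.IH)
      (use Suc.prems in \<open>auto simp: Ck_on_Suc_iff[OF assms(1)]\<close>)
qed

lemma Ck_on_mult:
  fixes f g :: "'a::real_normed_vector \<Rightarrow> 'b::real_normed_field"
  assumes "open S" "Ck_on k S f" "Ck_on k S g"
  shows "Ck_on k S (\<lambda>x. f x * g x)"
  using assms(2,3)
proof (induction k arbitrary: f g)
  case 0
  then show ?case by (auto intro: continuous_on_mult)
next
  case (Suc k)
  show ?case
    by (intro Ck_on_SucI[OF assms(1), where 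
          D="\<lambda>x v. f x * frechet_derivative g (at x) v + frechet_derivative f (at x) v * g x"]
      has_derivative_mult Ck_on_Suc_has_derivative[OF assms(1) Suc.prems(1)] Ck_on_add[OF assms(1)]
      Ck_on_Suc_has_derivative[OF assms(1) Suc.prems(2)] Suc.IH)
      (use Suc.prems Ck_on_lower[OF Suc.prems(1)] Ck_on_lower[OF Suc.prems(2)] in
        \<open>auto simp: Ck_on_Suc_iff[OF assms(1)]\<close>)
qed

lemma Ck_on_inverse:
  fixes f :: "'a::real_normed_vector \<Rightarrow> 'b::real_normed_field"
  assumes "open S" "Ck_on k S f" "\<And>x. x \<in> S \<Longrightarrow> f x \<noteq> 0"
  shows "Ck_on k S (\<lambda>x. inverse (f x))"
  using assms(2)
proof (induction k)
  case 0
  then show ?case using assms(3) by (auto intro: continuous_on_inverse)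
next
  case (Suc k)
  have "Ck_on k S (\<lambda>x. inverse (f x))" using Suc Ck_on_lower by blast
  then have "Ck_on k S (\<lambda>x. - (inverse (f x) * frechet_derivative f (at x) v * inverse (f x)))" for v
    using Suc.prems
    by (intro Ck_on_bounded_linear_comp[OF assms(1) bounded_linear_minus[OF bounded_linear_ident]]
       Ck_on_mult[OF assms(1)]) (auto simp: Ck_on_Suc_iff[OF assms(1)])
  moreover have "((\<lambda>x. inverse (f x)) has_derivative
      (\<lambda>v. - (inverse (f x) * frechet_derivative f (at x) v * inverse (f x)))) (at x)" if "x \<in> S" for x
    using that by (intro Deriv.has_derivative_inverse assms(3) Ck_on_Suc_has_derivative[OF assms(1) Suc.prems(1)])
  ultimately show ?case by (intro Ck_on_SucI[OF assms(1)])
qed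

lemma smooth_on_cong:
  assumes "open S" "\<And>y. y \<in> S \<Longrightarrow> f y = g y" "smooth_on S f"
  shows "smooth_on S g"
  using assms Ck_on_cong unfolding smooth_on_def by metis

lemma smooth_on_subset:
  assumes "T \<subseteq> S" "smooth_on S f"
  shows "smooth_on T f"
proof -
  have "Ck_on k S f \<Longrightarrow> Ck_on k T f" for k
    by (induction k arbitrary: f) (use assms(1) in \<open>auto simp: Ck_on.simps(2) intro: continuous_on_subset differentiable_on_subset\<close>)
  with assms show ?thesis by (auto simp: smooth_on_def)
qed

lemma smooth_on_imp_continuous_on: "smooth_on S f \<Longrightarrow> continuous_on S f"
  unfolding smooth_on_def using Ck_on.simps(1) by blast

lemma smooth_on_imp_differentiable: "open S \<Longrightarrow> smooth_on S f \<Longrightarrow> x \<in> S \<Longrightarrow> f differentiable (at x)"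
  unfolding smooth_on_def using Ck_on_Suc_iff by blast

lemma smooth_on_frechet_derivative:
  "smooth_on S f \<Longrightarrow> smooth_on S (\<lambda>x. frechet_derivative f (at x) v)"
  unfolding smooth_on_def using Ck_on.simps(2) by blast

lemma smooth_on_const: "open S \<Longrightarrow> smooth_on S (\<lambda>_. c)"
  by (simp add: smooth_on_def)

lemma smooth_on_bounded_linear_comp:
  "open S \<Longrightarrow> bounded_linear L \<Longrightarrow> smooth_on S f \<Longrightarrow> smooth_on S (\<lambda>x. L (f x))"
  by (simp add: smooth_on_def Ck_on_bounded_linear_comp)

lemma smooth_on_bounded_linear: "open S \<Longrightarrow> bounded_linear L \<Longrightarrow> smooth_on S L"
  by (simp add: smooth_on_def Ck_on_bounded_linear)

lemma smooth_on_add: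
  "open S \<Longrightarrow> smooth_on S f \<Longrightarrow> smooth_on S g \<Longrightarrow> smooth_on S (\<lambda>x. f x + g x)"
  by (simp add: smooth_on_def Ck_on_add)

lemma smooth_on_minus: "open S \<Longrightarrow> smooth_on S f \<Longrightarrow> smooth_on S (\<lambda>x. - f x)"
  by (rule smooth_on_bounded_linear_comp) (auto intro: bounded_linear_minus)

lemma smooth_on_diff:
  "open S \<Longrightarrow> smooth_on S f \<Longrightarrow> smooth_on S g \<Longrightarrow> smooth_on S (\<lambda>x. f x - g x)"
  using smooth_on_add[OF _ _ smooth_on_minus] by fastforce

lemma smooth_on_mult:
  fixes f g :: "'a::real_normed_vector \<Rightarrow> 'b::real_normed_field"
  shows "open S \<Longrightarrow> smooth_on S f \<Longrightarrow> smooth_on S g \<Longrightarrow> smooth_on S (\<lambda>x. f x * g x)"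
  by (simp add: smooth_on_def Ck_on_mult)

lemma smooth_on_divide:
  fixes f g :: "'a::real_normed_vector \<Rightarrow> 'b::real_normed_field"
  shows "open S \<Longrightarrow> smooth_on S f \<Longrightarrow> smooth_on S g \<Longrightarrow> (\<And>x. x \<in> S \<Longrightarrow> g x \<noteq> 0) \<Longrightarrow>
    smooth_on S (\<lambda>x. f x / g x)"
  unfolding divide_inverse by (intro smooth_on_mult) (auto simp: smooth_on_def Ck_on_inverse)

lemma smooth_on_sum:
  "open S \<Longrightarrow> (\<And>i. i \<in> I \<Longrightarrow> smooth_on S (f i)) \<Longrightarrow> smooth_on S (\<lambda>x. \<Sum>i\<in>I. f i x)"
  by (induction I rule: infinite_finite_induct) (auto simp: smooth_on_const smooth_on_add)

lemma smooth_on_prod: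
  fixes f :: "'i \<Rightarrow> 'a::real_normed_vector \<Rightarrow> 'b::real_normed_field"
  shows "open S \<Longrightarrow> (\<And>i. i \<in> I \<Longrightarrow> smooth_on S (f i)) \<Longrightarrow> smooth_on S (\<lambda>x. \<Prod>i\<in>I. f i x)"
  by (induction I rule: infinite_finite_induct) (auto simp: smooth_on_const smooth_on_mult)

lemma smooth_on_cnj: "open S \<Longrightarrow> smooth_on S f \<Longrightarrow> smooth_on S (\<lambda>x. cnj (f x))"
  by (rule smooth_on_bounded_linear_comp[OF _ bounded_linear_cnj])

lemma smooth_on_if:
  "(c \<Longrightarrow> smooth_on S f) \<Longrightarrow> (\<not> c \<Longrightarrow> smooth_on S g) \<Longrightarrow> smooth_on S (\<lambda>x. if c then f x else g x)"
  by (cases c) auto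

lemmas smooth_on_intros = smooth_on_const smooth_on_add smooth_on_minus smooth_on_diff smooth_on_mult
  smooth_on_sum smooth_on_prod smooth_on_cnj

lemma smooth_on_wirt:
  assumes "open S" "smooth_on S f"
  shows "smooth_on S (wirt a f)"
proof (cases a)
  case (Inl i)
  have "smooth_on S (\<lambda>x. wirt (Inl i) f x)"
    unfolding wirt_def divide_inverse sum.case
    by (intro smooth_on_intros smooth_on_frechet_derivative assms)
  then show ?thesis using Inl by simp
next
  case (Inr i)
  have "smooth_on S (\<lambda>x. wirt (Inr i) f x)"
    unfolding wirt_def divide_inverse sum.case
    by (intro smooth_on_intros smooth_on_frechet_derivative assms)
  then show ?thesis using Inr by simp
qed

section \<open>Symmetry of second derivatives\<close>

text \<open>The mean value theorem is applied first in direction \<open>v\<close> to \<open>a \<mapsto> f (x + a v + t w) - f (x + a v)\<close>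
and then in direction \<open>w\<close> to the derivative so obtained. The left-hand side is symmetric in \<open>v\<close> and
\<open>w\<close>, and this is the source of the symmetry of second derivatives.\<close>

lemma second_difference_mvt:
  fixes f :: "'a::real_normed_vector \<Rightarrow> real"
  assumes S: "open S" and f: "smooth_on S f" and t: "t > 0"
    and box: "\<And>a b. 0 \<le> a \<Longrightarrow> a \<le> t \<Longrightarrow> 0 \<le> b \<Longrightarrow> b \<le> t \<Longrightarrow> x + a *\<^sub>R v + b *\<^sub>R w \<in> S"
  obtains a b where "0 < a" "a < t" "0 < b" "b < t"
    "f (x + t *\<^sub>R v + t *\<^sub>R w) - f (x + t *\<^sub>R v) - f (x + t *\<^sub>R w) + f x =
      t * (t * frechet_derivative (\<lambda>y. frechet_derivative f (at y) v) (at (x + a *\<^sub>R v + b *\<^sub>R w)) w)"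
proof -
  let ?D = "\<lambda>y. frechet_derivative f (at y)"
  have D: "(f has_derivative ?D y) (at y)" if "y \<in> S" for y
    using smooth_on_imp_differentiable[OF S f that] frechet_derivative_works by blast
  have compD: "((\<lambda>a. f (l a)) has_derivative (\<lambda>h. ?D (l a) (l' h))) (at a)"
    if "l a \<in> S" "(l has_derivative l') (at a)" for l l' and a :: real
    using has_derivative_compose[OF that(2) D[OF that(1)]] .
  have lin: "?D y (c *\<^sub>R u) = c * ?D y u" if "y \<in> S" for c y u
    using has_derivative_linear[OF D[OF that]] by (simp add: linear_cmul)
  let ?E = "\<lambda>y. frechet_derivative (\<lambda>y. ?D y v) (at y)"
  have E: "((\<lambda>y. ?D y v) has_derivative ?E y) (at y)" if "y \<in> S" for y
    using smooth_on_imp_differentiable[OF S smooth_on_frechet_derivative[OF f] that] 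
      frechet_derivative_works by blast
  have compE: "((\<lambda>a. ?D (l a) v) has_derivative (\<lambda>h. ?E (l a) (l' h))) (at a)"
    if "l a \<in> S" "(l has_derivative l') (at a)" for l l' and a :: real
    using has_derivative_compose[OF that(2) E[OF that(1)]] .
  have linE: "?E y (c *\<^sub>R u) = c * ?E y u" if "y \<in> S" for c y u
    using has_derivative_linear[OF E[OF that]] by (simp add: linear_cmul)
  define \<phi> where "\<phi> a = f (x + a *\<^sub>R v + t *\<^sub>R w) - f (x + a *\<^sub>R v)" for a
  have "\<exists>a>0. a < t \<and> \<phi> t - \<phi> 0 = (t - 0) * (?D (x + a *\<^sub>R v + t *\<^sub>R w) v - ?D (x + a *\<^sub>R v) v)"
  proof (rule MVT2[OF t])
    fix a assume a: "0 \<le> a" "a \<le> t"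
    have *: "x + a *\<^sub>R v + t *\<^sub>R w \<in> S" "x + a *\<^sub>R v \<in> S"
      using box[of a t] box[of a 0] a t by auto
    have "(\<phi> has_derivative (\<lambda>h. ?D (x + a *\<^sub>R v + t *\<^sub>R w) (h *\<^sub>R v) - ?D (x + a *\<^sub>R v) (h *\<^sub>R v))) (at a)"
      unfolding \<phi>_def
      by (intro has_derivative_diff compD *) (auto intro!: derivative_eq_intros)
    then show "DERIV \<phi> a :> ?D (x + a *\<^sub>R v + t *\<^sub>R w) v - ?D (x + a *\<^sub>R v) v"
      by (simp add: has_field_derivative_def lin[OF *(1)] lin[OF *(2)] mult_commute_abs flip: right_diff_distrib)
  qed
  then obtain a where a: "0 < a" "a < t"
    "\<phi> t - \<phi> 0 = t * (?D (x + a *\<^sub>R v + t *\<^sub>R w) v - ?D (x + a *\<^sub>R v) v)" by auto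
  define \<psi> where "\<psi> b = ?D (x + a *\<^sub>R v + b *\<^sub>R w) v" for b
  have "\<exists>b>0. b < t \<and> \<psi> t - \<psi> 0 = (t - 0) * ?E (x + a *\<^sub>R v + b *\<^sub>R w) w"
  proof (rule MVT2[OF t])
    fix b assume b: "0 \<le> b" "b \<le> t"
    have *: "x + a *\<^sub>R v + b *\<^sub>R w \<in> S" using box[of a b] a b by auto
    have "(\<psi> has_derivative (\<lambda>h. ?E (x + a *\<^sub>R v + b *\<^sub>R w) (h *\<^sub>R w))) (at b)"
      unfolding \<psi>_def
      by (intro compE *) (auto intro!: derivative_eq_intros)
    then show "DERIV \<psi> b :> ?E (x + a *\<^sub>R v + b *\<^sub>R w) w"
      by (simp add: has_field_derivative_def linE[OF *] mult_commute_abs)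
  qed
  then obtain b where "0 < b" "b < t" "\<psi> t - \<psi> 0 = t * ?E (x + a *\<^sub>R v + b *\<^sub>R w) w" by auto
  with a show ?thesis by (intro that[of a b]) (auto simp: \<phi>_def \<psi>_def)
qed

text \<open>The two orders of differentiation give the same second difference divided by \<open>t\<^sup>2\<close>, at two different
points within distance \<open>O(t)\<close> of \<open>x\<close>. Both second derivatives are continuous, so they agree at \<open>x\<close>.\<close>

lemma frechet_derivative_commute_real:
  fixes f :: "'a::real_normed_vector \<Rightarrow> real"
  assumes S: "open S" and f: "smooth_on S f" and x: "x \<in> S"
  shows "frechet_derivative (\<lambda>y. frechet_derivative f (at y) v) (at x) w =
    frechet_derivative (\<lambda>y. frechet_derivative f (at y) w) (at x) v" (is "?G x = ?H x")
proof (rule ccontr)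
  assume ne: "?G x \<noteq> ?H x"
  define e where "e = \<bar>?G x - ?H x\<bar> / 2"
  have e: "e > 0" using ne by (simp add: e_def)
  have G: "isCont ?G x" and H: "isCont ?H x"
    using smooth_on_imp_continuous_on[OF smooth_on_frechet_derivative[OF smooth_on_frechet_derivative[OF f]]] S x
    by (auto simp: continuous_on_eq_continuous_at)
  obtain d1 where d1: "d1 > 0" "\<And>y. dist y x < d1 \<Longrightarrow> dist (?G y) (?G x) < e"
    using G e unfolding continuous_at_eps_delta by blast
  obtain d2 where d2: "d2 > 0" "\<And>y. dist y x < d2 \<Longrightarrow> dist (?H y) (?H x) < e"
    using H e unfolding continuous_at_eps_delta by blast
  obtain d3 where d3: "d3 > 0" "ball x d3 \<subseteq> S" using S x by (meson openE)
  define d where "d = min d1 (min d2 d3)"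
  define t where "t = d / (2 * (norm v + norm w + 1))"
  have pos: "norm v + norm w + 1 > 0" using norm_ge_zero[of v] norm_ge_zero[of w] by linarith
  have d: "d > 0" using d1 d2 d3 by (auto simp: d_def)
  have t: "t > 0" using d pos by (simp add: t_def)
  have near: "dist (x + a *\<^sub>R v + b *\<^sub>R w) x < d" if "0 \<le> a" "a \<le> t" "0 \<le> b" "b \<le> t" for a b
  proof -
    have "dist (x + a *\<^sub>R v + b *\<^sub>R w) x \<le> a * norm v + b * norm w"
      using norm_triangle_ineq[of "a *\<^sub>R v" "b *\<^sub>R w"] that by (simp add: dist_norm)
    also have "\<dots> \<le> t * norm v + t * norm w"
      using that by (intro add_mono mult_right_mono) auto
    also have "\<dots> \<le> t * (norm v + norm w + 1)" using t by (simp add: algebra_simps)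
    also have "\<dots> = d / 2" using pos unfolding t_def by (simp add: divide_simps)
    also have "\<dots> < d" using d by simp
    finally show ?thesis .
  qed
  have sub: "x + a *\<^sub>R v + b *\<^sub>R w \<in> S" if "0 \<le> a" "a \<le> t" "0 \<le> b" "b \<le> t" for a b
    using near[OF that] d3 by (auto simp: d_def dist_commute)
  obtain a b where ab: "0 < a" "a < t" "0 < b" "b < t"
    "f (x + t *\<^sub>R v + t *\<^sub>R w) - f (x + t *\<^sub>R v) - f (x + t *\<^sub>R w) + f x =
      t * (t * ?G (x + a *\<^sub>R v + b *\<^sub>R w))"
    by (rule second_difference_mvt[OF S f t sub])
  have sub': "x + a *\<^sub>R w + b *\<^sub>R v \<in> S" if "0 \<le> a" "a \<le> t" "0 \<le> b" "b \<le> t" for a b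
    using sub[of b a] that by (simp add: ac_simps)
  obtain a' b' where ab': "0 < a'" "a' < t" "0 < b'" "b' < t"
    "f (x + t *\<^sub>R w + t *\<^sub>R v) - f (x + t *\<^sub>R w) - f (x + t *\<^sub>R v) + f x =
      t * (t * ?H (x + a' *\<^sub>R w + b' *\<^sub>R v))"
    by (rule second_difference_mvt[OF S f t sub'])
  have "t * (t * ?G (x + a *\<^sub>R v + b *\<^sub>R w)) = t * (t * ?H (x + a' *\<^sub>R w + b' *\<^sub>R v))"
    unfolding ab(5)[symmetric] ab'(5)[symmetric] by (simp add: ac_simps)
  then have eq: "?G (x + a *\<^sub>R v + b *\<^sub>R w) = ?H (x + a' *\<^sub>R w + b' *\<^sub>R v)"
    using t by simp
  have "dist (?G (x + a *\<^sub>R v + b *\<^sub>R w)) (?G x) < e"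
    using near[of a b] ab(1-4) by (intro d1) (auto simp: d_def)
  moreover have "dist (?H (x + a' *\<^sub>R w + b' *\<^sub>R v)) (?H x) < e"
    using near[of b' a'] ab'(1-4) by (intro d2) (auto simp: d_def ac_simps)
  ultimately have "dist (?G x) (?H x) < e + e"
    unfolding eq by (intro dist_triangle_less_add[of _ "?H (x + a' *\<^sub>R w + b' *\<^sub>R v)"]) (simp_all only: dist_commute)
  then show False by (simp add: e_def dist_real_def)
qed

lemma frechet_derivative_bounded_linear_comp:
  assumes "bounded_linear L" "f differentiable (at x)"
  shows "frechet_derivative (\<lambda>y. L (f y)) (at x) v = L (frechet_derivative f (at x) v)"
  using bounded_linear.has_derivative[OF assms(1)] frechet_derivative_works[THEN iffD1, OF assms(2)]
    frechet_derivative_at by metis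

lemma frechet_derivative_commute:
  fixes f :: "'a::real_normed_vector \<Rightarrow> complex"
  assumes S: "open S" and f: "smooth_on S f" and x: "x \<in> S"
  shows "frechet_derivative (\<lambda>y. frechet_derivative f (at y) v) (at x) w =
    frechet_derivative (\<lambda>y. frechet_derivative f (at y) w) (at x) v"
proof -
  have *: "frechet_derivative (\<lambda>y. frechet_derivative (\<lambda>y. L (f y)) (at y) v) (at x) w =
      L (frechet_derivative (\<lambda>y. frechet_derivative f (at y) v) (at x) w)"
    if L: "bounded_linear L" for L :: "complex \<Rightarrow> real" and v w
  proof -
    have "frechet_derivative (\<lambda>y. frechet_derivative (\<lambda>y. L (f y)) (at y) v) (at x) =
      frechet_derivative (\<lambda>y. L (frechet_derivative f (at y) v)) (at x)"
      using smooth_on_imp_differentiable[OF S f]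
      by (intro frechet_derivative_cong_open[OF S x] frechet_derivative_bounded_linear_comp L)
    then show ?thesis
      using smooth_on_imp_differentiable[OF S smooth_on_frechet_derivative[OF f] x]
      by (simp add: frechet_derivative_bounded_linear_comp[OF L])
  qed
  show ?thesis
    using frechet_derivative_commute_real[OF S smooth_on_bounded_linear_comp[OF S bounded_linear_Re f] x, of v w]
      frechet_derivative_commute_real[OF S smooth_on_bounded_linear_comp[OF S bounded_linear_Im f] x, of v w]
    by (simp add: *[OF bounded_linear_Re] *[OF bounded_linear_Im] complex_eq_iff)
qed

section \<open>Wirtinger derivatives\<close>

text \<open>Conjugation of indices: conjugating a function exchanges its derivatives in the directions \<open>a\<close> and
\<open>bar a\<close>.\<close>

definition bar :: "'n idx \<Rightarrow> 'n idx" where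
  "bar a = (case a of Inl i \<Rightarrow> Inr i | Inr i \<Rightarrow> Inl i)"

lemma bar_simps [simp]: "bar (Inl i) = Inr i" "bar (Inr i) = Inl i" "bar (bar a) = a"
  by (auto simp: bar_def split: sum.splits)

lemma wirt_has_derivative:
  assumes "(f has_derivative D) (at x)"
  shows "wirt a f x = (case a of Inl i \<Rightarrow> (D (axis i 1) - \<i> * D (axis i \<i>)) / 2
    | Inr i \<Rightarrow> (D (axis i 1) + \<i> * D (axis i \<i>)) / 2)"
  by (simp add: wirt_def frechet_derivative_at[OF assms, symmetric] split: sum.split)

lemma wirt_cong_open:
  assumes "open S" "x \<in> S" "\<And>y. y \<in> S \<Longrightarrow> f y = g y"
  shows "wirt a f x = wirt a g x"
proof -
  have "frechet_derivative f (at x) = frechet_derivative g (at x)"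
    by (rule frechet_derivative_cong_open[of S]) (use assms in auto)
  then show ?thesis by (cases a) (simp_all add: wirt_def)
qed

lemma wirt_const [simp]: "wirt a (\<lambda>_. c) x = 0"
  by (simp add: wirt_has_derivative[OF has_derivative_const] split: sum.split)

lemma wirt_add:
  assumes "f differentiable (at x)" "g differentiable (at x)"
  shows "wirt a (\<lambda>y. f y + g y) x = wirt a f x + wirt a g x"
  using wirt_has_derivative[OF has_derivative_add[OF assms[unfolded frechet_derivative_works]], of a]
  by (auto simp: wirt_def field_simps split: sum.split)

lemma wirt_mult:
  assumes "f differentiable (at x)" "g differentiable (at x)"
  shows "wirt a (\<lambda>y. f y * g y) x = wirt a f x * g x + f x * wirt a g x"
  using wirt_has_derivative[OF has_derivative_mult[OF assms[unfolded frechet_derivative_works]], of a]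
  by (auto simp: wirt_def field_simps split: sum.split)

lemma wirt_cmult:
  assumes "f differentiable (at x)"
  shows "wirt a (\<lambda>y. c * f y) x = c * wirt a f x"
  using wirt_mult[of "\<lambda>_. c" x f a] assms by simp

lemma wirt_minus:
  assumes "f differentiable (at x)"
  shows "wirt a (\<lambda>y. - f y) x = - wirt a f x"
  using wirt_cmult[OF assms, of a "-1"] by simp

lemma wirt_diff:
  assumes "f differentiable (at x)" "g differentiable (at x)"
  shows "wirt a (\<lambda>y. f y - g y) x = wirt a f x - wirt a g x"
  using wirt_add[of f x "\<lambda>y. - g y" a] assms wirt_minus[of g x a] by (simp add: differentiable_minus)

lemma wirt_sum:
  assumes "\<And>i. i \<in> I \<Longrightarrow> f i differentiable (at x)"
  shows "wirt a (\<lambda>y. \<Sum>i\<in>I. f i y) x = (\<Sum>i\<in>I. wirt a (f i) x)"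
proof (cases "finite I")
  case True
  then show ?thesis using assms
    by (induction I rule: finite_induct) (auto simp: wirt_add differentiable_sum)
qed auto

lemma wirt_cnj:
  assumes "f differentiable (at x)"
  shows "wirt a (\<lambda>y. cnj (f y)) x = cnj (wirt (bar a) f x)"
  by (auto simp: wirt_def bar_def frechet_derivative_bounded_linear_comp[OF bounded_linear_cnj assms]
     split: sum.split)

lemma wirt_commute:
  assumes S: "open S" and f: "smooth_on S f" and x: "x \<in> S"
  shows "wirt a (wirt b f) x = wirt b (wirt a f) x"
proof -
  let ?D = "\<lambda>v y. frechet_derivative f (at y) v"
  have D: "(?D v has_derivative frechet_derivative (?D v) (at x)) (at x)" for v
    using smooth_on_imp_differentiable[OF S smooth_on_frechet_derivative[OF f] x]
      frechet_derivative_works by blast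
  have c: "frechet_derivative (?D v) (at x) w = frechet_derivative (?D w) (at x) v" for v w
    by (rule frechet_derivative_commute[OF S f x])
  have w: "(wirt b f has_derivative (\<lambda>w. case b of 
      Inl i \<Rightarrow> (frechet_derivative (?D (axis i 1)) (at x) w - \<i> * frechet_derivative (?D (axis i \<i>)) (at x) w) / 2
    | Inr i \<Rightarrow> (frechet_derivative (?D (axis i 1)) (at x) w + \<i> * frechet_derivative (?D (axis i \<i>)) (at x) w) / 2)) (at x)"
    for b
    unfolding wirt_def
    by (cases b) (auto intro!: derivative_eq_intros D simp: field_simps)
  show ?thesis
    unfolding wirt_has_derivative[OF w]
    by (cases a; cases b)
      (auto simp: c[of "axis _ \<i>" "axis _ 1"] c[of "axis i \<i>" "axis j \<i>" for i j]
        c[of "axis i 1" "axis j 1" for i j] field_simps)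
qed

section \<open>Smooth bump functions\<close>

text \<open>The classical flat function \<open>exp (- 1 / t)\<close>, extended by zero, together with all its derivatives:
these have the form \<open>p (1 / t) exp (- 1 / t)\<close> with a polynomial \<open>p\<close>. Keeping \<open>p\<close> as a parameter makes
the family closed under differentiation, with \<open>flat_deriv\<close> acting on the polynomials.\<close>

definition flat :: "real poly \<Rightarrow> real \<Rightarrow> real" where
  "flat p t = (if t > 0 then poly p (1 / t) * exp (- 1 / t) else 0)"

definition flat_deriv :: "real poly \<Rightarrow> real poly" where
  "flat_deriv p = [:0, 0, 1:] * (p - pderiv p)"

lemma poly_div_exp_tendsto_0: "((\<lambda>s. poly p s / exp s) \<longlongrightarrow> (0::real)) at_top"
proof -
  have "((\<lambda>s. \<Sum>i\<le>degree p. coeff p i * (s ^ i / exp s)) \<longlongrightarrow> (\<Sum>i\<le>degree p. coeff p i * 0)) at_top"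
    by (intro tendsto_intros tendsto_power_div_exp_0)
  then show ?thesis by (simp add: poly_altdef sum_divide_distrib)
qed

text \<open>With \<open>s = 1 / h\<close> the quotient is \<open>s p(s) / exp s\<close>, and the exponential beats every polynomial. This
gives the derivative at \<open>0\<close>, where the two branches of the definition meet.\<close>

lemma flat_tendsto_0: "((\<lambda>h. flat p h / h) \<longlongrightarrow> 0) (at 0)"
proof (rule filterlim_split_at)
  have "((\<lambda>h. poly (pCons 0 p) (inverse h) / exp (inverse h)) \<longlongrightarrow> 0) (at_right 0)"
    using poly_div_exp_tendsto_0 filterlim_inverse_at_top_right by (rule filterlim_compose)
  moreover have "eventually (\<lambda>h. poly (pCons 0 p) (inverse h) / exp (inverse h) = flat p h / h) (at_right 0)"
    by (auto simp: flat_def eventually_at_right_field field_simps exp_minus intro!: exI[of _ 1])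
  ultimately show "((\<lambda>h. flat p h / h) \<longlongrightarrow> 0) (at_right 0)"
    by (rule Lim_transform_eventually)
  have "eventually (\<lambda>h. 0 = flat p h / h) (at_left 0)"
    by (auto simp: flat_def eventually_at_left_field intro!: exI[of _ "-1"])
  then show "((\<lambda>h. flat p h / h) \<longlongrightarrow> 0) (at_left 0)"
    by (rule Lim_transform_eventually[OF tendsto_const])
qed

lemma flat_has_derivative: "(flat p has_real_derivative flat (flat_deriv p) t) (at t)"
proof (cases t "0::real" rule: linorder_cases)
  case less
  have "((\<lambda>_. 0) has_real_derivative 0) (at t)" by simp
  then have "(flat p has_real_derivative 0) (at t)"
    by (rule has_field_derivative_transform_within_open[where S="{..<0}"]) (use less in \<open>auto simp: flat_def\<close>)
  then show ?thesis using less by (simp add: flat_def)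
next
  case equal
  have "(flat p has_real_derivative 0) (at 0)"
    unfolding has_field_derivative_iff using flat_tendsto_0[of p] by (simp add: flat_def)
  then show ?thesis using equal by (simp add: flat_def)
next
  case greater
  have "((\<lambda>t. poly p (1 / t) * exp (- 1 / t)) has_real_derivative flat (flat_deriv p) t) (at t)"
    using greater
    by (auto intro!: derivative_eq_intros poly_DERIV DERIV_chain2[of "poly p"]
        simp: flat_def flat_deriv_def field_simps power2_eq_square)
  then show ?thesis
    by (rule has_field_derivative_transform_within_open[where S="{0<..}"]) (use greater in \<open>auto simp: flat_def\<close>)
qed

lemma smooth_on_flat_comp:
  fixes q :: "'a::real_normed_vector \<Rightarrow> real"
  assumes "open S" "smooth_on S q"
  shows "smooth_on S (\<lambda>x. flat p (q x))"
proof -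
  have "Ck_on k S (\<lambda>x. flat p (q x))" for k
  proof (induction k arbitrary: p)
    case 0
    have "continuous_on UNIV (flat p)"
      by (meson DERIV_isCont continuous_at_imp_continuous_on flat_has_derivative)
    then show ?case
      using smooth_on_imp_continuous_on[OF assms(2)] continuous_on_compose2[of UNIV "flat p" S q] by auto
  next
    case (Suc k)
    show ?case
    proof (rule Ck_on_SucI[OF assms(1)])
      fix x assume "x \<in> S"
      then have "(q has_derivative frechet_derivative q (at x)) (at x)"
        using smooth_on_imp_differentiable[OF assms] frechet_derivative_works by blast
      then show "((\<lambda>x. flat p (q x)) has_derivative
          (\<lambda>v. flat (flat_deriv p) (q x) * frechet_derivative q (at x) v)) (at x)"
        using has_derivative_compose[OF _ flat_has_derivative[THEN has_field_derivative_imp_has_derivative]]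
        by blast
    next
      show "Ck_on k S (\<lambda>x. flat (flat_deriv p) (q x) * frechet_derivative q (at x) v)" for v
        using smooth_on_frechet_derivative[OF assms(2), of v]
        by (intro Ck_on_mult[OF assms(1)] Suc.IH) (auto simp: smooth_on_def)
    qed
  qed
  then show ?thesis by (simp add: smooth_on_def)
qed

lemma smooth_on_inner_self:
  assumes "open S"
  shows "smooth_on S (\<lambda>x::'a::real_inner. x \<bullet> x)"
proof -
  have "Ck_on k S (\<lambda>x. x \<bullet> x)" for k
  proof (cases k)
    case 0
    then show ?thesis by (simp add: continuous_on_inner)
  next
    case (Suc m)
    show ?thesis unfolding Suc
    proof (rule Ck_on_SucI[OF assms])
      show "((\<lambda>x. x \<bullet> x) has_derivative (\<lambda>v. 2 * (x \<bullet> v))) (at x)" for x :: 'a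
        by (auto intro!: derivative_eq_intros simp: inner_commute)
      show "Ck_on m S (\<lambda>x. 2 * (x \<bullet> v))" for v
        by (intro Ck_on_bounded_linear assms bounded_linear_intros bounded_linear_inner_left)
    qed
  qed
  then show ?thesis by (simp add: smooth_on_def)
qed

text \<open>The square of the norm, unlike the norm, is smooth everywhere.\<close>

definition bump :: "'a::real_inner \<Rightarrow> real \<Rightarrow> 'a \<Rightarrow> real" where
  "bump x0 r x = flat 1 (r\<^sup>2 - (norm (x - x0))\<^sup>2)"

lemma smooth_on_bump:
  assumes "open S"
  shows "smooth_on S (bump x0 r)"
proof -
  have "smooth_on S (\<lambda>x. flat 1 (r\<^sup>2 - (x \<bullet> x - 2 * (x0 \<bullet> x) + x0 \<bullet> x0)))"
    by (intro smooth_on_flat_comp smooth_on_intros smooth_on_inner_self assms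
        smooth_on_bounded_linear[OF _ bounded_linear_inner_right])
  moreover have "(\<lambda>x. flat 1 (r\<^sup>2 - (x \<bullet> x - 2 * (x0 \<bullet> x) + x0 \<bullet> x0))) = bump x0 r"
    by (auto simp: bump_def power2_norm_eq_inner inner_diff inner_commute algebra_simps)
  ultimately show ?thesis by simp
qed

lemma bump_nonneg: "bump x0 r x \<ge> 0"
  by (simp add: bump_def flat_def)

lemma bump_pos: "x \<in> ball x0 r \<Longrightarrow> bump x0 r x > 0"
  by (auto simp: bump_def flat_def dist_norm norm_minus_commute intro!: power_strict_mono)

lemma bump_eq_0: "r \<ge> 0 \<Longrightarrow> x \<notin> cball x0 r \<Longrightarrow> bump x0 r x = 0"
  by (auto simp: bump_def flat_def dist_norm norm_minus_commute not_less not_le intro!: power_mono)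

section \<open>Integration by parts and the fundamental lemma\<close>

text \<open>The difference quotients of \<open>f\<close> in direction \<open>v\<close> have integral zero by translation invariance of
Lebesgue measure. They converge pointwise to the derivative, and they are dominated by a constant on
the compact set swept out by the support under translation by \<open>- t v\<close> with \<open>0 \<le> t \<le> 1\<close>.\<close>

lemma integral_directional_derivative_eq_0:
  fixes f :: "'a::euclidean_space \<Rightarrow> 'b::euclidean_space"
  assumes f: "\<And>x. (f has_derivative D x) (at x)" and cont: "continuous_on UNIV (\<lambda>x. D x v)"
    and K: "compact K" and f0: "\<And>x. x \<notin> K \<Longrightarrow> f x = 0"
  shows "(\<integral>x. D x v \<partial>lborel) = 0"
proof -
  define s where "s n x = real (Suc n) *\<^sub>R (f (inverse (real (Suc n)) *\<^sub>R v + x) - f x)" for n x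
  have contf: "continuous_on UNIV f"
    using f by (meson continuous_at_imp_continuous_on has_derivative_continuous)
  have D0: "D x v = 0" if "x \<notin> K" for x
  proof -
    have "((\<lambda>_. 0) has_derivative (\<lambda>_. 0)) (at x)" by simp
    then have "(f has_derivative (\<lambda>_. 0)) (at x)"
      by (rule has_derivative_transform_within_open[of _ _ _ _ "- K"])
        (use that f0 compact_imp_closed[OF K] in auto)
    then show ?thesis using has_derivative_unique[OF f] by metis
  qed
  have "bounded ((\<lambda>x. D x v) ` K)"
    using K cont by (intro compact_imp_bounded compact_continuous_image) (auto intro: continuous_on_subset)
  then obtain M where M: "M > 0" "\<And>x. x \<in> K \<Longrightarrow> norm (D x v) \<le> M"
    unfolding bounded_pos by auto
  have M': "norm (D x v) \<le> M" for x using M D0[of x] by (cases "x \<in> K") auto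
  have intf: "integrable lborel f"
  proof -
    have "(\<lambda>x. indicator K x *\<^sub>R f x) = f" using f0 by (auto simp: indicator_def)
    then show ?thesis
      using borel_integrable_compact[OF K, of f] continuous_on_subset[OF contf] by auto
  qed
  have trans: "integrable lborel (\<lambda>x. f (c + x)) \<and> (\<integral>x. f (c + x) \<partial>lborel) = (\<integral>x. f x \<partial>lborel)" for c
  proof -
    have "(\<integral>x. f x \<partial>distr lborel borel ((+) c)) = (\<integral>x. f (c + x) \<partial>lborel)"
      by (rule integral_distr) (use intf in auto)
    moreover have "integrable (distr lborel borel ((+) c)) f \<longleftrightarrow> integrable lborel (\<lambda>x. f (c + x))"
      by (rule integrable_distr_eq) (use intf in auto)
    ultimately show ?thesis using intf by (simp add: lborel_distr_plus)
  qed
  have s0: "(\<integral>x. s n x \<partial>lborel) = 0" for n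
    unfolding s_def using trans[of "inverse (real (Suc n)) *\<^sub>R v"] intf by (simp add: Bochner_Integration.integral_diff)
  define K' where "K' = (\<lambda>(x, t). x - t *\<^sub>R v) ` (K \<times> {0..1})"
  have K': "compact K'"
    unfolding K'_def using K by (intro compact_continuous_image compact_Times)
      (auto intro!: continuous_intros simp: case_prod_unfold)
  \<comment> \<open>Outside the swept set, both points of the difference quotient miss the support.\<close>
  have bound: "norm (s n x) \<le> indicator K' x *\<^sub>R M" for n x
  proof (cases "x \<in> K'")
    case True
    define t where "t = inverse (real (Suc n))"
    define \<phi> where "\<phi> a = f (a *\<^sub>R v + x)" for a
    have "norm (\<phi> t - \<phi> 0) \<le> M * norm (t - 0)"
    proof (rule differentiable_bound[of UNIV \<phi> "\<lambda>a h. D (a *\<^sub>R v + x) (h *\<^sub>R v)"])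
      show "(\<phi> has_derivative (\<lambda>h. D (a *\<^sub>R v + x) (h *\<^sub>R v))) (at a within UNIV)" for a
        unfolding \<phi>_def
        by (rule has_derivative_compose[of "\<lambda>a. a *\<^sub>R v + x" "\<lambda>h. h *\<^sub>R v" a UNIV, OF _ f])
          (auto intro!: derivative_eq_intros)
      show "onorm (\<lambda>h. D (a *\<^sub>R v + x) (h *\<^sub>R v)) \<le> M" for a
      proof (rule onorm_bound)
        show "norm (D (a *\<^sub>R v + x) (h *\<^sub>R v)) \<le> M * norm h" for h
          using linear_cmul[OF has_derivative_linear[OF f]] M'[of "a *\<^sub>R v + x"]
          by (simp add: mult.commute[of M] mult_left_mono)
      qed (use M in auto)
    qed auto
    then have "norm (f (t *\<^sub>R v + x) - f x) \<le> M * t" by (simp add: \<phi>_def t_def)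
    then have "norm (s n x) \<le> real (Suc n) * (M * t)"
      unfolding s_def t_def by (simp add: mult_left_mono del: of_nat_Suc)
    also have "\<dots> = M" by (simp add: t_def del: of_nat_Suc)
    finally show ?thesis using True by simp
  next
    case False
    have "x \<notin> K" using False unfolding K'_def by (force intro!: rev_image_eqI[of "(x, 0)"])
    moreover have "inverse (real (Suc n)) *\<^sub>R v + x \<notin> K"
      using False unfolding K'_def
      by (auto intro!: rev_image_eqI[of "(inverse (real (Suc n)) *\<^sub>R v + x, inverse (real (Suc n)))"] 
        simp: inverse_le_1_iff)
    ultimately show ?thesis using f0 False by (simp add: s_def)
  qed
  have lim: "(\<lambda>n. s n x) \<longlonglongrightarrow> D x v" for x
  proof -
    have "((\<lambda>a. f (a *\<^sub>R v + x)) has_derivative (\<lambda>h. D x (h *\<^sub>R v))) (at 0)"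
      by (rule has_derivative_compose[of "\<lambda>a. a *\<^sub>R v + x" "\<lambda>h. h *\<^sub>R v" 0 UNIV f "D x"])
        (use f[of x] in \<open>auto intro!: derivative_eq_intros\<close>)
    then have "((\<lambda>h. norm (f (h *\<^sub>R v + x) - f x - h *\<^sub>R D x v) / norm h) \<longlongrightarrow> 0) (at 0)"
      by (simp add: has_derivative_at linear_cmul[OF has_derivative_linear[OF f]])
    moreover have "filterlim (\<lambda>n. inverse (real (Suc n))) (at 0) sequentially"
      by (intro filterlim_atI LIMSEQ_inverse_real_of_nat) auto
    ultimately have *: "(\<lambda>n. norm (f (inverse (real (Suc n)) *\<^sub>R v + x) - f x - inverse (real (Suc n)) *\<^sub>R D x v)
        / norm (inverse (real (Suc n)))) \<longlonglongrightarrow> 0"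
      by (rule filterlim_compose)
    have "norm (f (inverse (real (Suc n)) *\<^sub>R v + x) - f x - inverse (real (Suc n)) *\<^sub>R D x v)
        / norm (inverse (real (Suc n))) = norm (s n x - D x v)" for n
    proof -
      have "s n x - D x v = real (Suc n) *\<^sub>R
          (f (inverse (real (Suc n)) *\<^sub>R v + x) - f x - inverse (real (Suc n)) *\<^sub>R D x v)"
        unfolding s_def by (simp add: scaleR_diff_right del: of_nat_Suc)
      then show ?thesis by (simp add: divide_inverse mult.commute del: of_nat_Suc)
    qed
    then show ?thesis using * by (simp add: LIM_zero_iff tendsto_norm_zero_iff del: of_nat_Suc)
  qed
  have "(\<lambda>n. \<integral>x. s n x \<partial>lborel) \<longlonglongrightarrow> (\<integral>x. D x v \<partial>lborel)"
  proof (rule integral_dominated_convergence)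
    show "(\<lambda>x. D x v) \<in> borel_measurable lborel"
      using borel_measurable_continuous_onI[OF cont] by simp
    show "s n \<in> borel_measurable lborel" for n
      using trans[of "inverse (real (Suc n)) *\<^sub>R v"] intf unfolding s_def by (auto intro!: borel_measurable_scaleR borel_measurable_diff)
    show "integrable lborel (\<lambda>x. indicator K' x *\<^sub>R M)"
      by (intro borel_integrable_compact K') auto
  qed (use lim bound in auto)
  then show ?thesis using s0 by (simp add: LIMSEQ_const_iff)
qed

text \<open>Smoothness is local; this glues a function that vanishes near the boundary of \<open>S\<close> to zero.\<close>

lemma smooth_on_Un:
  assumes "open S" "open T" "smooth_on S f" "smooth_on T f"
  shows "smooth_on (S \<union> T) f"
proof -
  have "Ck_on k S f \<Longrightarrow> Ck_on k T f \<Longrightarrow> Ck_on k (S \<union> T) f" for k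
  proof (induction k arbitrary: f)
    case 0
    then show ?case using assms(1,2) by (auto intro: continuous_on_open_Un)
  next
    case (Suc k)
    then show ?case using assms(1,2) by (simp add: Ck_on_Suc_iff open_Un) blast
  qed
  then show ?thesis using assms(3,4) by (auto simp: smooth_on_def)
qed

lemma smooth_on_extend_by_0:
  assumes S: "open S" and f: "smooth_on S f" and K: "compact K" "K \<subseteq> S"
    and f0: "\<And>x. x \<in> S \<Longrightarrow> x \<notin> K \<Longrightarrow> f x = 0"
  shows "smooth_on UNIV (\<lambda>x. if x \<in> S then f x else 0)"
proof -
  have o: "open (- K)" using K compact_imp_closed by blast
  have "smooth_on (S \<union> - K) (\<lambda>x. if x \<in> S then f x else 0)"
    by (intro smooth_on_Un S o smooth_on_cong[OF S _ f] smooth_on_cong[OF o _ smooth_on_const[OF o, of 0]])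
      (use f0 in auto)
  moreover have "S \<union> - K = UNIV" using K by auto
  ultimately show ?thesis by simp
qed

lemma integrable_compact_support:
  fixes f :: "'a::euclidean_space \<Rightarrow> 'b::{banach, second_countable_topology}"
  assumes "open S" "continuous_on S f" "compact K" "K \<subseteq> S" "\<And>x. x \<in> S \<Longrightarrow> x \<notin> K \<Longrightarrow> f x = 0"
  shows "set_integrable lborel S f"
proof -
  have "(\<lambda>x. indicator K x *\<^sub>R f x) = (\<lambda>x. indicator S x *\<^sub>R f x)"
    using assms(4,5) by (auto simp: fun_eq_iff indicator_def)
  then show ?thesis
    using borel_integrable_compact[OF assms(3) continuous_on_subset[OF assms(2,4)]]
    by (simp add: set_integrable_def)
qed

lemma integral_wirt_eq_0:
  fixes f :: "complex^'n::finite \<Rightarrow> complex"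
  assumes S: "open S" and f: "smooth_on S f" and K: "compact K" "K \<subseteq> S"
    and f0: "\<And>x. x \<in> S \<Longrightarrow> x \<notin> K \<Longrightarrow> f x = 0"
  shows "(LINT x:S|lborel. wirt a f x) = 0"
proof -
  define F where "F x = (if x \<in> S then f x else 0)" for x
  have F: "smooth_on UNIV F"
    unfolding F_def[abs_def] by (rule smooth_on_extend_by_0[OF assms])
  let ?D = "\<lambda>v x. frechet_derivative F (at x) v"
  have cont: "continuous_on UNIV (?D v)" for v
    by (intro smooth_on_imp_continuous_on smooth_on_frechet_derivative F)
  have F0: "F x = 0" if "x \<notin> K" for x using that f0 by (auto simp: F_def)
  have o: "open (- K)" using K compact_imp_closed by blast
  have D0: "?D v x = 0" if "x \<notin> K" for v x
  proof -
    have "frechet_derivative F (at x) = frechet_derivative (\<lambda>_. 0) (at x)"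
      by (rule frechet_derivative_cong_open[OF o]) (use that F0 in auto)
    then show ?thesis by simp
  qed
  have D: "(F has_derivative frechet_derivative F (at x)) (at x)" for x
    using smooth_on_imp_differentiable[OF open_UNIV F] frechet_derivative_works by blast
  have int0: "(\<integral>x. ?D v x \<partial>lborel) = 0" for v
    by (rule integral_directional_derivative_eq_0[OF D cont K(1) F0])
  have int: "integrable lborel (?D v)" for v
    using integrable_compact_support[OF open_UNIV cont K(1) _ D0] by (simp add: set_integrable_def)
  have "wirt a F x = 0" if "x \<notin> K" for x using D0[OF that] by (cases a) (auto simp: wirt_def)
  moreover have "wirt a f x = wirt a F x" if "x \<in> S" for x
    by (rule wirt_cong_open[OF S that]) (simp add: F_def)
  ultimately have "(LINT x:S|lborel. wirt a f x) = (\<integral>x. wirt a F x \<partial>lborel)"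
    unfolding set_lebesgue_integral_def
    by (intro Bochner_Integration.integral_cong) (use K(2) in \<open>auto simp: indicator_def\<close>)
  also have "\<dots> = 0"
    by (cases a) (simp_all add: wirt_def int0 int)
  finally show ?thesis .
qed

text \<open>If \<open>w x0 \<noteq> 0\<close>, then \<open>Re (cnj (w x0) * w)\<close> is positive near \<open>x0\<close>; multiplied by a bump function
supported there it is a nonnegative function that is positive on a ball, but has integral zero.\<close>

lemma fundamental_lemma:
  fixes w :: "'a::euclidean_space \<Rightarrow> complex"
  assumes S: "open S" and w: "continuous_on S w" and x0: "x0 \<in> S"
    and int0: "\<And>r. r > 0 \<Longrightarrow> cball x0 r \<subseteq> S \<Longrightarrow> (LINT x:S|lborel. of_real (bump x0 r x) * w x) = 0"
  shows "w x0 = 0"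
proof (rule ccontr)
  assume ne: "w x0 \<noteq> 0"
  define u where "u x = Re (cnj (w x0) * w x)" for x
  have u: "continuous_on S u" unfolding u_def by (intro continuous_intros w)
  have "u x0 = (cmod (w x0))\<^sup>2" unfolding u_def cmod_power2 by (simp add: power2_eq_square)
  then have "u x0 > 0" using ne by simp
  moreover have "isCont u x0" using u S x0 by (simp add: continuous_on_eq_continuous_at)
  ultimately obtain d1 where d1: "d1 > 0" "\<And>x. dist x x0 < d1 \<Longrightarrow> dist (u x) (u x0) < u x0"
    unfolding continuous_at_eps_delta by blast
  obtain d2 where d2: "d2 > 0" "ball x0 d2 \<subseteq> S" using S x0 by (meson openE)
  define d where "d = min d1 d2"
  have d: "d > 0" "\<And>x. dist x x0 < d \<Longrightarrow> u x > 0 \<and> x \<in> S"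
  proof -
    show "d > 0" using d1 d2 by (simp add: d_def)
    fix x assume x: "dist x x0 < d"
    then have "dist (u x) (u x0) < u x0" using d1(2)[of x] by (simp add: d_def)
    then have "u x > 0" unfolding dist_real_def by linarith
    moreover have "x \<in> S" using x d2 by (auto simp: d_def dist_commute)
    ultimately show "u x > 0 \<and> x \<in> S" by blast
  qed
  define r where "r = d / 2"
  have r: "r > 0" "cball x0 r \<subseteq> S" "\<And>x. x \<in> cball x0 r \<Longrightarrow> u x > 0"
    using d by (auto simp: r_def dist_commute)
  have b: "continuous_on S (bump x0 r)" by (intro smooth_on_imp_continuous_on smooth_on_bump S)
  have intw: "set_integrable lborel S (\<lambda>x. complex_of_real (bump x0 r x) * w x)"
    using r bump_eq_0[of r _ x0]
    by (intro integrable_compact_support[OF S _ compact_cball r(2)] continuous_intros b w) auto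
  have intu: "set_integrable lborel S (\<lambda>x. bump x0 r x * u x)"
    using r bump_eq_0[of r _ x0]
    by (intro integrable_compact_support[OF S _ compact_cball r(2)] continuous_intros b u) auto
  have intw': "set_integrable lborel S (\<lambda>x. cnj (w x0) * (of_real (bump x0 r x) * w x))"
    using set_integrable_mult_right[OF intw, of "cnj (w x0)"] .
  have "(LINT x:S|lborel. bump x0 r x * u x) =
      (\<integral>x. Re (indicator S x *\<^sub>R (cnj (w x0) * (of_real (bump x0 r x) * w x))) \<partial>lborel)"
    unfolding set_lebesgue_integral_def u_def
    by (intro Bochner_Integration.integral_cong) (auto simp: algebra_simps)
  also have "\<dots> = Re (LINT x:S|lborel. cnj (w x0) * (of_real (bump x0 r x) * w x))"
    unfolding set_lebesgue_integral_def using intw' unfolding set_integrable_def by (rule integral_Re)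
  also have "\<dots> = 0" using int0[OF r(1,2)] by simp
  finally have "(LINT x:S|lborel. bump x0 r x * u x) = 0" .
  moreover have nonneg: "indicator S x *\<^sub>R (bump x0 r x * u x) \<ge> 0" for x
    using r bump_eq_0[of r x x0] bump_nonneg[of x0 r x]
    by (cases "x \<in> cball x0 r") (auto simp: less_imp_le)
  ultimately have "AE x in lborel. indicator S x *\<^sub>R (bump x0 r x * u x) = 0"
    using integral_nonneg_eq_0_iff_AE[of lborel "\<lambda>x. indicator S x *\<^sub>R (bump x0 r x * u x)"] intu
    by (simp add: set_integrable_def set_lebesgue_integral_def)
  then have "AE x in lborel. x \<notin> ball x0 r"
  proof eventually_elim
    case (elim x)
    then show ?case
      using bump_pos[of x x0 r] subsetD[OF r(2), of x] r(3)[of x] by (auto simp: indicator_def)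
  qed
  then have "ball x0 r \<in> null_sets lborel"
    using AE_iff_null_sets[of "ball x0 r" lborel] by simp
  then have "negligible (ball x0 r)" 
    using negligible_iff_null_sets null_sets_completionI by blast
  then show False using open_not_negligible[of "ball x0 r"] r by auto
qed

section \<open>Inverses and determinants of Hermitian matrices\<close>

lemma matrix_inv_eq:
  fixes A :: "'a::field^'n::finite^'n"
  assumes "det A \<noteq> 0"
  shows "A ** matrix_inv A = mat 1" "matrix_inv A ** A = mat 1"
proof -
  have "\<exists>B. A ** B = mat 1 \<and> B ** A = mat 1"
    using assms invertible_det_nz[of A] by (simp add: invertible_def)
  then have "A ** matrix_inv A = mat 1 \<and> matrix_inv A ** A = mat 1"
    unfolding matrix_inv_def by (rule someI_ex)
  then show "A ** matrix_inv A = mat 1" "matrix_inv A ** A = mat 1" by auto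
qed

lemma ginv_left:
  assumes "det G \<noteq> 0"
  shows "(\<Sum>i\<in>UNIV. ginv G j i * G $ i $ k) = (if j = k then 1 else 0)"
  using arg_cong[OF matrix_inv_eq(2)[OF assms], of "\<lambda>M. M $ j $ k"]
  by (simp add: matrix_matrix_mult_def mat_def ginv_def)

lemma ginv_right:
  assumes "det G \<noteq> 0"
  shows "(\<Sum>i\<in>UNIV. G $ j $ i * ginv G i k) = (if j = k then 1 else 0)"
  using arg_cong[OF matrix_inv_eq(1)[OF assms], of "\<lambda>M. M $ j $ k"]
  by (simp add: matrix_matrix_mult_def mat_def ginv_def)

lemma sum_delta_mult:
  "(\<Sum>i\<in>UNIV. (if j = i then 1 else 0) * f i) = (f j :: complex)"
  "(\<Sum>i\<in>UNIV. (if i = j then 1 else 0) * f i) = (f j :: complex)"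
  "(\<Sum>i\<in>UNIV. f i * (if i = j then 1 else 0)) = (f j :: complex)"
  "(\<Sum>i\<in>UNIV. f i * (if j = i then 1 else 0)) = (f j :: complex)"
  for j :: "'n::finite"
  by (simp_all add: if_distrib[of "\<lambda>c. c * f i" for i] if_distrib[of "\<lambda>c. f i * c" for i] cong: if_cong)

lemma ginv_right_contract:
  assumes "det G \<noteq> 0"
  shows "(\<Sum>i\<in>UNIV. G $ j $ i * (\<Sum>k\<in>UNIV. ginv G i k * v k)) = v j"
proof -
  have "(\<Sum>i\<in>UNIV. G $ j $ i * (\<Sum>k\<in>UNIV. ginv G i k * v k)) =
      (\<Sum>k\<in>UNIV. (\<Sum>i\<in>UNIV. G $ j $ i * ginv G i k) * v k)"
    unfolding sum_distrib_left sum_distrib_right by (subst sum.swap) (simp add: mult.assoc)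
  then show ?thesis by (simp add: ginv_right[OF assms] sum_delta_mult)
qed

lemma ginv_left_contract:
  assumes "det G \<noteq> 0"
  shows "(\<Sum>i\<in>UNIV. (\<Sum>k\<in>UNIV. v k * ginv G k i) * G $ i $ j) = v j"
proof -
  have "(\<Sum>i\<in>UNIV. (\<Sum>k\<in>UNIV. v k * ginv G k i) * G $ i $ j) =
      (\<Sum>k\<in>UNIV. v k * (\<Sum>i\<in>UNIV. ginv G k i * G $ i $ j))"
    unfolding sum_distrib_left sum_distrib_right by (subst sum.swap) (simp add: mult.assoc)
  then show ?thesis by (simp add: ginv_left[OF assms] sum_delta_mult)
qed

lemma ginv_unique:
  assumes "det G \<noteq> 0" "\<And>j k. (\<Sum>i\<in>UNIV. X j i * G $ i $ k) = (if j = k then 1 else 0)"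
  shows "X j k = ginv G j k"
proof -
  have "X j k = (\<Sum>i\<in>UNIV. X j i * (\<Sum>l\<in>UNIV. G $ i $ l * ginv G l k))"
    by (simp add: ginv_right[OF assms(1)] sum_delta_mult)
  also have "\<dots> = (\<Sum>l\<in>UNIV. (\<Sum>i\<in>UNIV. X j i * G $ i $ l) * ginv G l k)"
    unfolding sum_distrib_left sum_distrib_right by (subst sum.swap) (simp add: mult.assoc)
  also have "\<dots> = ginv G j k" by (simp add: assms(2) sum_delta_mult)
  finally show ?thesis .
qed

lemma ginv_hermitian:
  assumes "det G \<noteq> 0" "\<And>i j. G $ j $ i = cnj (G $ i $ j)"
  shows "cnj (ginv G j i) = ginv G i j"
proof (rule ginv_unique[OF assms(1), of "\<lambda>i j. cnj (ginv G j i)"])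
  fix i k
  have "(\<Sum>j\<in>UNIV. cnj (ginv G j i) * G $ j $ k) = cnj (\<Sum>j\<in>UNIV. G $ k $ j * ginv G j i)"
    by (simp add: assms(2)[of k] mult.commute)
  also have "\<dots> = (if i = k then 1 else 0)" by (simp add: ginv_right[OF assms(1)])
  finally show "(\<Sum>j\<in>UNIV. cnj (ginv G j i) * G $ j $ k) = (if i = k then 1 else 0)" .
qed

text \<open>Cramer's rule exhibits the entries of the inverse matrix as rational functions of the entries of the
matrix, hence as smooth functions.\<close>

lemma ginv_cramer:
  assumes "det G \<noteq> 0"
  shows "ginv G j i = det (\<chi> k l. if l = j then (if k = i then 1 else 0) else G $ k $ l) / det G"
proof -
  have "G *v (\<chi> j. ginv G j i) = (\<chi> k. if k = i then 1 else 0)"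
    using ginv_right[OF assms, of _ i] by (simp add: matrix_vector_mult_def vec_eq_iff)
  then show ?thesis unfolding cramer[OF assms] by (simp add: vec_eq_iff cong: if_cong)
qed

definition posdef :: "complex^'n::finite^'n \<Rightarrow> bool" where
  "posdef G \<longleftrightarrow> (\<forall>v. v \<noteq> 0 \<longrightarrow> 0 < Re (\<Sum>i\<in>UNIV. \<Sum>j\<in>UNIV. G $ i $ j * v $ i * cnj (v $ j)))"

lemma posdef_det_nz:
  assumes "posdef G"
  shows "det G \<noteq> 0"
proof
  assume "det G = 0"
  then have "\<not> invertible (transpose G)" using invertible_det_nz[of "transpose G"] by (simp add: det_transpose)
  then obtain v where v: "transpose G *v v = 0" "v \<noteq> 0"
    using matrix_left_invertible_ker[of "transpose G"] invertible_left_inverse by blast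
  have *: "(\<Sum>i\<in>UNIV. G $ i $ j * v $ i) = 0" for j
    using arg_cong[OF v(1), of "\<lambda>u. u $ j"] by (simp add: matrix_vector_mult_def transpose_def)
  have "(\<Sum>i\<in>UNIV. \<Sum>j\<in>UNIV. G $ i $ j * v $ i * cnj (v $ j)) = 0"
    by (subst sum.swap) (simp add: * flip: sum_distrib_right)
  moreover have "0 < Re (\<Sum>i\<in>UNIV. \<Sum>j\<in>UNIV. G $ i $ j * v $ i * cnj (v $ j))"
    using assms v(2) unfolding posdef_def by blast
  ultimately show False by simp
qed

lemma det_hermitian_real:
  assumes "\<And>i j. G $ j $ i = cnj (G $ i $ j)"
  shows "Im (det G) = 0"
proof -
  have "cnj (det G) = det (\<chi> i j. cnj (G $ i $ j))"
    by (simp add: det_def)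
  also have "(\<chi> i j. cnj (G $ i $ j)) = transpose G"
    by (simp add: transpose_def vec_eq_iff flip: assms)
  finally have "cnj (det G) = det G" by (simp add: det_transpose)
  then show ?thesis by (simp add: complex_eq_iff)
qed

text \<open>The segment from the identity matrix to \<open>G\<close> consists of positive definite Hermitian matrices, on
which the determinant is real and does not vanish. So it keeps the sign that it has at the identity.\<close>

lemma posdef_det_pos:
  assumes pos: "posdef G" and herm: "\<And>i j. G $ j $ i = cnj (G $ i $ j)"
  shows "Re (det G) > 0"
proof (rule ccontr)
  assume neg: "\<not> Re (det G) > 0"
  define H where "H t = (\<chi> i j. of_real (1 - t) * mat 1 $ i $ j + of_real t * G $ i $ j)" for t :: real
  have mat1: "(\<Sum>i\<in>UNIV. \<Sum>j\<in>UNIV. mat 1 $ i $ j * v $ i * cnj (v $ j)) = of_real ((norm v)\<^sup>2)"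
    for v :: "complex^'a"
    by (simp add: mat_def if_distrib[of "\<lambda>c. c * _ * _"] complex_norm_square[symmetric] norm_vec_def L2_set_def
      sum_nonneg if_distribR cong: if_cong)
  have H: "posdef (H t)" if "0 \<le> t" "t \<le> 1" for t
    unfolding posdef_def
  proof (intro allI impI)
    fix v :: "complex^'a" assume v: "v \<noteq> 0"
    have "(\<Sum>i\<in>UNIV. \<Sum>j\<in>UNIV. H t $ i $ j * v $ i * cnj (v $ j)) =
      of_real (1 - t) * (\<Sum>i\<in>UNIV. \<Sum>j\<in>UNIV. mat 1 $ i $ j * v $ i * cnj (v $ j)) +
      of_real t * (\<Sum>i\<in>UNIV. \<Sum>j\<in>UNIV. G $ i $ j * v $ i * cnj (v $ j))"
      unfolding sum_distrib_left sum.distrib[symmetric] H_def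
      by (intro sum.cong) (auto simp: algebra_simps)
    then have "Re (\<Sum>i\<in>UNIV. \<Sum>j\<in>UNIV. H t $ i $ j * v $ i * cnj (v $ j)) =
      (1 - t) * (norm v)\<^sup>2 + t * Re (\<Sum>i\<in>UNIV. \<Sum>j\<in>UNIV. G $ i $ j * v $ i * cnj (v $ j))"
      unfolding mat1 by simp
    also have "\<dots> > 0"
    proof (cases "t = 0")
      case False
      then show ?thesis
        using that pos v unfolding posdef_def by (intro add_nonneg_pos mult_pos_pos) auto
    qed (use v in simp)
    finally show "0 < Re (\<Sum>i\<in>UNIV. \<Sum>j\<in>UNIV. H t $ i $ j * v $ i * cnj (v $ j))" .
  qed
  have "continuous_on {0..1} (\<lambda>t. Re (det (H t)))"
    unfolding det_def H_def by (auto intro!: continuous_intros)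
  moreover have "H 0 = mat 1" "H 1 = G" by (simp_all add: H_def vec_eq_iff)
  ultimately obtain t where t: "0 \<le> t" "t \<le> 1" "Re (det (H t)) = 0"
    using IVT2'[of "\<lambda>t. Re (det (H t))" 1 0 0] neg by auto
  have "H t $ j $ i = cnj (H t $ i $ j)" for i j
    unfolding H_def by (simp add: herm[of j i] mat_def)
  then have "Im (det (H t)) = 0" by (rule det_hermitian_real)
  with t show False using posdef_det_nz[OF H[OF t(1,2)]] by (simp add: complex_eq_iff)
qed

lemma smooth_on_det:
  fixes G :: "'a::real_normed_vector \<Rightarrow> complex^'n::finite^'n"
  assumes "open S" "\<And>i j. smooth_on S (\<lambda>x. G x $ i $ j)"
  shows "smooth_on S (\<lambda>x. det (G x))"
  unfolding det_def by (intro smooth_on_intros assms)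

lemma differentiable_prod:
  fixes f :: "'i \<Rightarrow> 'a::real_normed_vector \<Rightarrow> 'b::real_normed_field"
  assumes "\<And>i. i \<in> I \<Longrightarrow> f i differentiable (at x)"
  shows "(\<lambda>y. \<Prod>i\<in>I. f i y) differentiable (at x)"
  using assms by (induction I rule: infinite_finite_induct) (auto intro: differentiable_mult)

lemma wirt_prod:
  assumes "finite I" "\<And>i. i \<in> I \<Longrightarrow> f i differentiable (at x)"
  shows "wirt a (\<lambda>y. \<Prod>i\<in>I. f i y) x = (\<Sum>i\<in>I. wirt a (f i) x * (\<Prod>j\<in>I - {i}. f j x))"
  using assms
proof (induction I rule: finite_induct)
  case (insert k I)
  have "(\<Sum>i\<in>I. wirt a (f i) x * (\<Prod>j\<in>insert k I - {i}. f j x)) =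
      f k x * (\<Sum>i\<in>I. wirt a (f i) x * (\<Prod>j\<in>I - {i}. f j x))"
    unfolding sum_distrib_left
  proof (rule sum.cong)
    fix i assume "i \<in> I"
    then have "insert k I - {i} = insert k (I - {i})" using insert by auto
    then show "wirt a (f i) x * (\<Prod>j\<in>insert k I - {i}. f j x) =
        f k x * (wirt a (f i) x * (\<Prod>j\<in>I - {i}. f j x))"
      using insert by simp
  qed simp
  moreover have "insert k I - {k} = I" using insert by auto
  ultimately show ?case using insert by (simp add: wirt_mult differentiable_prod)
qed simp

text \<open>Jacobi's formula. The determinant is linear in each row, so its derivative is the sum over \<open>k\<close> of the
determinants with row \<open>k\<close> replaced by its derivative. That row is a combination of the rows of \<open>G\<close>
with coefficients from \<open>\<partial>G G\<^sup>-\<^sup>1\<close>, and Cramer's lemma extracts the coefficient of row \<open>k\<close>.\<close>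

lemma wirt_det:
  fixes G :: "complex^'m::finite \<Rightarrow> complex^'n::finite^'n"
  assumes d: "\<And>i j. (\<lambda>y. G y $ i $ j) differentiable (at x)" and nz: "det (G x) \<noteq> 0"
  shows "wirt a (\<lambda>y. det (G y)) x =
    (\<Sum>k\<in>UNIV. \<Sum>l\<in>UNIV. ginv (G x) l k * wirt a (\<lambda>y. G y $ k $ l) x) * det (G x)"
proof -
  have dp: "(\<lambda>y. \<Prod>i\<in>UNIV. G y $ i $ p i) differentiable (at x)" for p
    using d by (intro differentiable_prod) auto
  define E where "E k l = wirt a (\<lambda>y. G y $ k $ l) x" for k l
  have "wirt a (\<lambda>y. det (G y)) x = (\<Sum>p | p permutes UNIV. of_int (sign p) *
      (\<Sum>k\<in>UNIV. E k (p k) * (\<Prod>i\<in>UNIV - {k}. G x $ i $ p i)))"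
    unfolding det_def E_def
    by (simp add: wirt_sum wirt_cmult dp differentiable_mult wirt_prod d)
  also have "\<dots> = (\<Sum>k\<in>UNIV. \<Sum>p | p permutes UNIV. of_int (sign p) *
      (E k (p k) * (\<Prod>i\<in>UNIV - {k}. G x $ i $ p i)))"
    unfolding sum_distrib_left by (rule sum.swap)
  also have "\<dots> = (\<Sum>k\<in>UNIV. det (\<chi> i. if i = k then (\<chi> l. E k l) else row i (G x)))"
  proof (rule sum.cong)
    fix k
    have "(\<Prod>i\<in>UNIV. (\<chi> i. if i = k then (\<chi> l. E k l) else row i (G x)) $ i $ p i) =
        E k (p k) * (\<Prod>i\<in>UNIV - {k}. G x $ i $ p i)" for p
      by (subst prod.remove[of _ k]) (auto simp: row_def intro!: prod.cong)
    then show "(\<Sum>p | p permutes UNIV. of_int (sign p) * (E k (p k) * (\<Prod>i\<in>UNIV - {k}. G x $ i $ p i))) =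
        det (\<chi> i. if i = k then (\<chi> l. E k l) else row i (G x))"
      unfolding det_def by simp
  qed simp
  also have "\<dots> = (\<Sum>k\<in>UNIV. (\<Sum>l\<in>UNIV. ginv (G x) l k * E k l) * det (G x))"
  proof (rule sum.cong)
    fix k
    have row: "(\<chi> l. E k l) = (\<Sum>i\<in>UNIV. (\<chi> i. \<Sum>l\<in>UNIV. E k l * ginv (G x) l i) $ i *s row i (G x))"
      using ginv_left_contract[OF nz, of "E k"] by (simp add: vec_eq_iff row_def)
    have "det (\<chi> i. if i = k then (\<chi> l. E k l) else row i (G x)) =
        (\<Sum>l\<in>UNIV. E k l * ginv (G x) l k) * det (G x)"
      unfolding row cramer_lemma_transpose by simp
    then show "det (\<chi> i. if i = k then (\<chi> l. E k l) else row i (G x)) =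
        (\<Sum>l\<in>UNIV. ginv (G x) l k * E k l) * det (G x)" by (simp add: mult.commute)
  qed simp
  finally show ?thesis by (simp add: E_def sum_distrib_right)
qed

section \<open>Hermitian metrics on a coordinate domain\<close>

locale hermitian_domain =
  fixes S :: "(complex^'n::finite) set" and h :: "complex^'n \<Rightarrow> complex^'n^'n"
  assumes open_S: "open S"
    and smooth_h: "smooth_on S (\<lambda>x. h x $ i $ j)"
    and herm: "x \<in> S \<Longrightarrow> h x $ j $ i = cnj (h x $ i $ j)"
    and posdef_h: "x \<in> S \<Longrightarrow> posdef (h x)"
begin

lemmas smooth_differentiable = smooth_on_imp_differentiable[OF open_S]
lemmas smooth_intros = smooth_on_intros[OF open_S]
lemmas smooth_wirt = smooth_on_wirt[OF open_S]

lemma det_nz: "x \<in> S \<Longrightarrow> det (h x) \<noteq> 0"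
  using posdef_h posdef_det_nz by blast

lemma ginv_sym: "x \<in> S \<Longrightarrow> cnj (ginv (h x) j i) = ginv (h x) i j"
  by (rule ginv_hermitian[OF det_nz herm])

lemma smooth_det: "smooth_on S (\<lambda>x. det (h x))"
  by (rule smooth_on_det[OF open_S smooth_h])

lemma smooth_ginv: "smooth_on S (\<lambda>x. ginv (h x) j i)"
proof -
  have "smooth_on S (\<lambda>x. det (\<chi> k l. if l = j then (if k = i then 1 else 0) else h x $ k $ l) / det (h x))"
    using det_nz
    by (intro smooth_on_divide smooth_on_det smooth_det open_S)
      (auto intro!: smooth_on_if smooth_on_const smooth_h open_S)
  then show ?thesis
    by (rule smooth_on_cong[OF open_S _ , rotated]) (simp add: ginv_cramer[OF det_nz])
qed

lemmas diff_h = smooth_differentiable[OF smooth_h]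
lemmas diff_ginv = smooth_differentiable[OF smooth_ginv]
lemmas diff_det = smooth_differentiable[OF smooth_det]

text \<open>This is \<open>\<partial>(g\<^sup>-\<^sup>1) = - g\<^sup>-\<^sup>1 (\<partial>g) g\<^sup>-\<^sup>1\<close>, from differentiating \<open>g\<^sup>-\<^sup>1 g = 1\<close>.\<close>

lemma wirt_ginv:
  assumes x: "x \<in> S"
  shows "wirt a (\<lambda>y. ginv (h y) j i) x =
    - (\<Sum>k\<in>UNIV. \<Sum>l\<in>UNIV. ginv (h x) j k * wirt a (\<lambda>y. h y $ k $ l) x * ginv (h x) l i)"
proof -
  let ?D = "\<lambda>k l. wirt a (\<lambda>y. h y $ k $ l) x" and ?g = "ginv (h x)"
  have "(\<Sum>k\<in>UNIV. wirt a (\<lambda>y. ginv (h y) j k) x * h x $ k $ l) = - (\<Sum>k\<in>UNIV. ?g j k * ?D k l)" for l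
  proof -
    have "wirt a (\<lambda>y. \<Sum>k\<in>UNIV. ginv (h y) j k * h y $ k $ l) x =
        wirt a (\<lambda>y. if j = l then 1 else 0) x"
      by (rule wirt_cong_open[OF open_S x]) (simp add: ginv_left[OF det_nz])
    then have "(\<Sum>k\<in>UNIV. wirt a (\<lambda>y. ginv (h y) j k) x * h x $ k $ l + ?g j k * ?D k l) = 0"
      by (simp add: wirt_sum wirt_mult diff_h diff_ginv x differentiable_mult)
    then show ?thesis by (simp add: sum.distrib add_eq_0_iff)
  qed
  then have "(\<Sum>l\<in>UNIV. (\<Sum>k\<in>UNIV. wirt a (\<lambda>y. ginv (h y) j k) x * h x $ k $ l) * ?g l i) =
      - (\<Sum>l\<in>UNIV. \<Sum>k\<in>UNIV. ?g j k * ?D k l * ?g l i)"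
    by (simp add: sum_distrib_right sum_negf)
  moreover have "(\<Sum>l\<in>UNIV. (\<Sum>k\<in>UNIV. wirt a (\<lambda>y. ginv (h y) j k) x * h x $ k $ l) * ?g l i) =
      (\<Sum>k\<in>UNIV. wirt a (\<lambda>y. ginv (h y) j k) x * (\<Sum>l\<in>UNIV. h x $ k $ l * ?g l i))"
    unfolding sum_distrib_left sum_distrib_right by (subst sum.swap) (simp add: mult.assoc)
  moreover have "\<dots> = wirt a (\<lambda>y. ginv (h y) j i) x"
    by (simp add: ginv_right[OF det_nz[OF x]] sum_delta_mult)
  moreover have "(\<Sum>l\<in>UNIV. \<Sum>k\<in>UNIV. ?g j k * ?D k l * ?g l i) =
      (\<Sum>k\<in>UNIV. \<Sum>l\<in>UNIV. ?g j k * ?D k l * ?g l i)" by (rule sum.swap)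
  ultimately show ?thesis by argo
qed

lemma wirt_h_bar:
  assumes x: "x \<in> S"
  shows "wirt (bar a) (\<lambda>y. h y $ k $ l) x = cnj (wirt a (\<lambda>y. h y $ l $ k) x)"
proof -
  have "wirt (bar a) (\<lambda>y. h y $ k $ l) x = wirt (bar a) (\<lambda>y. cnj (h y $ l $ k)) x"
    by (rule wirt_cong_open[OF open_S x]) (rule herm)
  also have "\<dots> = cnj (wirt (bar (bar a)) (\<lambda>y. h y $ l $ k) x)"
    by (rule wirt_cnj[OF diff_h[OF x]])
  finally show ?thesis by simp
qed

text \<open>The exponential of \<open>log_det\<close> is the determinant, which is real and positive; comparing derivatives
reduces the claim to Jacobi's formula.\<close>

lemma wirt_log_det:
  assumes x: "x \<in> S"
  shows "wirt a (\<lambda>y. log_det h y []) x =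
    (\<Sum>k\<in>UNIV. \<Sum>l\<in>UNIV. ginv (h x) l k * wirt a (\<lambda>y. h y $ k $ l) x)"
proof -
  let ?L = "\<lambda>y. log_det h y []"
  have real: "Im (det (h y)) = 0" "Re (det (h y)) > 0" if "y \<in> S" for y
    using det_hermitian_real[OF herm[OF that]] posdef_det_pos[OF posdef_h[OF that] herm[OF that]] by blast+
  have ex: "exp (?L y) = det (h y)" if "y \<in> S" for y
    using real[OF that] by (simp add: log_det_def complex_eq_iff exp_of_real)
  obtain D where D: "(?L has_derivative D) (at x)"
  proof -
    have "((\<lambda>y. Re (det (h y))) has_derivative (\<lambda>v. Re (frechet_derivative (\<lambda>y. det (h y)) (at x) v))) (at x)"
      using diff_det[OF x] frechet_derivative_works by (intro has_derivative_Re) blast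
    from has_derivative_of_real[OF has_derivative_ln[OF _ this]] show ?thesis
      using that real[OF x] unfolding log_det_def by blast
  qed
  have E: "((\<lambda>y. exp (?L y)) has_derivative (\<lambda>v. exp (?L x) * D v)) (at x)"
    using has_derivative_compose[OF D DERIV_exp[THEN has_field_derivative_imp_has_derivative]] .
  have "wirt a (\<lambda>y. exp (?L y)) x = exp (?L x) * wirt a ?L x"
    unfolding wirt_has_derivative[OF E] wirt_has_derivative[OF D]
    by (cases a) (auto simp: field_simps)
  moreover have "wirt a (\<lambda>y. exp (?L y)) x = wirt a (\<lambda>y. det (h y)) x"
    by (rule wirt_cong_open[OF open_S x ex])
  ultimately have "det (h x) * wirt a ?L x =
      (\<Sum>k\<in>UNIV. \<Sum>l\<in>UNIV. ginv (h x) l k * wirt a (\<lambda>y. h y $ k $ l) x) * det (h x)"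
    by (simp add: wirt_det diff_h det_nz x ex)
  then show ?thesis using det_nz[OF x] by simp
qed

lemma smooth_torsion: "smooth_on S (\<lambda>x. torsion h x i j k)"
  unfolding torsion_def by (intro smooth_intros smooth_wirt smooth_h)

text \<open>The trace \<open>g\<^bsup>\<bar>l i\<^esup> T\<^bsub>ki\<bar>l\<^esub>\<close> of the torsion.\<close>

definition tau :: "complex^'n \<Rightarrow> 'n \<Rightarrow> complex" where
  "tau x k = (\<Sum>i\<in>UNIV. \<Sum>l\<in>UNIV. ginv (h x) l i * torsion h x k i l)"

lemma smooth_tau: "smooth_on S (\<lambda>x. tau x k)"
  unfolding tau_def by (intro smooth_intros smooth_ginv smooth_torsion)

text \<open>Divided by \<open>det g\<close>, the derivative of \<open>det g\<close> contributes \<open>g\<^bsup>\<bar>j i\<^esup> g\<^bsup>\<bar>l k\<^esup> \<partial>\<^sub>i g\<^bsub>k\<bar>l\<^esub>\<close> and that of the inverse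
metric \<open>- g\<^bsup>\<bar>j k\<^esup> g\<^bsup>\<bar>l i\<^esup> \<partial>\<^sub>i g\<^bsub>k\<bar>l\<^esub>\<close>. After exchanging \<open>i\<close> and \<open>k\<close> in one of them, the
difference is a contraction of the torsion: this is how the torsion enters the adjoints.\<close>

lemma divergence_ginv:
  assumes x: "x \<in> S"
  shows "(\<Sum>i\<in>UNIV. wirt (Inl i) (\<lambda>y. ginv (h y) j i * det (h y)) x) =
    (\<Sum>k\<in>UNIV. ginv (h x) j k * tau x k) * det (h x)"
proof -
  let ?g = "ginv (h x)" and ?D = "\<lambda>i k l. wirt (Inl i) (\<lambda>y. h y $ k $ l) x"
  have "wirt (Inl i) (\<lambda>y. ginv (h y) j i * det (h y)) x =
      ((\<Sum>k\<in>UNIV. \<Sum>l\<in>UNIV. ?g j i * (?g l k * ?D i k l)) -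
      (\<Sum>k\<in>UNIV. \<Sum>l\<in>UNIV. ?g j k * (?g l i * ?D i k l))) * det (h x)" for i
  proof -
    have "wirt (Inl i) (\<lambda>y. ginv (h y) j i * det (h y)) x =
       - (\<Sum>k\<in>UNIV. \<Sum>l\<in>UNIV. ?g j k * ?D i k l * ?g l i) * det (h x) +
       ?g j i * ((\<Sum>k\<in>UNIV. \<Sum>l\<in>UNIV. ?g l k * ?D i k l) * det (h x))"
      by (simp add: wirt_mult diff_ginv diff_det wirt_ginv wirt_det diff_h det_nz x)
    moreover have "(\<Sum>k\<in>UNIV. \<Sum>l\<in>UNIV. ?g j i * (?g l k * ?D i k l)) =
        ?g j i * (\<Sum>k\<in>UNIV. \<Sum>l\<in>UNIV. ?g l k * ?D i k l)"
      by (simp add: sum_distrib_left)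
    moreover have "(\<Sum>k\<in>UNIV. \<Sum>l\<in>UNIV. ?g j k * (?g l i * ?D i k l)) =
        (\<Sum>k\<in>UNIV. \<Sum>l\<in>UNIV. ?g j k * ?D i k l * ?g l i)"
      by (simp add: mult_ac)
    ultimately show ?thesis by (simp only:) (simp add: algebra_simps)
  qed
  then have "(\<Sum>i\<in>UNIV. wirt (Inl i) (\<lambda>y. ginv (h y) j i * det (h y)) x) =
     ((\<Sum>i\<in>UNIV. \<Sum>k\<in>UNIV. \<Sum>l\<in>UNIV. ?g j i * (?g l k * ?D i k l)) -
      (\<Sum>i\<in>UNIV. \<Sum>k\<in>UNIV. \<Sum>l\<in>UNIV. ?g j k * (?g l i * ?D i k l))) * det (h x)"
    by (simp only: sum_subtractf sum_distrib_right[symmetric])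
  also have "(\<Sum>i\<in>UNIV. \<Sum>k\<in>UNIV. \<Sum>l\<in>UNIV. ?g j k * (?g l i * ?D i k l)) =
      (\<Sum>k\<in>UNIV. \<Sum>i\<in>UNIV. \<Sum>l\<in>UNIV. ?g j k * (?g l i * ?D i k l))"
    by (rule sum.swap)
  finally show ?thesis
    by (simp add: tau_def torsion_def sum_subtractf sum_distrib_left algebra_simps)
qed

end

section \<open>Recursion for the inner product of tensors\<close>

lemma sum_idx:
  fixes f :: "'n::finite idx \<Rightarrow> 'b::comm_monoid_add"
  shows "(\<Sum>a\<in>UNIV. f a) = (\<Sum>i\<in>UNIV. f (Inl i)) + (\<Sum>i\<in>UNIV. f (Inr i))"
  unfolding UNIV_sum by (subst sum.union_disjoint) (auto simp: sum.reindex)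

lemma sum_lists_Suc:
  fixes f :: "'a::finite list \<Rightarrow> 'b::comm_monoid_add"
  shows "(\<Sum>as | length as = Suc r. f as) = (\<Sum>a\<in>UNIV. \<Sum>as | length as = r. f (a # as))"
proof -
  have "(\<Sum>a\<in>UNIV. \<Sum>as | length as = r. f (a # as)) = (\<Sum>(a, as)\<in>UNIV \<times> {as. length as = r}. f (a # as))"
    by (rule sum.cartesian_product)
  also have "\<dots> = sum f {as. length as = Suc r}"
    by (rule sum.reindex_bij_witness[of _ "\<lambda>as. (hd as, tl as)" "\<lambda>(a, as). a # as"])
      (auto simp: length_Suc_conv)
  finally show ?thesis by simp
qed

lemma tens_inner_0: "tens_inner G 0 A B = A [] * cnj (B [])"
  by (simp add: tens_inner_def)

text \<open>Splitting off the first slot allows induction on the rank in the statements about tensors.\<close>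

lemma tens_inner_Suc:
  "tens_inner G (Suc r) A B = (\<Sum>a\<in>UNIV. \<Sum>b\<in>UNIV.
     coframe_inner G a b * tens_inner G r (\<lambda>as. A (a # as)) (\<lambda>bs. B (b # bs)))"
proof -
  have "tens_inner G (Suc r) A B = (\<Sum>a\<in>UNIV. \<Sum>as | length as = r. \<Sum>b\<in>UNIV. \<Sum>bs | length bs = r.
      coframe_inner G a b * ((\<Prod>m<r. coframe_inner G (as ! m) (bs ! m)) * A (a # as) * cnj (B (b # bs))))"
    unfolding tens_inner_def sum_lists_Suc prod.lessThan_Suc_shift by (simp add: mult.assoc)
  also have "\<dots> = (\<Sum>a\<in>UNIV. \<Sum>b\<in>UNIV. coframe_inner G a b *
      tens_inner G r (\<lambda>as. A (a # as)) (\<lambda>bs. B (b # bs)))"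
    unfolding tens_inner_def sum_distrib_left
    by (rule sum.cong[OF refl], rule sum.swap)
  finally show ?thesis .
qed

lemma coframe_inner_simps [simp]:
  "coframe_inner G (Inl i) (Inl j) = ginv G j i"
  "coframe_inner G (Inr i) (Inr j) = ginv G i j"
  "coframe_inner G (Inl i) (Inr j) = 0"
  "coframe_inner G (Inr i) (Inl j) = 0"
  by (simp_all add: coframe_inner_def)

lemma tens_inner_1: "tens_inner G 1 A B =
    (\<Sum>a\<in>UNIV. \<Sum>b\<in>UNIV. coframe_inner G a b * (A [a] * cnj (B [b])))"
  unfolding One_nat_def tens_inner_Suc tens_inner_0 ..

section \<open>Formal adjoints on one-forms\<close>

lemma set_integral_sum:
  fixes f :: "'i \<Rightarrow> 'a \<Rightarrow> 'b::{banach, second_countable_topology}"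
  assumes "\<And>i. i \<in> I \<Longrightarrow> set_integrable M A (f i)"
  shows "set_integrable M A (\<lambda>x. \<Sum>i\<in>I. f i x)"
    and "(LINT x:A|M. (\<Sum>i\<in>I. f i x)) = (\<Sum>i\<in>I. LINT x:A|M. f i x)"
  using assms unfolding set_integrable_def set_lebesgue_integral_def scaleR_sum_right
  by (auto intro: Bochner_Integration.integral_sum)

lemma degree_filter:
  "{m. m < Suc (Suc 0) \<and> P m} = (if P 0 then {0} else {}) \<union> (if P 1 then {1} else {})"
  "{m. m < Suc 0 \<and> P m} = (if P 0 then {0} else {})"
  "{m::nat. m = 0 \<and> P m} = (if P 0 then {0} else {})"
  by (auto simp: less_Suc_eq intro: gr0I)

context hermitian_domain
begin

lemma smooth_coframe_inner: "smooth_on S (\<lambda>x. coframe_inner (h x) a b)"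
  by (cases a; cases b) (simp_all add: smooth_ginv smooth_on_const open_S)

lemma alternating_1: "alternating 1 \<alpha>"
  by (simp add: alternating_def)

lemma test_formD:
  assumes "test_form S 1 \<eta>"
  shows "smooth_on S (\<lambda>x. \<eta> x [b])" "\<exists>K. compact K \<and> K \<subseteq> S \<and> (\<forall>x. x \<notin> K \<longrightarrow> \<eta> x [b] = 0)"
  using assms smooth_on_subset[of S UNIV] unfolding test_form_def smooth_form_on_def by force+

text \<open>The product \<open>M \<eta>\<close> has compact support in \<open>S\<close>, so the integral of its derivative vanishes.\<close>

lemma integral_by_parts:
  assumes M: "smooth_on S M" and \<eta>: "smooth_on S \<eta>"
    and K: "compact K" "K \<subseteq> S" "\<And>x. x \<notin> K \<Longrightarrow> \<eta> x = 0"
  shows "set_integrable lborel S (\<lambda>x. M x * wirt a \<eta> x)"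
    and "set_integrable lborel S (\<lambda>x. wirt a M x * \<eta> x)"
    and "(LINT x:S|lborel. M x * wirt a \<eta> x) = - (LINT x:S|lborel. wirt a M x * \<eta> x)"
proof -
  have o: "open (- K)" using K compact_imp_closed by blast
  have w0: "wirt a \<eta> x = 0" if "x \<notin> K" for x
    using wirt_cong_open[OF o, of x \<eta> "\<lambda>_. 0" a] that K(3) by simp
  show 1: "set_integrable lborel S (\<lambda>x. M x * wirt a \<eta> x)"
    by (intro integrable_compact_support[OF open_S _ K(1,2)] smooth_on_imp_continuous_on smooth_intros M smooth_wirt \<eta>)
      (simp add: w0)
  show 2: "set_integrable lborel S (\<lambda>x. wirt a M x * \<eta> x)"
    by (intro integrable_compact_support[OF open_S _ K(1,2)] smooth_on_imp_continuous_on smooth_intros M smooth_wirt \<eta>)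
      (simp add: K)
  have "(LINT x:S|lborel. wirt a (\<lambda>y. M y * \<eta> y) x) = 0"
    by (rule integral_wirt_eq_0[OF open_S smooth_on_mult[OF open_S M \<eta>] K(1,2)]) (simp add: K)
  moreover have "(LINT x:S|lborel. wirt a (\<lambda>y. M y * \<eta> y) x) =
      (LINT x:S|lborel. wirt a M x * \<eta> x + M x * wirt a \<eta> x)"
    using open_S by (intro set_lebesgue_integral_cong)
      (auto simp: wirt_mult smooth_differentiable[OF M] smooth_differentiable[OF \<eta>])
  ultimately show "(LINT x:S|lborel. M x * wirt a \<eta> x) = - (LINT x:S|lborel. wirt a M x * \<eta> x)"
    by (simp add: set_integral_add[OF 2 1] add_eq_0_iff)
qed

text \<open>When the pairing of \<open>D \<eta>\<close> with \<open>\<beta>\<close>, times the volume density, is a first order operator in \<open>\<eta>\<close> with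
coefficients \<open>M a b\<close>, the adjoint is read off from the divergence of the coefficients. Both \<open>\<partial>\<close> and
\<open>\<partial>\<bar>\<close> are covered by letting \<open>a\<close> and \<open>b\<close> range over barred and unbarred indices.\<close>

lemma is_formal_adjointI:
  assumes M: "\<And>a b. smooth_on S (M a b)"
    and \<theta>: "\<And>d. smooth_on S (\<lambda>x. \<theta> x [d])"
    and D: "\<And>\<eta> x. x \<in> S \<Longrightarrow> form_inner (h x) 2 (D \<eta> x) (\<beta> x) * det (h x) =
        (\<Sum>a\<in>UNIV. \<Sum>b\<in>UNIV. M a b x * wirt a (\<lambda>y. \<eta> y [b]) x)"
    and div: "\<And>x b. x \<in> S \<Longrightarrow> (\<Sum>d\<in>UNIV. coframe_inner (h x) b d * cnj (\<theta> x [d])) * det (h x) =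
        - (\<Sum>a\<in>UNIV. wirt a (M a b) x)"
  shows "is_formal_adjoint D S h 1 \<beta> \<theta>"
  unfolding is_formal_adjoint_def
proof (intro conjI allI impI)
  show "smooth_form_on S 1 \<theta>"
    using \<theta> by (auto simp: smooth_form_on_def alternating_1[unfolded One_nat_def] length_Suc_conv)
  fix \<eta> :: "'n tens_field" assume test: "test_form S 1 \<eta>"
  note \<eta> = test_formD[OF test]
  have ibp: "set_integrable lborel S (\<lambda>x. M a b x * wirt a (\<lambda>y. \<eta> y [b]) x)"
    "set_integrable lborel S (\<lambda>x. wirt a (M a b) x * \<eta> x [b])"
    "(LINT x:S|lborel. M a b x * wirt a (\<lambda>y. \<eta> y [b]) x) = - (LINT x:S|lborel. wirt a (M a b) x * \<eta> x [b])"
    for a b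
    using integral_by_parts[OF M[of a b] \<eta>(1)[of b]] \<eta>(2)[of b] by blast+
  have "(LINT x:S|lborel. form_inner (h x) (Suc 1) (D \<eta> x) (\<beta> x) * det (h x)) =
      (LINT x:S|lborel. (\<Sum>a\<in>UNIV. \<Sum>b\<in>UNIV. M a b x * wirt a (\<lambda>y. \<eta> y [b]) x))"
    using open_S D by (intro set_lebesgue_integral_cong) (auto simp: numeral_2_eq_2)
  also have "\<dots> = (\<Sum>a\<in>UNIV. \<Sum>b\<in>UNIV. LINT x:S|lborel. M a b x * wirt a (\<lambda>y. \<eta> y [b]) x)"
    by (simp add: set_integral_sum ibp(1))
  also have "\<dots> = (\<Sum>a\<in>UNIV. \<Sum>b\<in>UNIV. - (LINT x:S|lborel. wirt a (M a b) x * \<eta> x [b]))"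
    by (simp only: ibp)
  also have "\<dots> = (LINT x:S|lborel. (\<Sum>a\<in>UNIV. \<Sum>b\<in>UNIV. - (wirt a (M a b) x * \<eta> x [b])))"
    by (simp add: set_integral_sum ibp(2) sum_negf set_integral_uminus)
  also have "\<dots> = (LINT x:S|lborel. form_inner (h x) 1 (\<eta> x) (\<theta> x) * det (h x))"
  proof (intro set_lebesgue_integral_cong allI impI)
    fix x assume x: "x \<in> S"
    have "form_inner (h x) 1 (\<eta> x) (\<theta> x) * det (h x) =
        (\<Sum>b\<in>UNIV. \<eta> x [b] * ((\<Sum>d\<in>UNIV. coframe_inner (h x) b d * cnj (\<theta> x [d])) * det (h x)))"
      unfolding form_inner_def tens_inner_1 by (simp add: sum_distrib_left sum_distrib_right mult_ac)
    also have "\<dots> = (\<Sum>b\<in>UNIV. \<Sum>a\<in>UNIV. - (wirt a (M a b) x * \<eta> x [b]))"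
      unfolding div[OF x] by (simp add: sum_distrib_left sum_negf mult.commute)
    also have "\<dots> = (\<Sum>a\<in>UNIV. \<Sum>b\<in>UNIV. - (wirt a (M a b) x * \<eta> x [b]))"
      by (rule sum.swap)
    finally show "(\<Sum>a\<in>UNIV. \<Sum>b\<in>UNIV. - (wirt a (M a b) x * \<eta> x [b])) =
        form_inner (h x) 1 (\<eta> x) (\<theta> x) * det (h x)" ..
  qed (use open_S in auto)
  finally show "(LINT x:S|lborel. form_inner (h x) (Suc 1) (D \<eta> x) (\<beta> x) * det (h x)) =
    (LINT x:S|lborel. form_inner (h x) 1 (\<eta> x) (\<theta> x) * det (h x))" .
qed

lemma coframe_inner_nondegenerate:
  assumes x: "x \<in> S" and 0: "\<And>b. (\<Sum>d\<in>UNIV. coframe_inner (h x) b d * v d) = 0"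
  shows "v d = 0"
proof (cases d)
  case (Inl i)
  have "(\<Sum>k\<in>UNIV. v (Inl k) * ginv (h x) k j) = 0" for j
    using 0[of "Inl j"] by (simp add: sum_idx mult.commute)
  then show ?thesis using ginv_left_contract[OF det_nz[OF x], of "\<lambda>k. v (Inl k)" i] Inl by simp
next
  case (Inr i)
  have "(\<Sum>k\<in>UNIV. ginv (h x) j k * v (Inr k)) = 0" for j
    using 0[of "Inr j"] by (simp add: sum_idx)
  then show ?thesis using ginv_right_contract[OF det_nz[OF x], of i "\<lambda>k. v (Inr k)"] Inr by simp
qed

text \<open>Testing against a bump function in a single component \<open>b\<close> shows that each component of the difference
of two adjoints, contracted with the pairing of covectors, vanishes; the pairing is nondegenerate.\<close>

lemma formal_adjoint_unique:
  assumes "is_formal_adjoint D S h 1 \<beta> \<theta>" "is_formal_adjoint D S h 1 \<beta> \<theta>'" and x0: "x0 \<in> S"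
  shows "\<theta> x0 [d] = \<theta>' x0 [d]"
proof -
  have sm: "smooth_on S (\<lambda>x. \<theta> x [d])" "smooth_on S (\<lambda>x. \<theta>' x [d])" for d
    using assms(1,2) by (auto simp: is_formal_adjoint_def smooth_form_on_def)
  define w where "w b x = (\<Sum>d\<in>UNIV. coframe_inner (h x) b d * cnj (\<theta> x [d] - \<theta>' x [d])) * det (h x)" for b x
  have "w b x0 = 0" for b
  proof (rule fundamental_lemma[OF open_S _ x0])
    show "continuous_on S (w b)"
      unfolding w_def by (intro smooth_on_imp_continuous_on smooth_intros smooth_coframe_inner sm smooth_det)
    fix r :: real assume r: "r > 0" "cball x0 r \<subseteq> S"
    define \<eta> :: "'n tens_field" where "\<eta> x as = (if as = [b] then of_real (bump x0 r x) else 0)" for x as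
    have "smooth_on UNIV (\<lambda>x. \<eta> x as)" for as
      unfolding \<eta>_def
      by (intro smooth_on_if smooth_on_bounded_linear_comp[OF open_UNIV bounded_linear_of_real]
          smooth_on_bump smooth_on_const open_UNIV)
    then have test: "test_form S 1 \<eta>"
      unfolding test_form_def smooth_form_on_def
      using r bump_eq_0[of r _ x0] by (auto simp: alternating_1[unfolded One_nat_def] \<eta>_def intro!: exI[of _ "cball x0 r"])
    define u where "u \<theta> x = (\<Sum>d\<in>UNIV. coframe_inner (h x) b d * cnj (\<theta> x [d])) * det (h x)" for \<theta> :: "'n tens_field" and x
    have fi: "form_inner (h x) 1 (\<eta> x) \<theta>x * det (h x) =
        of_real (bump x0 r x) * ((\<Sum>d\<in>UNIV. coframe_inner (h x) b d * cnj (\<theta>x [d])) * det (h x))" for \<theta>x x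
    proof -
      have "(\<Sum>a\<in>UNIV. \<Sum>d\<in>UNIV. coframe_inner (h x) a d * (\<eta> x [a] * cnj (\<theta>x [d]))) =
        (\<Sum>a\<in>UNIV. if a = b then (\<Sum>d\<in>UNIV. coframe_inner (h x) a d * (of_real (bump x0 r x) * cnj (\<theta>x [d]))) else 0)"
        by (rule sum.cong) (auto simp: \<eta>_def)
      then show ?thesis
        unfolding form_inner_def tens_inner_1 by (simp add: sum_distrib_left sum_distrib_right mult_ac)
    qed
    have int: "set_integrable lborel S (\<lambda>x. of_real (bump x0 r x) * u \<theta> x)"
      if "\<And>d. smooth_on S (\<lambda>x. \<theta> x [d])" for \<theta>
    proof (rule integrable_compact_support[OF open_S _ compact_cball r(2)])
      show "continuous_on S (\<lambda>x. of_real (bump x0 r x) * u \<theta> x)"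
        unfolding u_def
        by (intro smooth_on_imp_continuous_on smooth_intros smooth_coframe_inner that smooth_det
          smooth_on_bounded_linear_comp[OF open_S bounded_linear_of_real] smooth_on_bump open_S)
    qed (use bump_eq_0[of r _ x0] r in auto)
    have "(LINT x:S|lborel. of_real (bump x0 r x) * u \<theta> x) = (LINT x:S|lborel. of_real (bump x0 r x) * u \<theta>' x)"
    proof -
      have "(LINT x:S|lborel. form_inner (h x) 1 (\<eta> x) (\<theta> x) * det (h x)) =
          (LINT x:S|lborel. form_inner (h x) 1 (\<eta> x) (\<theta>' x) * det (h x))"
      proof (rule trans[OF sym])
        show "(LINT x:S|lborel. form_inner (h x) (Suc 1) (D \<eta> x) (\<beta> x) * det (h x)) =
            (LINT x:S|lborel. form_inner (h x) 1 (\<eta> x) (\<theta> x) * det (h x))"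
          using assms(1) test unfolding is_formal_adjoint_def by blast
        show "(LINT x:S|lborel. form_inner (h x) (Suc 1) (D \<eta> x) (\<beta> x) * det (h x)) =
            (LINT x:S|lborel. form_inner (h x) 1 (\<eta> x) (\<theta>' x) * det (h x))"
          using assms(2) test unfolding is_formal_adjoint_def by blast
      qed
      then show ?thesis unfolding fi u_def .
    qed
    moreover have "of_real (bump x0 r x) * w b x =
        of_real (bump x0 r x) * u \<theta> x - of_real (bump x0 r x) * u \<theta>' x" for x
      unfolding w_def u_def by (simp add: sum_subtractf algebra_simps)
    ultimately show "(LINT x:S|lborel. of_real (bump x0 r x) * w b x) = 0"
      by (simp add: set_integral_diff int sm)
  qed
  then have "(\<Sum>d\<in>UNIV. coframe_inner (h x0) b d * cnj (\<theta> x0 [d] - \<theta>' x0 [d])) = 0" for b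
    using det_nz[OF x0] by (simp add: w_def)
  then have "cnj (\<theta> x0 [d] - \<theta>' x0 [d]) = 0"
    by (rule coframe_inner_nondegenerate[OF x0])
  then show ?thesis by simp
qed

lemma formal_adjoint_eq:
  assumes "is_formal_adjoint D S h 1 \<beta> \<theta>" "x \<in> S"
  shows "formal_adjoint D S h 1 \<beta> x [d] = \<theta> x [d]"
  using formal_adjoint_unique[OF someI[of "is_formal_adjoint D S h 1 \<beta>", OF assms(1)] assms]
  by (simp add: formal_adjoint_def)

subsection \<open>The Bismut Ricci form in coordinates\<close>

text \<open>Only the mixed components of the two-form pair with \<open>\<omega>\<close>. The factor \<open>1/2\<close> in the inner product of
forms compensates for the two orders of the index pair.\<close>

lemma form_inner_dolb_fund_form:
  assumes "x \<in> S"
  shows "form_inner (h x) 2 (dolb \<eta> x) (fund_form (h x)) =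
    - \<i> * (\<Sum>i\<in>UNIV. \<Sum>j\<in>UNIV. ginv (h x) j i * wirt (Inl i) (\<lambda>y. \<eta> y [Inr j]) x)"
    and "form_inner (h x) 2 (dolbbar \<eta> x) (fund_form (h x)) =
    \<i> * (\<Sum>i\<in>UNIV. \<Sum>j\<in>UNIV. ginv (h x) j i * wirt (Inr j) (\<lambda>y. \<eta> y [Inl i]) x)"
proof -
  let ?g = "ginv (h x)"
  have gen: "form_inner (h x) 2 F (fund_form (h x)) =
     - \<i> / 2 * (\<Sum>i\<in>UNIV. \<Sum>j\<in>UNIV. ?g j i * (F [Inl i, Inr j] - F [Inr j, Inl i]))" for F
  proof -
    have 1: "(\<Sum>k\<in>UNIV. ?g k i * (\<Sum>l\<in>UNIV. ?g j l * (c * cnj (h x $ k $ l)))) = c * ?g j i" for i j c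
    proof -
      have "(\<Sum>k\<in>UNIV. ?g k i * (\<Sum>l\<in>UNIV. ?g j l * (c * cnj (h x $ k $ l)))) =
          c * (\<Sum>k\<in>UNIV. (\<Sum>l\<in>UNIV. ?g j l * h x $ l $ k) * ?g k i)"
        unfolding herm[OF assms, symmetric] sum_distrib_left sum_distrib_right
        by (intro sum.cong refl) (simp add: mult_ac)
      then show ?thesis by (simp add: ginv_left[OF det_nz[OF assms]] sum_delta_mult)
    qed
    have "tens_inner (h x) 2 F (fund_form (h x)) =
      (\<Sum>i\<in>UNIV. \<Sum>k\<in>UNIV. ?g k i * (\<Sum>j\<in>UNIV. \<Sum>l\<in>UNIV. ?g j l * (F [Inl i, Inr j] * cnj (\<i> * h x $ k $ l)))) +
      (\<Sum>j\<in>UNIV. \<Sum>l\<in>UNIV. ?g j l * (\<Sum>i\<in>UNIV. \<Sum>k\<in>UNIV. ?g k i * (F [Inr j, Inl i] * cnj (- \<i> * h x $ k $ l))))"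
      unfolding numeral_2_eq_2 tens_inner_Suc tens_inner_0
      by (simp add: sum_idx fund_form_def)
    also have "(\<Sum>i\<in>UNIV. \<Sum>k\<in>UNIV. ?g k i * (\<Sum>j\<in>UNIV. \<Sum>l\<in>UNIV. ?g j l * (F [Inl i, Inr j] * cnj (\<i> * h x $ k $ l)))) =
       (\<Sum>i\<in>UNIV. \<Sum>j\<in>UNIV. (\<Sum>k\<in>UNIV. ?g k i * (\<Sum>l\<in>UNIV. ?g j l * (- \<i> * F [Inl i, Inr j] * cnj (h x $ k $ l)))))"
      unfolding sum_distrib_left by (rule sum.cong[OF refl], subst sum.swap) (simp add: mult_ac)
    also have "\<dots> = (\<Sum>i\<in>UNIV. \<Sum>j\<in>UNIV. - \<i> * F [Inl i, Inr j] * ?g j i)"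
      by (simp only: 1)
    also have "(\<Sum>j\<in>UNIV. \<Sum>l\<in>UNIV. ?g j l * (\<Sum>i\<in>UNIV. \<Sum>k\<in>UNIV. ?g k i * (F [Inr j, Inl i] * cnj (- \<i> * h x $ k $ l)))) =
       (\<Sum>j\<in>UNIV. \<Sum>i\<in>UNIV. (\<Sum>k\<in>UNIV. ?g k i * (\<Sum>l\<in>UNIV. ?g j l * (\<i> * F [Inr j, Inl i] * cnj (h x $ k $ l)))))"
      unfolding sum_distrib_left
    proof (rule sum.cong[OF refl])
      fix j
      have "(\<Sum>l\<in>UNIV. \<Sum>i\<in>UNIV. \<Sum>k\<in>UNIV. ?g j l * (?g k i * (F [Inr j, Inl i] * cnj (- \<i> * h x $ k $ l)))) =
         (\<Sum>i\<in>UNIV. \<Sum>l\<in>UNIV. \<Sum>k\<in>UNIV. ?g j l * (?g k i * (F [Inr j, Inl i] * cnj (- \<i> * h x $ k $ l))))"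
        by (rule sum.swap)
      also have "\<dots> = (\<Sum>i\<in>UNIV. \<Sum>k\<in>UNIV. \<Sum>l\<in>UNIV. ?g j l * (?g k i * (F [Inr j, Inl i] * cnj (- \<i> * h x $ k $ l))))"
        by (rule sum.cong[OF refl], rule sum.swap)
      also have "\<dots> = (\<Sum>i\<in>UNIV. \<Sum>k\<in>UNIV. \<Sum>l\<in>UNIV. ?g k i * (?g j l * (\<i> * F [Inr j, Inl i] * cnj (h x $ k $ l))))"
        by (simp add: mult_ac)
      finally show "(\<Sum>l\<in>UNIV. \<Sum>i\<in>UNIV. \<Sum>k\<in>UNIV. ?g j l * (?g k i * (F [Inr j, Inl i] * cnj (- \<i> * h x $ k $ l)))) =
        (\<Sum>i\<in>UNIV. \<Sum>k\<in>UNIV. \<Sum>l\<in>UNIV. ?g k i * (?g j l * (\<i> * F [Inr j, Inl i] * cnj (h x $ k $ l))))" .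
    qed
    also have "\<dots> = (\<Sum>j\<in>UNIV. \<Sum>i\<in>UNIV. \<i> * F [Inr j, Inl i] * ?g j i)"
      by (simp only: 1)
    also have "\<dots> = (\<Sum>i\<in>UNIV. \<Sum>j\<in>UNIV. \<i> * F [Inr j, Inl i] * ?g j i)"
      by (rule sum.swap)
    finally show ?thesis
      unfolding form_inner_def sum.distrib[symmetric] sum_distrib_left sum_divide_distrib
      by (simp add: sum_distrib_left algebra_simps fact_2)
  qed
  show "form_inner (h x) 2 (dolb \<eta> x) (fund_form (h x)) =
    - \<i> * (\<Sum>i\<in>UNIV. \<Sum>j\<in>UNIV. ginv (h x) j i * wirt (Inl i) (\<lambda>y. \<eta> y [Inr j]) x)"
    unfolding gen dolb_def
    by (simp add: degree_filter sum_distrib_left)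
  show "form_inner (h x) 2 (dolbbar \<eta> x) (fund_form (h x)) =
    \<i> * (\<Sum>i\<in>UNIV. \<Sum>j\<in>UNIV. ginv (h x) j i * wirt (Inr j) (\<lambda>y. \<eta> y [Inl i]) x)"
    unfolding gen dolbbar_def
    by (simp add: degree_filter sum_distrib_left)
qed

lemma formal_adjoint_dolb:
  assumes x: "x \<in> S"
  shows "formal_adjoint dolb S h 1 (\<lambda>y. fund_form (h y)) x [Inr k] = - \<i> * cnj (tau x k)"
proof -
  define M where "M a b x = (case (a, b) of (Inl i, Inr j) \<Rightarrow> - \<i> * (ginv (h x) j i * det (h x)) | _ \<Rightarrow> 0)"
    for a b :: "'n idx" and x
  define \<theta> :: "'n tens_field" where "\<theta> x as = (case as of [Inr k] \<Rightarrow> - \<i> * cnj (tau x k) | _ \<Rightarrow> 0)" for x as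
  have \<theta>_simps: "\<theta> x [Inr k] = - \<i> * cnj (tau x k)" "\<theta> x [Inl k] = 0" for x k
    by (simp_all add: \<theta>_def)
  have M_simps: "M (Inl i) (Inr j) = (\<lambda>x. - \<i> * (ginv (h x) j i * det (h x)))"
    "M (Inl i) (Inl j) = (\<lambda>_. 0)" "M (Inr i) b = (\<lambda>_. 0)" for i j b
    by (auto simp: M_def)
  have "is_formal_adjoint dolb S h 1 (\<lambda>y. fund_form (h y)) \<theta>"
  proof (rule is_formal_adjointI)
    show "smooth_on S (M a b)" for a b
      by (cases a; cases b) (auto simp only: M_simps intro!: smooth_intros smooth_ginv smooth_det)
    show "smooth_on S (\<lambda>x. \<theta> x [d])" for d
      by (cases d) (auto simp only: \<theta>_simps intro!: smooth_intros smooth_tau)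
    show "form_inner (h x) 2 (dolb \<eta> x) (fund_form (h x)) * det (h x) =
        (\<Sum>a\<in>UNIV. \<Sum>b\<in>UNIV. M a b x * wirt a (\<lambda>y. \<eta> y [b]) x)" if "x \<in> S" for \<eta> x
      unfolding form_inner_dolb_fund_form[OF that] sum_idx M_simps
      by (simp add: sum_distrib_left sum_distrib_right mult_ac)
    show "(\<Sum>d\<in>UNIV. coframe_inner (h x) b d * cnj (\<theta> x [d])) * det (h x) =
        - (\<Sum>a\<in>UNIV. wirt a (M a b) x)" if x: "x \<in> S" for x b
    proof (cases b)
      case (Inl i)
      then show ?thesis by (simp add: sum_idx M_simps \<theta>_simps)
    next
      case (Inr j)
      have "(\<Sum>i\<in>UNIV. wirt (Inl i) (\<lambda>x. - \<i> * (ginv (h x) j i * det (h x))) x) =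
         - \<i> * (\<Sum>i\<in>UNIV. wirt (Inl i) (\<lambda>y. ginv (h y) j i * det (h y)) x)"
        unfolding sum_distrib_left
        by (intro sum.cong refl wirt_cmult differentiable_mult diff_ginv diff_det x)
      also have "\<dots> = - \<i> * ((\<Sum>k\<in>UNIV. ginv (h x) j k * tau x k) * det (h x))"
        unfolding divergence_ginv[OF x] ..
      finally show ?thesis using Inr
        by (simp add: sum_idx M_simps \<theta>_simps sum_distrib_left sum_distrib_right sum_negf mult_ac)
    qed
  qed
  from formal_adjoint_eq[OF this x] show ?thesis by (simp add: \<theta>_simps)
qed

text \<open>The conjugate of the computation for \<open>\<partial>\<close>: as \<open>det g\<close> is real and \<open>g\<close> is Hermitian, the divergence
in the barred directions is the conjugate of the one in \<open>divergence_ginv\<close>.\<close>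

lemma formal_adjoint_dolbbar:
  assumes x: "x \<in> S"
  shows "formal_adjoint dolbbar S h 1 (\<lambda>y. fund_form (h y)) x [Inl k] = \<i> * tau x k"
proof -
  define M where "M a b x = (case (a, b) of (Inr j, Inl i) \<Rightarrow> \<i> * (ginv (h x) j i * det (h x)) | _ \<Rightarrow> 0)"
    for a b :: "'n idx" and x
  define \<theta> :: "'n tens_field" where "\<theta> x as = (case as of [Inl k] \<Rightarrow> \<i> * tau x k | _ \<Rightarrow> 0)" for x as
  have \<theta>_simps: "\<theta> x [Inl k] = \<i> * tau x k" "\<theta> x [Inr k] = 0" for x k
    by (simp_all add: \<theta>_def)
  have M_simps: "M (Inr j) (Inl i) = (\<lambda>x. \<i> * (ginv (h x) j i * det (h x)))"
    "M (Inr i) (Inr j) = (\<lambda>_. 0)" "M (Inl i) b = (\<lambda>_. 0)" for i j b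
    by (auto simp: M_def)
  have "is_formal_adjoint dolbbar S h 1 (\<lambda>y. fund_form (h y)) \<theta>"
  proof (rule is_formal_adjointI)
    show "smooth_on S (M a b)" for a b
      by (cases a; cases b) (auto simp only: M_simps intro!: smooth_intros smooth_ginv smooth_det)
    show "smooth_on S (\<lambda>x. \<theta> x [d])" for d
      by (cases d) (auto simp only: \<theta>_simps intro!: smooth_intros smooth_tau)
    show "form_inner (h x) 2 (dolbbar \<eta> x) (fund_form (h x)) * det (h x) =
        (\<Sum>a\<in>UNIV. \<Sum>b\<in>UNIV. M a b x * wirt a (\<lambda>y. \<eta> y [b]) x)" if "x \<in> S" for \<eta> x
    proof -
      have sw: "(\<Sum>j\<in>UNIV. \<Sum>i\<in>UNIV. ginv (h x) j i * wirt (Inr j) (\<lambda>y. \<eta> y [Inl i]) x) =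
        (\<Sum>i\<in>UNIV. \<Sum>j\<in>UNIV. ginv (h x) j i * wirt (Inr j) (\<lambda>y. \<eta> y [Inl i]) x)"
        by (rule sum.swap)
      show ?thesis
        unfolding form_inner_dolb_fund_form[OF that] sum_idx M_simps sw[symmetric]
        by (simp add: sum_distrib_left sum_distrib_right mult_ac)
    qed
    show "(\<Sum>d\<in>UNIV. coframe_inner (h x) b d * cnj (\<theta> x [d])) * det (h x) =
        - (\<Sum>a\<in>UNIV. wirt a (M a b) x)" if x: "x \<in> S" for x b
    proof (cases b)
      case (Inr i)
      then show ?thesis by (simp add: sum_idx M_simps \<theta>_simps)
    next
      case (Inl i)
      have "wirt (Inr j) (\<lambda>x. \<i> * (ginv (h x) j i * det (h x))) x =
          \<i> * cnj (wirt (Inl j) (\<lambda>y. ginv (h y) i j * det (h y)) x)" for j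
      proof -
        have "wirt (Inr j) (\<lambda>x. \<i> * (ginv (h x) j i * det (h x))) x =
            \<i> * wirt (Inr j) (\<lambda>y. ginv (h y) j i * det (h y)) x"
          by (intro wirt_cmult differentiable_mult diff_ginv diff_det x)
        also have "wirt (Inr j) (\<lambda>y. ginv (h y) j i * det (h y)) x =
            wirt (Inr j) (\<lambda>y. cnj (ginv (h y) i j * det (h y))) x"
        proof (rule wirt_cong_open[OF open_S x])
          fix y assume y: "y \<in> S"
          have "cnj (det (h y)) = det (h y)"
            using det_hermitian_real[OF herm[OF y]] by (simp add: complex_eq_iff)
          then show "ginv (h y) j i * det (h y) = cnj (ginv (h y) i j * det (h y))"
            by (simp add: ginv_sym y)
        qed
        also have "\<dots> = cnj (wirt (bar (Inr j)) (\<lambda>y. ginv (h y) i j * det (h y)) x)"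
          by (intro wirt_cnj differentiable_mult diff_ginv diff_det x)
        finally show ?thesis by simp
      qed
      then have "(\<Sum>j\<in>UNIV. wirt (Inr j) (\<lambda>x. \<i> * (ginv (h x) j i * det (h x))) x) =
         \<i> * cnj (\<Sum>j\<in>UNIV. wirt (Inl j) (\<lambda>y. ginv (h y) i j * det (h y)) x)"
        by (simp add: sum_distrib_left)
      also have "\<dots> = \<i> * cnj ((\<Sum>k\<in>UNIV. ginv (h x) i k * tau x k) * det (h x))"
        unfolding divergence_ginv[OF x] ..
      also have "\<dots> = \<i> * ((\<Sum>k\<in>UNIV. ginv (h x) k i * cnj (tau x k)) * det (h x))"
        using det_hermitian_real[OF herm[OF x]] by (simp add: ginv_sym x complex_eq_iff[of "cnj (det (h x))"])
      finally show ?thesis using Inl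
        by (simp add: sum_idx M_simps \<theta>_simps sum_distrib_left sum_distrib_right sum_negf mult_ac)
    qed
  qed
  from formal_adjoint_eq[OF this x] show ?thesis by (simp add: \<theta>_simps)
qed

lemma bismut_P_eq:
  assumes x: "x \<in> S"
  shows "bismut_P S h x $ i $ j =
    wirt (Inl i) (\<lambda>y. cnj (tau y j)) x + wirt (Inr j) (\<lambda>y. tau y i) x
    - wirt (Inl i) (wirt (Inr j) (\<lambda>y. log_det h y [])) x"
proof -
  have "wirt (Inl i) (\<lambda>y. formal_adjoint dolb S h 1 (\<lambda>y. fund_form (h y)) y [Inr j]) x =
      wirt (Inl i) (\<lambda>y. - \<i> * cnj (tau y j)) x"
    by (rule wirt_cong_open[OF open_S x formal_adjoint_dolb])
  also have "\<dots> = - \<i> * wirt (Inl i) (\<lambda>y. cnj (tau y j)) x"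
    by (intro wirt_cmult smooth_differentiable[OF smooth_on_cnj[OF open_S smooth_tau] x])
  finally have 1: "wirt (Inl i) (\<lambda>y. formal_adjoint dolb S h 1 (\<lambda>y. fund_form (h y)) y [Inr j]) x =
      - \<i> * wirt (Inl i) (\<lambda>y. cnj (tau y j)) x" .
  have "wirt (Inr j) (\<lambda>y. formal_adjoint dolbbar S h 1 (\<lambda>y. fund_form (h y)) y [Inl i]) x =
      wirt (Inr j) (\<lambda>y. \<i> * tau y i) x"
    by (rule wirt_cong_open[OF open_S x formal_adjoint_dolbbar])
  also have "\<dots> = \<i> * wirt (Inr j) (\<lambda>y. tau y i) x"
    by (intro wirt_cmult smooth_differentiable[OF smooth_tau x])
  finally have 2: "wirt (Inr j) (\<lambda>y. formal_adjoint dolbbar S h 1 (\<lambda>y. fund_form (h y)) y [Inl i]) x =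
      \<i> * wirt (Inr j) (\<lambda>y. tau y i) x" .
  show ?thesis
    using 1 2 by (simp add: bismut_P_def bismut_rho11_def dolb_def dolbbar_def degree_filter field_simps)
qed

end

section \<open>The second Ricci curvature\<close>

context hermitian_domain
begin

definition dh :: "complex^'n \<Rightarrow> 'n \<Rightarrow> 'n \<Rightarrow> 'n \<Rightarrow> complex" where
  "dh x i k l = wirt (Inl i) (\<lambda>y. h y $ k $ l) x"

definition dbh :: "complex^'n \<Rightarrow> 'n \<Rightarrow> 'n \<Rightarrow> 'n \<Rightarrow> complex" where
  "dbh x j k l = wirt (Inr j) (\<lambda>y. h y $ k $ l) x"

definition ddbh :: "complex^'n \<Rightarrow> 'n \<Rightarrow> 'n \<Rightarrow> 'n \<Rightarrow> 'n \<Rightarrow> complex" where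
  "ddbh x i j k l = wirt (Inl i) (\<lambda>y. dbh y j k l) x"

text \<open>All terms of the curvature identities that are quadratic in the first derivatives of the metric are
brought to this one contraction \<open>g\<^bsup>\<bar>l a\<^esup> g\<^bsup>\<bar>b k\<^esup> f\<^bsub>klab\<^esub>\<close>, so that identities between them become
identities between the summands \<open>f\<close>.\<close>

definition quad :: "complex^'n \<Rightarrow> ('n \<Rightarrow> 'n \<Rightarrow> 'n \<Rightarrow> 'n \<Rightarrow> complex) \<Rightarrow> complex" where
  "quad x f = (\<Sum>k\<in>UNIV. \<Sum>l\<in>UNIV. \<Sum>a\<in>UNIV. \<Sum>b\<in>UNIV. ginv (h x) l a * ginv (h x) b k * f k l a b)"

text \<open>In coordinates, the trace \<open>g\<^bsup>\<bar>q p\<^esup> \<Omega>\<^bsub>p\<bar>q i\<bar>j\<^esub>\<close> of the Chern curvature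
\<open>\<Omega>\<^bsub>p\<bar>q i\<bar>j\<^esub> = - \<partial>\<^sub>p \<partial>\<^bsub>\<bar>q\<^esub> g\<^bsub>i\<bar>j\<^esub> + g\<^bsup>\<bar>b a\<^esup> \<partial>\<^sub>p g\<^bsub>i\<bar>b\<^esub> \<partial>\<^bsub>\<bar>q\<^esub> g\<^bsub>a\<bar>j\<^esub>\<close> over its
first two indices; see \<open>trace_curvature\<close>.\<close>

definition second_ricci :: "complex^'n \<Rightarrow> 'n \<Rightarrow> 'n \<Rightarrow> complex" where
  "second_ricci x i j = quad x (\<lambda>k l a b. dh x k i l * dbh x b a j)
     - (\<Sum>k\<in>UNIV. \<Sum>l\<in>UNIV. ginv (h x) l k * ddbh x k l i j)"

lemma smooth_dh: "smooth_on S (\<lambda>x. dh x i k l)"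
  unfolding dh_def by (intro smooth_wirt smooth_h)

lemma smooth_dbh: "smooth_on S (\<lambda>x. dbh x i k l)"
  unfolding dbh_def by (intro smooth_wirt smooth_h)

lemmas diff_dh = smooth_differentiable[OF smooth_dh]
lemmas diff_dbh = smooth_differentiable[OF smooth_dbh]

lemma cnj_dh: "x \<in> S \<Longrightarrow> cnj (dh x i k l) = dbh x i l k"
  using wirt_h_bar[of x "Inl i" l k] by (simp add: dh_def dbh_def)

lemma cnj_dbh: "x \<in> S \<Longrightarrow> cnj (dbh x i k l) = dh x i l k"
  by (simp flip: cnj_dh)

lemma wirt_dh: 
  assumes "x \<in> S"
  shows "wirt (Inr j) (\<lambda>y. dh y i k l) x = ddbh x i j k l"
  using wirt_commute[OF open_S smooth_h assms, of "Inr j" "Inl i"] unfolding ddbh_def dbh_def dh_def by simp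

lemma cnj_ddbh:
  assumes x: "x \<in> S"
  shows "cnj (ddbh x i j k l) = ddbh x j i l k"
proof -
  have "ddbh x j i l k = wirt (Inl j) (\<lambda>y. cnj (dh y i k l)) x"
    unfolding ddbh_def by (rule wirt_cong_open[OF open_S x]) (simp add: cnj_dh)
  also have "\<dots> = cnj (wirt (Inr j) (\<lambda>y. dh y i k l) x)"
    using wirt_cnj[OF diff_dh[OF x], of "Inl j"] by simp
  finally show ?thesis by (simp add: wirt_dh x)
qed

lemma torsion_eq: "torsion h x i j k = dh x i j k - dh x j i k"
  by (simp add: torsion_def dh_def)

lemma quad_add: "quad x f + quad x g = quad x (\<lambda>k l a b. f k l a b + g k l a b)"
  unfolding quad_def by (simp add: sum.distrib distrib_left)

lemma quad_diff: "quad x f - quad x g = quad x (\<lambda>k l a b. f k l a b - g k l a b)"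
  unfolding quad_def by (simp add: sum_subtractf right_diff_distrib)

lemma cnj_quad:
  assumes x: "x \<in> S"
  shows "cnj (quad x f) = quad x (\<lambda>k l a b. cnj (f b a l k))"
  unfolding quad_def cnj_sum sum.cartesian_product UNIV_Times_UNIV
  by (rule sum.reindex_bij_witness[of _ "\<lambda>(k, l, a, b). (b, a, l, k)" "\<lambda>(k, l, a, b). (b, a, l, k)"])
    (auto simp: ginv_sym x)

text \<open>The two inverse metrics in \<open>quad\<close> may be exchanged.\<close>

lemma quad_flip: "quad x f = quad x (\<lambda>k l a b. f a b k l)"
  unfolding quad_def sum.cartesian_product UNIV_Times_UNIV
  by (rule sum.reindex_bij_witness[of _ "\<lambda>(k, l, a, b). (a, b, k, l)" "\<lambda>(k, l, a, b). (a, b, k, l)"])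
    (auto simp: mult_ac)

lemma cnj_second_ricci:
  assumes x: "x \<in> S"
  shows "cnj (second_ricci x i j) = second_ricci x j i"
proof -
  have "cnj (\<Sum>k\<in>UNIV. \<Sum>l\<in>UNIV. ginv (h x) l k * ddbh x k l i j) =
      (\<Sum>k\<in>UNIV. \<Sum>l\<in>UNIV. ginv (h x) k l * ddbh x l k j i)"
    by (simp add: ginv_sym cnj_ddbh x)
  also have "\<dots> = (\<Sum>k\<in>UNIV. \<Sum>l\<in>UNIV. ginv (h x) l k * ddbh x k l j i)"
    by (rule sum.swap)
  finally show ?thesis
    by (simp add: second_ricci_def cnj_quad x cnj_dh cnj_dbh mult.commute)
qed

lemma wirt_bar_tau:
  assumes x: "x \<in> S"
  shows "wirt (Inr j) (\<lambda>y. tau y i) x =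
    (\<Sum>k\<in>UNIV. \<Sum>l\<in>UNIV. ginv (h x) l k * (ddbh x i j k l - ddbh x k j i l))
    - quad x (\<lambda>k l a b. dbh x j a b * (dh x i k l - dh x k i l))"
proof -
  have t: "wirt (Inr j) (\<lambda>y. torsion h y i k l) x = ddbh x i j k l - ddbh x k j i l" for k l
    unfolding torsion_eq by (simp add: wirt_diff diff_dh wirt_dh x)
  have dt: "(\<lambda>y. torsion h y i k l) differentiable (at x)" for k l
    by (rule smooth_differentiable[OF smooth_torsion x])
  have "wirt (Inr j) (\<lambda>y. ginv (h y) l k * torsion h y i k l) x =
      ginv (h x) l k * (ddbh x i j k l - ddbh x k j i l) -
      (\<Sum>a\<in>UNIV. \<Sum>b\<in>UNIV. ginv (h x) l a * ginv (h x) b k * (dbh x j a b * (dh x i k l - dh x k i l)))" for k l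
    by (simp add: wirt_mult diff_ginv dt t x wirt_ginv sum_distrib_right dbh_def[symmetric])
      (simp add: torsion_eq mult_ac)
  then show ?thesis
    unfolding tau_def quad_def sum_subtractf[symmetric]
    by (simp add: wirt_sum differentiable_mult diff_ginv dt x)
qed

lemma wirt_cnj_tau:
  assumes x: "x \<in> S"
  shows "wirt (Inl i) (\<lambda>y. cnj (tau y j)) x =
    (\<Sum>k\<in>UNIV. \<Sum>l\<in>UNIV. ginv (h x) l k * (ddbh x i j k l - ddbh x i l k j))
    - quad x (\<lambda>k l a b. dh x i k l * (dbh x j a b - dbh x b a j))"
proof -
  have "wirt (Inl i) (\<lambda>y. cnj (tau y j)) x = cnj (wirt (Inr i) (\<lambda>y. tau y j) x)"
    using wirt_cnj[OF smooth_differentiable[OF smooth_tau x], of "Inl i"] by simp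
  also have "\<dots> = (\<Sum>k\<in>UNIV. \<Sum>l\<in>UNIV. ginv (h x) k l * (ddbh x i j l k - ddbh x i k l j))
    - quad x (\<lambda>k l a b. dh x i k l * (dbh x j a b - dbh x b a j))"
    by (simp add: wirt_bar_tau x cnj_quad cnj_dh cnj_dbh cnj_ddbh ginv_sym)
  also have "(\<Sum>k\<in>UNIV. \<Sum>l\<in>UNIV. ginv (h x) k l * (ddbh x i j l k - ddbh x i k l j)) =
    (\<Sum>k\<in>UNIV. \<Sum>l\<in>UNIV. ginv (h x) l k * (ddbh x i j k l - ddbh x i l k j))"
    by (rule sum.swap)
  finally show ?thesis .
qed

lemma wirt_wirt_log_det:
  assumes x: "x \<in> S"
  shows "wirt (Inl i) (wirt (Inr j) (\<lambda>y. log_det h y [])) x =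
    (\<Sum>k\<in>UNIV. \<Sum>l\<in>UNIV. ginv (h x) l k * ddbh x i j k l)
    - quad x (\<lambda>k l a b. dh x i k l * dbh x j a b)"
proof -
  have "wirt (Inl i) (wirt (Inr j) (\<lambda>y. log_det h y [])) x =
      wirt (Inl i) (\<lambda>y. \<Sum>k\<in>UNIV. \<Sum>l\<in>UNIV. ginv (h y) l k * dbh y j k l) x"
    unfolding dbh_def by (rule wirt_cong_open[OF open_S x wirt_log_det])
  also have "\<dots> = (\<Sum>k\<in>UNIV. \<Sum>l\<in>UNIV. wirt (Inl i) (\<lambda>y. ginv (h y) l k * dbh y j k l) x)"
    by (simp add: wirt_sum differentiable_mult diff_ginv diff_dbh x)
  also have "\<dots> = (\<Sum>k\<in>UNIV. \<Sum>l\<in>UNIV. ginv (h x) l k * ddbh x i j k l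
      - (\<Sum>a\<in>UNIV. \<Sum>b\<in>UNIV. ginv (h x) l a * ginv (h x) b k * (dh x i a b * dbh x j k l)))"
    by (simp add: wirt_mult diff_ginv diff_dbh x wirt_ginv sum_distrib_right dh_def[symmetric] ddbh_def[symmetric])
      (simp add: mult_ac)
  also have "\<dots> = (\<Sum>k\<in>UNIV. \<Sum>l\<in>UNIV. ginv (h x) l k * ddbh x i j k l)
    - quad x (\<lambda>k l a b. dh x i a b * dbh x j k l)"
    by (simp add: quad_def sum_subtractf)
  finally show ?thesis by (subst quad_flip)
qed

lemma torsion_Q_eq:
  assumes x: "x \<in> S"
  shows "torsion_Q h x $ i $ j =
    quad x (\<lambda>k l a b. (dh x i k l - dh x k i l) * (dbh x j a b - dbh x b a j))"
  unfolding torsion_Q_def quad_def torsion_eq vec_lambda_beta sum.cartesian_product UNIV_Times_UNIV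
  by (rule sum.reindex_bij_witness[of _ "\<lambda>(k, l, a, b). (a, l, k, b)" "\<lambda>(a, l, k, b). (k, l, a, b)"])
    (auto simp: cnj_dh x)

text \<open>The identity is the component of \<open>\<partial>\<partial>\<bar>\<omega>\<close> with indices \<open>i, k, \<bar>j, \<bar>l\<close>, written out.\<close>

lemma pluriclosed_identity:
  assumes x: "x \<in> S" and pl: "dolb (dolbbar (\<lambda>y. fund_form (h y))) x [Inl i, Inl k, Inr j, Inr l] = 0"
  shows "ddbh x i j k l - ddbh x i l k j - ddbh x k j i l = - ddbh x k l i j"
proof -
  have f: "{m. m < Suc (Suc (Suc (Suc 0))) \<and> isl ([Inl i, Inl k, Inr j, Inr l] ! m)} = {0, 1}"
    by (auto simp: less_Suc_eq)
  have f': "{m. m < Suc (Suc (Suc 0)) \<and> \<not> isl ([Inl k, Inr j, Inr l] ! m)} = {1, 2}" for k :: 'n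
    by (auto simp: less_Suc_eq)
  have c: "wirt (Inr j) (\<lambda>y. \<i> * h y $ k $ l) y = \<i> * dbh y j k l" if "y \<in> S" for j k l y
    unfolding dbh_def using that by (intro wirt_cmult diff_h)
  have "wirt (Inl i) (\<lambda>y. - wirt (Inr j) (\<lambda>y. \<i> * h y $ k $ l) y + wirt (Inr l) (\<lambda>y. \<i> * h y $ k $ j) y) x =
    \<i> * (ddbh x i l k j - ddbh x i j k l)" for i k
  proof -
    have "wirt (Inl i) (\<lambda>y. - wirt (Inr j) (\<lambda>y. \<i> * h y $ k $ l) y + wirt (Inr l) (\<lambda>y. \<i> * h y $ k $ j) y) x =
      wirt (Inl i) (\<lambda>y. \<i> * (dbh y l k j - dbh y j k l)) x"
      by (rule wirt_cong_open[OF open_S x]) (simp add: c algebra_simps)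
    then show ?thesis by (simp add: wirt_cmult wirt_diff diff_dbh x ddbh_def differentiable_diff)
  qed
  then have "\<i> * (ddbh x i l k j - ddbh x i j k l) - \<i> * (ddbh x k l i j - ddbh x k j i l) = 0"
    using pl by (simp add: dolb_def dolbbar_def f f' fund_form_def numeral_2_eq_2)
  then have "\<i> * (ddbh x i l k j - ddbh x i j k l - (ddbh x k l i j - ddbh x k j i l)) = 0"
    by (simp add: right_diff_distrib)
  then have "ddbh x i l k j - ddbh x i j k l - (ddbh x k l i j - ddbh x k j i l) = 0"
    unfolding mult_eq_0_iff by simp
  then show ?thesis by (simp add: algebra_simps) 
qed

text \<open>The pluriclosed condition deals with the second derivatives. With \<open>D\<close> and \<open>E\<close> for the unbarred and
barred first derivatives of \<open>g\<close>, what is left is the expansion of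
\<open>(D\<^sub>i - D\<^sub>k) (E\<^sub>j - E\<^sub>b)\<close>, the quadratic term in \<open>Q\<close>: added to the terms
\<open>- D\<^sub>i E\<^sub>j + D\<^sub>i E\<^sub>b + D\<^sub>k E\<^sub>j\<close> of \<open>P\<close> it leaves \<open>D\<^sub>k E\<^sub>b\<close>, the quadratic term of \<open>S\<close>.\<close>

lemma bismut_P_plus_torsion_Q:
  assumes x: "x \<in> S"
    and pl: "\<And>as. length as = 4 \<Longrightarrow> dolb (dolbbar (\<lambda>y. fund_form (h y))) x as = 0"
  shows "bismut_P S h x $ i $ j + torsion_Q h x $ i $ j = second_ricci x i j"
proof -
  have "bismut_P S h x $ i $ j =
     (\<Sum>k\<in>UNIV. \<Sum>l\<in>UNIV. ginv (h x) l k * (ddbh x i j k l - ddbh x i l k j - ddbh x k j i l))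
     + (quad x (\<lambda>k l a b. dh x i k l * dbh x j a b)
      - quad x (\<lambda>k l a b. dh x i k l * (dbh x j a b - dbh x b a j))
      - quad x (\<lambda>k l a b. dbh x j a b * (dh x i k l - dh x k i l)))"
    unfolding bismut_P_eq[OF x] wirt_cnj_tau[OF x] wirt_bar_tau[OF x] wirt_wirt_log_det[OF x]
    by (simp add: sum_subtractf sum.distrib algebra_simps)
  also have "(\<Sum>k\<in>UNIV. \<Sum>l\<in>UNIV. ginv (h x) l k * (ddbh x i j k l - ddbh x i l k j - ddbh x k j i l)) =
      - (\<Sum>k\<in>UNIV. \<Sum>l\<in>UNIV. ginv (h x) l k * ddbh x k l i j)"
    by (simp add: pluriclosed_identity[OF x pl] sum_negf)
  finally have P: "bismut_P S h x $ i $ j = - (\<Sum>k\<in>UNIV. \<Sum>l\<in>UNIV. ginv (h x) l k * ddbh x k l i j)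
     + (quad x (\<lambda>k l a b. dh x i k l * dbh x j a b)
      - quad x (\<lambda>k l a b. dh x i k l * (dbh x j a b - dbh x b a j))
      - quad x (\<lambda>k l a b. dbh x j a b * (dh x i k l - dh x k i l)))" .
  have "quad x (\<lambda>k l a b. dh x k i l * dbh x b a j) =
      quad x (\<lambda>k l a b. dh x i k l * dbh x j a b)
      - quad x (\<lambda>k l a b. dh x i k l * (dbh x j a b - dbh x b a j))
      - quad x (\<lambda>k l a b. dbh x j a b * (dh x i k l - dh x k i l))
      + quad x (\<lambda>k l a b. (dh x i k l - dh x k i l) * (dbh x j a b - dbh x b a j))"
    unfolding quad_add quad_diff by (rule arg_cong[of _ _ "quad x"]) (simp add: fun_eq_iff algebra_simps)
  then show ?thesis
    unfolding torsion_Q_eq[OF x] second_ricci_def P by simp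
qed

lemma trace_curvature:
  assumes x: "x \<in> S"
  shows "(\<Sum>p\<in>UNIV. \<Sum>q\<in>UNIV. ginv (h x) p q * wirt (Inr p) (\<lambda>y. christoffel h y q i s) x) =
    - (\<Sum>\<beta>\<in>UNIV. ginv (h x) \<beta> s * second_ricci x i \<beta>)"
proof -
  have c: "wirt (Inr p) (\<lambda>y. christoffel h y q i s) x = (\<Sum>t\<in>UNIV. ginv (h x) t s * ddbh x q p i t)
     - (\<Sum>t\<in>UNIV. \<Sum>a\<in>UNIV. \<Sum>b\<in>UNIV. ginv (h x) t a * dbh x p a b * ginv (h x) b s * dh x q i t)" for p q
  proof -
    have "wirt (Inr p) (\<lambda>y. christoffel h y q i s) x =
       (\<Sum>t\<in>UNIV. wirt (Inr p) (\<lambda>y. ginv (h y) t s * dh y q i t) x)"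
      unfolding christoffel_def dh_def[symmetric]
      by (simp add: wirt_sum differentiable_mult diff_ginv diff_dh x)
    also have "\<dots> = (\<Sum>t\<in>UNIV. ginv (h x) t s * ddbh x q p i t -
       (\<Sum>a\<in>UNIV. \<Sum>b\<in>UNIV. ginv (h x) t a * dbh x p a b * ginv (h x) b s * dh x q i t))"
      by (simp add: wirt_mult diff_ginv diff_dh x wirt_ginv wirt_dh sum_distrib_right dbh_def)
    finally show ?thesis by (simp add: sum_subtractf)
  qed
  have "(\<Sum>p\<in>UNIV. \<Sum>q\<in>UNIV. ginv (h x) p q * (\<Sum>t\<in>UNIV. ginv (h x) t s * ddbh x q p i t)) =
      (\<Sum>\<beta>\<in>UNIV. ginv (h x) \<beta> s * (\<Sum>k\<in>UNIV. \<Sum>l\<in>UNIV. ginv (h x) l k * ddbh x k l i \<beta>))"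
    unfolding sum_distrib_left sum.cartesian_product UNIV_Times_UNIV
    by (rule sum.reindex_bij_witness[of _ "\<lambda>(t, q, p). (p, q, t)" "\<lambda>(p, q, t). (t, q, p)"]) (auto simp: mult_ac)
  moreover have "(\<Sum>p\<in>UNIV. \<Sum>q\<in>UNIV. ginv (h x) p q *
      (\<Sum>t\<in>UNIV. \<Sum>a\<in>UNIV. \<Sum>b\<in>UNIV. ginv (h x) t a * dbh x p a b * ginv (h x) b s * dh x q i t)) =
      (\<Sum>\<beta>\<in>UNIV. ginv (h x) \<beta> s * quad x (\<lambda>k l a b. dh x k i l * dbh x b a \<beta>))"
    unfolding quad_def sum_distrib_left sum.cartesian_product UNIV_Times_UNIV
    by (rule sum.reindex_bij_witness[of _ "\<lambda>(\<beta>, k, l, a, b). (b, k, l, a, \<beta>)" "\<lambda>(p, q, t, a, b). (b, q, t, a, p)"])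
      (auto simp: mult_ac)
  ultimately show ?thesis
    unfolding c second_ricci_def by (simp add: right_diff_distrib sum_subtractf)
qed

lemma trace_curvature_bar:
  assumes x: "x \<in> S"
  shows "(\<Sum>p\<in>UNIV. \<Sum>q\<in>UNIV. ginv (h x) p q * wirt (Inl q) (\<lambda>y. cnj (christoffel h y p j s)) x) =
    - (\<Sum>\<alpha>\<in>UNIV. ginv (h x) s \<alpha> * second_ricci x \<alpha> j)"
proof -
  have sm: "smooth_on S (\<lambda>y. christoffel h y p j s)" for p
    unfolding christoffel_def dh_def[symmetric] by (intro smooth_intros smooth_ginv smooth_dh)
  have w: "wirt (Inl q) (\<lambda>y. cnj (christoffel h y p j s)) x = cnj (wirt (Inr q) (\<lambda>y. christoffel h y p j s) x)" for p q
    using wirt_cnj[OF smooth_differentiable[OF sm x], of "Inl q"] by simp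
  have "(\<Sum>p\<in>UNIV. \<Sum>q\<in>UNIV. ginv (h x) p q * cnj (wirt (Inr q) (\<lambda>y. christoffel h y p j s) x)) =
     (\<Sum>q\<in>UNIV. \<Sum>p\<in>UNIV. ginv (h x) p q * cnj (wirt (Inr q) (\<lambda>y. christoffel h y p j s) x))"
    by (rule sum.swap)
  also have "\<dots> = cnj (\<Sum>q\<in>UNIV. \<Sum>p\<in>UNIV. ginv (h x) q p * wirt (Inr q) (\<lambda>y. christoffel h y p j s) x)"
    by (simp add: ginv_sym x)
  also have "\<dots> = - (\<Sum>\<alpha>\<in>UNIV. ginv (h x) s \<alpha> * second_ricci x \<alpha> j)"
    unfolding trace_curvature[OF x] by (simp add: ginv_sym cnj_second_ricci x)
  finally show ?thesis unfolding w .
qed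

end

section \<open>Covariant derivatives\<close>

lemma nabla_Nil: "nabla h A x [a] = wirt a (\<lambda>y. A y []) x"
  by (simp add: nabla_def)

lemma nabla_Cons:
  "nabla h A x (a # b # bs) = nabla h (\<lambda>y as. A y (b # as)) x (a # bs)
     - (\<Sum>c\<in>UNIV. conn h x a b c * A x (c # bs))"
  unfolding nabla_def by (simp add: sum.lessThan_Suc_shift del: sum.lessThan_Suc)

lemma conn_simps [simp]:
  "conn h x (Inl i) (Inl j) (Inl s) = christoffel h x i j s"
  "conn h x (Inr i) (Inr j) (Inr s) = cnj (christoffel h x i j s)"
  "conn h x (Inl i) (Inr j) c = 0" "conn h x (Inr i) (Inl j) c = 0"
  "conn h x (Inl i) b (Inr s) = 0" "conn h x (Inr i) b (Inl s) = 0"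
  by (simp_all add: conn_def split: sum.splits)

text \<open>The two derivatives may be taken one after the other, treating the inner index as a label and not as
a slot of the tensor: its connection coefficients in a direction of the opposite type vanish.\<close>

lemma nabla_mixed:
  "nabla h (nabla h A) x (Inl p # Inr q # as) =
   nabla h (\<lambda>y as. nabla h A y (Inr q # as)) x (Inl p # as)"
  by (simp add: nabla_Cons)

lemma nabla_diff:
  assumes "(\<lambda>y. A y bs) differentiable (at x)" "(\<lambda>y. B y bs) differentiable (at x)"
  shows "nabla h (\<lambda>y as. A y as - B y as) x (a # bs) = nabla h A x (a # bs) - nabla h B x (a # bs)"
  by (simp add: nabla_def wirt_diff assms right_diff_distrib sum_subtractf)

lemma nabla_sum_mult:
  fixes f :: "'c::finite \<Rightarrow> complex^'n::finite \<Rightarrow> complex"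
  assumes "\<And>c. f c differentiable (at x)" "\<And>c. (\<lambda>y. A c y bs) differentiable (at x)"
  shows "nabla h (\<lambda>y as. \<Sum>c\<in>UNIV. f c y * A c y as) x (a # bs) =
    (\<Sum>c\<in>UNIV. wirt a (f c) x * A c x bs + f c x * nabla h (A c) x (a # bs))"
proof -
  let ?G = "\<lambda>c m d. conn h x a (bs ! m) d * A c x (bs[m := d])"
  have "(\<Sum>m<length bs. \<Sum>d\<in>UNIV. conn h x a (bs ! m) d * (\<Sum>c\<in>UNIV. f c x * A c x (bs[m := d]))) =
    (\<Sum>m<length bs. \<Sum>d\<in>UNIV. \<Sum>c\<in>UNIV. f c x * ?G c m d)"
    by (simp add: sum_distrib_left mult_ac)
  also have "\<dots> = (\<Sum>m<length bs. \<Sum>c\<in>UNIV. \<Sum>d\<in>UNIV. f c x * ?G c m d)"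
    by (rule sum.cong[OF refl], rule sum.swap)
  also have "\<dots> = (\<Sum>c\<in>UNIV. \<Sum>m<length bs. \<Sum>d\<in>UNIV. f c x * ?G c m d)"
    by (rule sum.swap)
  also have "\<dots> = (\<Sum>c\<in>UNIV. f c x * (\<Sum>m<length bs. \<Sum>d\<in>UNIV. ?G c m d))"
    by (simp add: sum_distrib_left)
  finally show ?thesis
    by (simp add: nabla_def wirt_sum wirt_mult assms differentiable_mult right_diff_distrib sum_subtractf sum.distrib)
qed

lemma tens_inner_cong:
  assumes "\<And>as. length as = r \<Longrightarrow> A as = A' as" "\<And>as. length as = r \<Longrightarrow> B as = B' as"
  shows "tens_inner G r A B = tens_inner G r A' B'"
  unfolding tens_inner_def by (intro sum.cong) (auto simp: assms)

lemma tens_inner_diff_left: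
  "tens_inner G r (\<lambda>as. A as - A' as) B = tens_inner G r A B - tens_inner G r A' B"
  by (simp add: tens_inner_def algebra_simps sum_subtractf)

lemma tens_inner_diff_right:
  "tens_inner G r A (\<lambda>as. B as - B' as) = tens_inner G r A B - tens_inner G r A B'"
  by (simp add: tens_inner_def algebra_simps sum_subtractf)

lemma tens_inner_zero_left [simp]: "tens_inner G r (\<lambda>_. 0) B = 0"
  by (simp add: tens_inner_def)

lemma tens_inner_add_right:
  "tens_inner G r A (\<lambda>as. B as + B' as) = tens_inner G r A B + tens_inner G r A B'"
  by (simp add: tens_inner_def algebra_simps sum.distrib)

lemma tens_inner_sum_left:
  "tens_inner G r (\<lambda>as. \<Sum>i\<in>I. c i * A i as) B = (\<Sum>i\<in>I. c i * tens_inner G r (A i) B)"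
proof -
  have "(\<Sum>i\<in>I. c i * tens_inner G r (A i) B) = (\<Sum>as | length as = r. \<Sum>bs | length bs = r. \<Sum>i\<in>I.
      c i * ((\<Prod>m<r. coframe_inner G (as ! m) (bs ! m)) * A i as * cnj (B bs)))"
    unfolding tens_inner_def sum_distrib_left by (subst sum.swap, rule sum.cong[OF refl], rule sum.swap)
  then show ?thesis unfolding tens_inner_def by (simp add: sum_distrib_left sum_distrib_right mult_ac)
qed

lemma tens_inner_sum_right:
  "tens_inner G r A (\<lambda>as. \<Sum>i\<in>I. c i * B i as) = (\<Sum>i\<in>I. cnj (c i) * tens_inner G r A (B i))"
proof -
  have "(\<Sum>i\<in>I. cnj (c i) * tens_inner G r A (B i)) = (\<Sum>as | length as = r. \<Sum>bs | length bs = r. \<Sum>i\<in>I.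
      cnj (c i) * ((\<Prod>m<r. coframe_inner G (as ! m) (bs ! m)) * A as * cnj (B i bs)))"
    unfolding tens_inner_def sum_distrib_left by (subst sum.swap, rule sum.cong[OF refl], rule sum.swap)
  then show ?thesis unfolding tens_inner_def by (simp add: sum_distrib_left sum_distrib_right mult_ac)
qed

context hermitian_domain
begin

definition smooth_tensor :: "nat \<Rightarrow> 'n tens_field \<Rightarrow> bool" where
  "smooth_tensor r A \<longleftrightarrow> (\<forall>as. length as = r \<longrightarrow> smooth_on S (\<lambda>x. A x as))"

lemma smooth_christoffel: "smooth_on S (\<lambda>y. christoffel h y i j s)"
  unfolding christoffel_def by (intro smooth_intros smooth_ginv smooth_wirt smooth_h)

lemma smooth_conn: "smooth_on S (\<lambda>y. conn h y a b c)"
  by (cases a; cases b; cases c)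
    (auto intro: smooth_christoffel smooth_on_cnj[OF open_S] smooth_on_const[OF open_S])

lemma smooth_tensor_nabla:
  assumes "smooth_tensor r A"
  shows "smooth_tensor r (\<lambda>y as. nabla h A y (a # as))"
  using assms unfolding smooth_tensor_def nabla_def
  by (auto intro!: smooth_intros smooth_wirt smooth_conn)

lemma smooth_tensor_Cons: "smooth_tensor (Suc r) A \<Longrightarrow> smooth_tensor r (\<lambda>y as. A y (b # as))"
  unfolding smooth_tensor_def by auto

lemma smooth_tensor_differentiable:
  "smooth_tensor r A \<Longrightarrow> length as = r \<Longrightarrow> x \<in> S \<Longrightarrow> (\<lambda>y. A y as) differentiable (at x)"
  unfolding smooth_tensor_def using smooth_differentiable by blast

lemma smooth_tens_inner:
  assumes "smooth_tensor r A" "smooth_tensor r B"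
  shows "smooth_on S (\<lambda>x. tens_inner (h x) r (A x) (B x))"
  using assms unfolding tens_inner_def smooth_tensor_def
  by (auto intro!: smooth_intros smooth_coframe_inner)

text \<open>The curvature of the connection, in the sign convention in which it appears when it acts on covariant
tensors by \<open>\<nabla>\<^sub>a \<nabla>\<^sub>b - \<nabla>\<^sub>b \<nabla>\<^sub>a\<close>.\<close>

definition curv :: "complex^'n \<Rightarrow> 'n idx \<Rightarrow> 'n idx \<Rightarrow> 'n idx \<Rightarrow> 'n idx \<Rightarrow> complex" where
  "curv x a b d c = wirt b (\<lambda>y. conn h y a d c) x - wirt a (\<lambda>y. conn h y b d c) x
     + (\<Sum>e\<in>UNIV. conn h x a d e * conn h x b e c - conn h x b d e * conn h x a e c)"

text \<open>The first slot is split off. The middle sum is symmetric in \<open>a\<close> and \<open>b\<close> and disappears from the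
commutator; antisymmetrizing the last sum gives the curvature.\<close>

lemma nabla_nabla_Cons:
  assumes x: "x \<in> S" and A: "smooth_tensor (Suc (length bs)) A"
  shows "nabla h (\<lambda>y as. nabla h A y (b # as)) x (a # d # bs) =
    nabla h (\<lambda>y as. nabla h (\<lambda>y as. A y (d # as)) y (b # as)) x (a # bs)
    - (\<Sum>c\<in>UNIV. conn h x b d c * nabla h (\<lambda>y as. A y (c # as)) x (a # bs)
         + conn h x a d c * nabla h (\<lambda>y as. A y (c # as)) x (b # bs))
    - (\<Sum>c\<in>UNIV. (wirt a (\<lambda>y. conn h y b d c) x - (\<Sum>e\<in>UNIV. conn h x a d e * conn h x b e c)) * A x (c # bs))"
proof -
  have dA: "(\<lambda>y. A y (c # bs)) differentiable (at x)" for c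
    by (rule smooth_tensor_differentiable[OF A]) (use x in auto)
  have dN: "(\<lambda>y. nabla h (\<lambda>y as. A y (d # as)) y (b # bs)) differentiable (at x)"
    by (rule smooth_tensor_differentiable[OF smooth_tensor_nabla[OF smooth_tensor_Cons[OF A]]]) (use x in auto)
  have dc: "(\<lambda>y. conn h y b d c) differentiable (at x)" for c
    by (rule smooth_differentiable[OF smooth_conn x])
  have 1: "nabla h (\<lambda>y as. nabla h A y (b # d # as)) x (a # bs) =
     nabla h (\<lambda>y as. nabla h (\<lambda>y as. A y (d # as)) y (b # as)) x (a # bs)
     - (\<Sum>c\<in>UNIV. wirt a (\<lambda>y. conn h y b d c) x * A x (c # bs)
         + conn h x b d c * nabla h (\<lambda>y as. A y (c # as)) x (a # bs))"
    unfolding nabla_Cons[of h A]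
    by (subst nabla_diff) (simp_all add: dN differentiable_sum differentiable_mult dc dA nabla_sum_mult)
  have "(\<Sum>c\<in>UNIV. conn h x a d c * (\<Sum>e\<in>UNIV. conn h x b c e * A x (e # bs))) =
      (\<Sum>e\<in>UNIV. \<Sum>c\<in>UNIV. conn h x a d c * conn h x b c e * A x (e # bs))"
    unfolding sum_distrib_left by (subst sum.swap) (simp add: mult_ac)
  then have 2: "(\<Sum>c\<in>UNIV. conn h x a d c * nabla h A x (b # c # bs)) =
     (\<Sum>c\<in>UNIV. conn h x a d c * nabla h (\<lambda>y as. A y (c # as)) x (b # bs))
     - (\<Sum>c\<in>UNIV. (\<Sum>e\<in>UNIV. conn h x a d e * conn h x b e c) * A x (c # bs))"
    unfolding nabla_Cons[of h A] by (simp add: right_diff_distrib sum_subtractf sum_distrib_right)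
  show ?thesis
    unfolding nabla_Cons[of h "\<lambda>y as. nabla h A y (b # as)"] 1 2
    by (simp add: sum.distrib sum_subtractf left_diff_distrib)
qed

lemma nabla_commutator:
  assumes x: "x \<in> S"
  shows "smooth_tensor (length bs) A \<Longrightarrow>
    nabla h (\<lambda>y as. nabla h A y (b # as)) x (a # bs) - nabla h (\<lambda>y as. nabla h A y (a # as)) x (b # bs) =
    (\<Sum>m<length bs. \<Sum>c\<in>UNIV. curv x a b (bs ! m) c * A x (bs[m := c]))"
proof (induction bs arbitrary: A)
  case Nil
  have "smooth_on S (\<lambda>y. A y [])" using Nil by (simp add: smooth_tensor_def)
  from wirt_commute[OF open_S this x, of a b] show ?case by (simp add: nabla_Nil)
next
  case (Cons d bs)
  have A: "smooth_tensor (Suc (length bs)) A" using Cons.prems by simp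
  have "nabla h (\<lambda>y as. nabla h A y (b # as)) x (a # d # bs) - nabla h (\<lambda>y as. nabla h A y (a # as)) x (b # d # bs) =
    (nabla h (\<lambda>y as. nabla h (\<lambda>y as. A y (d # as)) y (b # as)) x (a # bs) -
     nabla h (\<lambda>y as. nabla h (\<lambda>y as. A y (d # as)) y (a # as)) x (b # bs)) +
    (\<Sum>c\<in>UNIV. curv x a b d c * A x (c # bs))"
    unfolding nabla_nabla_Cons[OF x A] curv_def
    by (simp add: sum.distrib sum_subtractf left_diff_distrib distrib_right)
  also have "nabla h (\<lambda>y as. nabla h (\<lambda>y as. A y (d # as)) y (b # as)) x (a # bs) -
     nabla h (\<lambda>y as. nabla h (\<lambda>y as. A y (d # as)) y (a # as)) x (b # bs) =
     (\<Sum>m<length bs. \<Sum>c\<in>UNIV. curv x a b (bs ! m) c * A x (d # bs[m := c]))"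
    by (rule Cons.IH[OF smooth_tensor_Cons[OF A]])
  finally show ?case by (simp add: sum.lessThan_Suc_shift del: sum.lessThan_Suc)
qed

text \<open>Metric compatibility for one-forms. In each type of direction only one of the two sums is nonzero; by
\<open>wirt_ginv\<close> it is the derivative of the inverse metric, because the Christoffel symbols are
\<open>g\<^sup>-\<^sup>1 \<partial>g\<close>.\<close>

lemma wirt_coframe_inner:
  assumes x: "x \<in> S"
  shows "wirt a (\<lambda>y. coframe_inner (h y) b d) x =
    - (\<Sum>e\<in>UNIV. conn h x a e b * coframe_inner (h x) e d)
    - (\<Sum>e\<in>UNIV. cnj (conn h x (bar a) e d) * coframe_inner (h x) b e)"
proof -
  have 1: "(\<Sum>m\<in>UNIV. christoffel h x k m i * ginv (h x) j m) =
      (\<Sum>m\<in>UNIV. \<Sum>l\<in>UNIV. ginv (h x) j m * dh x k m l * ginv (h x) l i)" for i j k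
    unfolding christoffel_def dh_def[symmetric] by (simp add: sum_distrib_left sum_distrib_right mult_ac)
  have "(\<Sum>m\<in>UNIV. cnj (christoffel h x k m j) * ginv (h x) m i) =
      (\<Sum>m\<in>UNIV. \<Sum>l\<in>UNIV. ginv (h x) j l * dbh x k l m * ginv (h x) m i)" for i j k
    unfolding christoffel_def dh_def[symmetric]
    by (simp add: sum_distrib_left sum_distrib_right mult_ac ginv_sym x cnj_dh)
  also have "(\<Sum>m\<in>UNIV. \<Sum>l\<in>UNIV. ginv (h x) j l * dbh x k l m * ginv (h x) m i) =
      (\<Sum>l\<in>UNIV. \<Sum>m\<in>UNIV. ginv (h x) j l * dbh x k l m * ginv (h x) m i)" for i j k
    by (rule sum.swap)
  finally have 2: "(\<Sum>m\<in>UNIV. cnj (christoffel h x k m j) * ginv (h x) m i) =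
      (\<Sum>l\<in>UNIV. \<Sum>m\<in>UNIV. ginv (h x) j l * dbh x k l m * ginv (h x) m i)" for i j k .
  show ?thesis
    by (cases a; cases b; cases d)
      (simp_all add: sum_idx 1 2 wirt_ginv x dh_def[symmetric] dbh_def[symmetric])
qed

text \<open>By induction on the rank: in the product rule for the recursion of the inner product, the derivative
of the pairing of the first slots supplies the connection terms of these slots.\<close>

lemma metric_compatible:
  assumes x: "x \<in> S"
  shows "smooth_tensor r A \<Longrightarrow> smooth_tensor r B \<Longrightarrow>
    wirt a (\<lambda>y. tens_inner (h y) r (A y) (B y)) x =
    tens_inner (h x) r (\<lambda>as. nabla h A x (a # as)) (B x) +
    tens_inner (h x) r (A x) (\<lambda>as. nabla h B x (bar a # as))"
proof (induction r arbitrary: A B)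
  case 0
  have d: "(\<lambda>y. A y []) differentiable (at x)" "(\<lambda>y. B y []) differentiable (at x)"
    using smooth_tensor_differentiable[OF 0(1) _ x] smooth_tensor_differentiable[OF 0(2) _ x] by auto
  have dc: "(\<lambda>y. cnj (B y [])) differentiable (at x)"
    using bounded_linear.has_derivative[OF bounded_linear_cnj] d(2) unfolding differentiable_def by blast
  show ?case using d dc by (simp add: tens_inner_0 nabla_Nil wirt_mult wirt_cnj)
next
  case (Suc r)
  let ?A = "\<lambda>b y as. A y (b # as)" and ?B = "\<lambda>d y bs. B y (d # bs)"
  let ?I = "tens_inner (h x) r" and ?c = "coframe_inner (h x)"
  note A = smooth_tensor_Cons[OF Suc.prems(1)] and B = smooth_tensor_Cons[OF Suc.prems(2)]
  have di: "(\<lambda>y. tens_inner (h y) r (?A b y) (?B d y)) differentiable (at x)" for b d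
    by (rule smooth_differentiable[OF smooth_tens_inner[OF A B] x])
  have dc: "(\<lambda>y. coframe_inner (h y) b d) differentiable (at x)" for b d
    by (rule smooth_differentiable[OF smooth_coframe_inner x])
  let ?X = "\<lambda>b d. ?c b d * (?I (\<lambda>as. nabla h (?A b) x (a # as)) (?B d x) + ?I (?A b x) (\<lambda>as. nabla h (?B d) x (bar a # as)))"
  let ?Y = "\<lambda>b d. (\<Sum>e\<in>UNIV. conn h x a e b * ?c e d) * ?I (?A b x) (?B d x)"
  let ?Z = "\<lambda>b d. (\<Sum>e\<in>UNIV. cnj (conn h x (bar a) e d) * ?c b e) * ?I (?A b x) (?B d x)"
  have "wirt a (\<lambda>y. tens_inner (h y) (Suc r) (A y) (B y)) x = (\<Sum>b\<in>UNIV. \<Sum>d\<in>UNIV. ?X b d - ?Y b d - ?Z b d)"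
    unfolding tens_inner_Suc
    by (simp add: wirt_sum wirt_mult differentiable_sum differentiable_mult di dc wirt_coframe_inner x Suc.IH[OF A B]
      algebra_simps)
  also have "\<dots> = (\<Sum>b\<in>UNIV. \<Sum>d\<in>UNIV. ?X b d) - (\<Sum>b\<in>UNIV. \<Sum>d\<in>UNIV. ?Y b d) - (\<Sum>b\<in>UNIV. \<Sum>d\<in>UNIV. ?Z b d)"
    by (simp add: sum_subtractf)
  also have "(\<Sum>b\<in>UNIV. \<Sum>d\<in>UNIV. ?Y b d) =
      (\<Sum>b\<in>UNIV. \<Sum>d\<in>UNIV. ?c b d * (\<Sum>e\<in>UNIV. conn h x a b e * ?I (?A e x) (?B d x)))"
    unfolding sum_distrib_left sum_distrib_right sum.cartesian_product UNIV_Times_UNIV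
    by (rule sum.reindex_bij_witness[of _ "\<lambda>(b, d, e). (e, d, b)" "\<lambda>(b, d, e). (e, d, b)"]) (auto simp: mult_ac)
  also have "(\<Sum>b\<in>UNIV. \<Sum>d\<in>UNIV. ?Z b d) =
      (\<Sum>b\<in>UNIV. \<Sum>d\<in>UNIV. ?c b d * (\<Sum>e\<in>UNIV. cnj (conn h x (bar a) d e) * ?I (?A b x) (?B e x)))"
    unfolding sum_distrib_left sum_distrib_right sum.cartesian_product UNIV_Times_UNIV
    by (rule sum.reindex_bij_witness[of _ "\<lambda>(b, d, e). (b, e, d)" "\<lambda>(b, d, e). (b, e, d)"]) (auto simp: mult_ac)
  finally show ?case
    unfolding tens_inner_Suc nabla_Cons tens_inner_diff_left tens_inner_diff_right
      tens_inner_sum_left tens_inner_sum_right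
    by (simp add: sum_subtractf sum.distrib algebra_simps)
qed

subsection \<open>The Bochner formula\<close>

text \<open>For one barred and one unbarred direction the products of connection coefficients vanish.\<close>

lemma curv_simps:
  "curv x (Inr p) (Inl q) (Inl i) (Inl s) = - wirt (Inr p) (\<lambda>y. christoffel h y q i s) x"
  "curv x (Inr p) (Inl q) (Inr j) (Inr s) = wirt (Inl q) (\<lambda>y. cnj (christoffel h y p j s)) x"
  "curv x (Inr p) (Inl q) (Inl i) (Inr s) = 0"
  "curv x (Inr p) (Inl q) (Inr j) (Inl s) = 0"
  by (simp_all add: curv_def sum_idx)

lemma circ_add:
  "circ G P B as + circ G Q B as = circ G (P + Q) B as"
  unfolding circ_def sum.distrib[symmetric]
  by (intro sum.cong refl)
    (auto simp: algebra_simps sum.distrib[symmetric] split: sum.split)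

text \<open>Contracting the curvature term of the commutator gives the second Ricci curvature in each slot, with
the sign depending on the type of the slot as in the definition of \<open>\<circ>\<close>.\<close>

lemma trace_curv:
  assumes x: "x \<in> S"
    and K: "\<And>i j. K $ i $ j = second_ricci x i j"
  shows "(\<Sum>p\<in>UNIV. \<Sum>q\<in>UNIV. ginv (h x) p q *
      (\<Sum>m<length as. \<Sum>c\<in>UNIV. curv x (Inr p) (Inl q) (as ! m) c * B (as[m := c]))) =
    - circ (h x) K B as"
proof -
  have "(\<Sum>p\<in>UNIV. \<Sum>q\<in>UNIV. ginv (h x) p q *
      (\<Sum>m<length as. \<Sum>c\<in>UNIV. curv x (Inr p) (Inl q) (as ! m) c * B (as[m := c]))) =
    (\<Sum>m<length as. \<Sum>c\<in>UNIV. (\<Sum>p\<in>UNIV. \<Sum>q\<in>UNIV. ginv (h x) p q * curv x (Inr p) (Inl q) (as ! m) c) *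
        B (as[m := c]))"
    unfolding sum_distrib_left sum_distrib_right sum.cartesian_product
    by (rule sum.reindex_bij_witness[of _ "\<lambda>(m, c, p, q). (p, q, m, c)" "\<lambda>(p, q, m, c). (m, c, p, q)"])
      (auto simp: mult_ac)
  also have "\<dots> = - circ (h x) K B as"
    unfolding circ_def
  proof (subst sum_negf[symmetric], intro sum.cong refl)
    fix m
    show "(\<Sum>c\<in>UNIV. (\<Sum>p\<in>UNIV. \<Sum>q\<in>UNIV. ginv (h x) p q * curv x (Inr p) (Inl q) (as ! m) c) * B (as[m := c])) =
      - (case as ! m of
          Inl p \<Rightarrow> - (\<Sum>\<alpha>\<in>UNIV. \<Sum>\<beta>\<in>UNIV. ginv (h x) \<beta> \<alpha> * K $ p $ \<beta> * B (as[m := Inl \<alpha>]))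
        | Inr q \<Rightarrow> \<Sum>\<alpha>\<in>UNIV. \<Sum>\<beta>\<in>UNIV. ginv (h x) \<beta> \<alpha> * K $ \<alpha> $ q * B (as[m := Inr \<beta>]))"
    proof (cases "as ! m")
      case (Inl i)
      have tr: "(\<Sum>p\<in>UNIV. \<Sum>q\<in>UNIV. ginv (h x) p q * - wirt (Inr p) (\<lambda>y. christoffel h y q i s) x) =
          (\<Sum>\<beta>\<in>UNIV. ginv (h x) \<beta> s * second_ricci x i \<beta>)" for s
        using trace_curvature[OF x, of i s] by (simp add: sum_negf)
      show ?thesis
        unfolding Inl sum_idx curv_simps K tr by (simp add: sum_distrib_right)
    next
      case (Inr j)
      have sw: "(\<Sum>\<alpha>\<in>UNIV. \<Sum>\<beta>\<in>UNIV. ginv (h x) \<beta> \<alpha> * K $ \<alpha> $ j * B (as[m := Inr \<beta>])) =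
          (\<Sum>\<beta>\<in>UNIV. \<Sum>\<alpha>\<in>UNIV. ginv (h x) \<beta> \<alpha> * K $ \<alpha> $ j * B (as[m := Inr \<beta>]))"
        by (rule sum.swap)
      show ?thesis
        unfolding Inr sum_idx curv_simps trace_curvature_bar[OF x] sum.case sw
        by (simp add: K sum_distrib_right sum_negf)
    qed
  qed
  finally show ?thesis .
qed

lemma tens_inner_nabla10:
  "tens_inner (h x) (Suc r) (nabla10 h A x) (nabla10 h B x) =
    (\<Sum>p\<in>UNIV. \<Sum>q\<in>UNIV. ginv (h x) q p *
      tens_inner (h x) r (\<lambda>as. nabla h A x (Inl p # as)) (\<lambda>as. nabla h B x (Inl q # as)))"
  unfolding tens_inner_Suc by (simp add: sum_idx nabla10_def)

lemma tens_inner_nabla01: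
  "tens_inner (h x) (Suc r) (nabla01 h A x) (nabla01 h B x) =
    (\<Sum>p\<in>UNIV. \<Sum>q\<in>UNIV. ginv (h x) q p *
      tens_inner (h x) r (\<lambda>as. nabla h A x (Inr q # as)) (\<lambda>as. nabla h B x (Inr p # as)))"
  unfolding tens_inner_Suc by (simp add: sum_idx nabla01_def) (rule sum.swap)

lemma chern_laplacian_eq:
  "chern_laplacian h A x as = (\<Sum>p\<in>UNIV. \<Sum>q\<in>UNIV. ginv (h x) q p *
     nabla h (\<lambda>y as. nabla h A y (Inr q # as)) x (Inl p # as))"
  unfolding chern_laplacian_def nabla_mixed ..

lemma conjugate_laplacian:
  assumes x: "x \<in> S" and B: "smooth_tensor (length as) B"
    and K: "\<And>i j. K $ i $ j = second_ricci x i j"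
  shows "(\<Sum>p\<in>UNIV. \<Sum>q\<in>UNIV. ginv (h x) p q *
      nabla h (\<lambda>y as. nabla h B y (Inl q # as)) x (Inr p # as)) =
    chern_laplacian h B x as - circ (h x) K (B x) as"
proof -
  let ?N = "\<lambda>a b. nabla h (\<lambda>y as. nabla h B y (b # as)) x (a # as)"
  let ?R = "\<lambda>p q. \<Sum>m<length as. \<Sum>c\<in>UNIV. curv x (Inr p) (Inl q) (as ! m) c * B x (as[m := c])"
  have "?N (Inr p) (Inl q) = ?N (Inl q) (Inr p) + ?R p q" for p q
    using nabla_commutator[OF x B, of "Inl q" "Inr p"] by (simp add: diff_eq_eq)
  then have "(\<Sum>p\<in>UNIV. \<Sum>q\<in>UNIV. ginv (h x) p q * ?N (Inr p) (Inl q)) =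
     (\<Sum>p\<in>UNIV. \<Sum>q\<in>UNIV. ginv (h x) p q * ?N (Inl q) (Inr p)) +
     (\<Sum>p\<in>UNIV. \<Sum>q\<in>UNIV. ginv (h x) p q * ?R p q)"
    by (simp only: distrib_left sum.distrib)
  also have "(\<Sum>p\<in>UNIV. \<Sum>q\<in>UNIV. ginv (h x) p q * ?N (Inl q) (Inr p)) = chern_laplacian h B x as"
    unfolding chern_laplacian_eq by (rule sum.swap)
  also have "(\<Sum>p\<in>UNIV. \<Sum>q\<in>UNIV. ginv (h x) p q * ?R p q) = - circ (h x) K (B x) as"
    by (rule trace_curv[OF x K])
  finally show ?thesis by simp
qed

text \<open>The formula for an arbitrary Hermitian metric, where the second Ricci curvature takes the place of
\<open>P + Q\<close>.\<close>

lemma bochner_formula: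
  assumes x: "x \<in> S" and B: "smooth_tensor r B"
    and K: "\<And>i j. K $ i $ j = second_ricci x i j"
  shows "chern_laplacian h (\<lambda>y _. tens_inner (h y) r (B y) (B y)) x [] =
      tens_inner (h x) r (chern_laplacian h B x) (B x)
    + tens_inner (h x) r (B x) (chern_laplacian h B x)
    + tens_inner (h x) (Suc r) (nabla10 h B x) (nabla10 h B x)
    + tens_inner (h x) (Suc r) (nabla01 h B x) (nabla01 h B x)
    - tens_inner (h x) r (B x) (circ (h x) K (B x))"
proof -
  let ?I = "tens_inner (h x) r"
  define N where "N a y as = nabla h B y (a # as)" for a y as
  have N: "smooth_tensor r (N a)" for a
    unfolding N_def by (rule smooth_tensor_nabla[OF B])
  have comp: "wirt a (\<lambda>y. tens_inner (h y) r (A y) (A' y)) y =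
      tens_inner (h y) r (\<lambda>as. nabla h A y (a # as)) (A' y) +
      tens_inner (h y) r (A y) (\<lambda>as. nabla h A' y (bar a # as))"
    if "smooth_tensor r A" "smooth_tensor r A'" "y \<in> S" for a A A' y
    using metric_compatible that by blast
  have d: "(\<lambda>y. tens_inner (h y) r (A y) (A' y)) differentiable (at x)"
    if "smooth_tensor r A" "smooth_tensor r A'" for A A'
    by (rule smooth_differentiable[OF smooth_tens_inner[OF that] x])
  have hess: "wirt (Inl p) (wirt (Inr q) (\<lambda>y. tens_inner (h y) r (B y) (B y))) x =
      ?I (\<lambda>as. nabla h (N (Inr q)) x (Inl p # as)) (B x) + ?I (N (Inr q) x) (N (Inr p) x)
    + ?I (N (Inl p) x) (N (Inl q) x) + ?I (B x) (\<lambda>as. nabla h (N (Inl q)) x (Inr p # as))" for p q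
  proof -
    have "wirt (Inl p) (wirt (Inr q) (\<lambda>y. tens_inner (h y) r (B y) (B y))) x =
      wirt (Inl p) (\<lambda>y. tens_inner (h y) r (N (Inr q) y) (B y) + tens_inner (h y) r (B y) (N (Inl q) y)) x"
      by (rule wirt_cong_open[OF open_S x]) (simp add: comp B N_def[abs_def])
    also have "\<dots> = wirt (Inl p) (\<lambda>y. tens_inner (h y) r (N (Inr q) y) (B y)) x
       + wirt (Inl p) (\<lambda>y. tens_inner (h y) r (B y) (N (Inl q) y)) x"
      by (rule wirt_add) (intro d N B)+
    finally show ?thesis
      by (simp add: comp N B x) (simp add: N_def[abs_def])
  qed
  have "chern_laplacian h (\<lambda>y _. tens_inner (h y) r (B y) (B y)) x [] =
     (\<Sum>p\<in>UNIV. \<Sum>q\<in>UNIV. ginv (h x) q p *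
       wirt (Inl p) (wirt (Inr q) (\<lambda>y. tens_inner (h y) r (B y) (B y))) x)"
    unfolding chern_laplacian_eq nabla_Nil by simp
  also have "\<dots> = (\<Sum>p\<in>UNIV. \<Sum>q\<in>UNIV. ginv (h x) q p * ?I (\<lambda>as. nabla h (N (Inr q)) x (Inl p # as)) (B x))
     + (\<Sum>p\<in>UNIV. \<Sum>q\<in>UNIV. ginv (h x) q p * ?I (N (Inr q) x) (N (Inr p) x))
     + (\<Sum>p\<in>UNIV. \<Sum>q\<in>UNIV. ginv (h x) q p * ?I (N (Inl p) x) (N (Inl q) x))
     + (\<Sum>p\<in>UNIV. \<Sum>q\<in>UNIV. ginv (h x) q p * ?I (B x) (\<lambda>as. nabla h (N (Inl q)) x (Inr p # as)))"
    by (simp only: hess distrib_left sum.distrib)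
  also have "(\<Sum>p\<in>UNIV. \<Sum>q\<in>UNIV. ginv (h x) q p * ?I (\<lambda>as. nabla h (N (Inr q)) x (Inl p # as)) (B x)) =
      ?I (chern_laplacian h B x) (B x)"
  proof -
    have "?I (chern_laplacian h B x) (B x) = ?I (\<lambda>as. \<Sum>p\<in>UNIV. 1 * (\<Sum>q\<in>UNIV. ginv (h x) q p *
        nabla h (N (Inr q)) x (Inl p # as))) (B x)"
      by (rule tens_inner_cong) (simp_all add: chern_laplacian_eq N_def[abs_def])
    then show ?thesis unfolding tens_inner_sum_left by simp
  qed
  also have "(\<Sum>p\<in>UNIV. \<Sum>q\<in>UNIV. ginv (h x) q p * ?I (N (Inr q) x) (N (Inr p) x)) =
      tens_inner (h x) (Suc r) (nabla01 h B x) (nabla01 h B x)"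
    by (simp add: tens_inner_nabla01 N_def[abs_def])
  also have "(\<Sum>p\<in>UNIV. \<Sum>q\<in>UNIV. ginv (h x) q p * ?I (N (Inl p) x) (N (Inl q) x)) =
      tens_inner (h x) (Suc r) (nabla10 h B x) (nabla10 h B x)"
    by (simp add: tens_inner_nabla10 N_def[abs_def])
  also have "(\<Sum>p\<in>UNIV. \<Sum>q\<in>UNIV. ginv (h x) q p * ?I (B x) (\<lambda>as. nabla h (N (Inl q)) x (Inr p # as))) =
      ?I (B x) (chern_laplacian h B x) - ?I (B x) (circ (h x) K (B x))"
  proof -
    have "?I (B x) (chern_laplacian h B x) - ?I (B x) (circ (h x) K (B x)) =
       ?I (B x) (\<lambda>as. \<Sum>p\<in>UNIV. 1 * (\<Sum>q\<in>UNIV. ginv (h x) p q * nabla h (N (Inl q)) x (Inr p # as)))"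
      unfolding tens_inner_diff_right[symmetric] N_def[abs_def]
      by (rule tens_inner_cong) (use conjugate_laplacian[OF x _ K] B in auto)
    then show ?thesis unfolding tens_inner_sum_right by (simp add: ginv_sym x)
  qed
  finally show ?thesis by simp
qed

end

theorem corollary4p4:
  fixes \<A> :: "('m::{t2_space,second_countable_topology}, 'n::finite) chart set"
    and g :: "('m, 'n) chart \<Rightarrow> complex^'n \<Rightarrow> complex^'n^'n"
    and A :: "('m, 'n) chart \<Rightarrow> 'n tens_field"
    and r :: nat and U :: "'m set" and \<phi> :: "'m \<Rightarrow> complex^'n" and p :: 'm
  assumes "complex_atlas \<A>"
    and "hermitian_metric \<A> g"
    and "pluriclosed \<A> g"
    and "tensor_field \<A> r A"
    and "(U, \<phi>) \<in> \<A>" and "p \<in> U"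
  shows "let S = \<phi> ` U; x = \<phi> p; h = g (U, \<phi>); B = A (U, \<phi>) in
    chern_laplacian h (\<lambda>y _. tens_inner (h y) r (B y) (B y)) x [] =
      tens_inner (h x) r (chern_laplacian h B x) (B x)
    + tens_inner (h x) r (B x) (chern_laplacian h B x)
    + tens_inner (h x) (Suc r) (nabla10 h B x) (nabla10 h B x)
    + tens_inner (h x) (Suc r) (nabla01 h B x) (nabla01 h B x)
    - tens_inner (h x) r (B x) (circ (h x) (bismut_P S h x) (B x))
    - tens_inner (h x) r (B x) (circ (h x) (torsion_Q h x) (B x))"
proof -
  define S where "S = \<phi> ` U"
  define h where "h = g (U, \<phi>)"
  define B where "B = A (U, \<phi>)"
  have x: "\<phi> p \<in> S" using assms(6) by (simp add: S_def)
  have metric: "tensor_field \<A> 2 (\<lambda>c x. metric_tens (g c x))"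
    using assms(2) by (simp add: hermitian_metric_def)
  interpret hermitian_domain S h
  proof
    show "open S" using assms(1,5) by (auto simp: complex_atlas_def S_def)
    show "smooth_on S (\<lambda>x. h x $ i $ j)" for i j
    proof -
      have "smooth_on S (\<lambda>x. metric_tens (h x) [Inl i, Inr j])"
        using metric assms(5) unfolding tensor_field_def S_def h_def by fastforce
      then show ?thesis by (simp add: metric_tens_def)
    qed
    show "h x $ j $ i = cnj (h x $ i $ j)" if "x \<in> S" for x i j
      using assms(2,5) that unfolding hermitian_metric_def S_def h_def by fast
    show "posdef (h x)" if "x \<in> S" for x
      using assms(2,5) that unfolding hermitian_metric_def posdef_def S_def h_def by fast
  qed
  have B: "smooth_tensor r B"
    using assms(4,5) unfolding smooth_tensor_def unfolding tensor_field_def S_def B_def by fast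
  have pl: "dolb (dolbbar (\<lambda>y. fund_form (h y))) (\<phi> p) as = 0" if "length as = 4" for as
    using assms(3,5) x that unfolding pluriclosed_def S_def h_def by fast
  have "(bismut_P S h (\<phi> p) + torsion_Q h (\<phi> p)) $ i $ j = second_ricci (\<phi> p) i j" for i j
    using bismut_P_plus_torsion_Q[OF x pl] by simp
  note bochner_formula[OF x B this]
  moreover have "tens_inner (h (\<phi> p)) r (B (\<phi> p))
        (circ (h (\<phi> p)) (bismut_P S h (\<phi> p) + torsion_Q h (\<phi> p)) (B (\<phi> p))) =
      tens_inner (h (\<phi> p)) r (B (\<phi> p)) (circ (h (\<phi> p)) (bismut_P S h (\<phi> p)) (B (\<phi> p))) +
      tens_inner (h (\<phi> p)) r (B (\<phi> p)) (circ (h (\<phi> p)) (torsion_Q h (\<phi> p)) (B (\<phi> p)))"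
    unfolding circ_add[symmetric] tens_inner_add_right ..
  ultimately show ?thesis
    unfolding Let_def S_def h_def B_def by simp
qed

end
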